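(* Let $M_1$ and $M_2$ be connected compact oriented triangulated three-dimensional manifolds, with real vertex coordinates in general position, and let $M$ be the manifold obtained by gluing $M_1$ and $M_2$ by one common boundary component $\Gamma$ (identically triangulated in $M_1$ and $M_2$, with the same vertex coordinates and the same minimal rigid construction, and with opposite orientations). Then the generating functions of the invariants of $M$, $M_1$ and $M_2$ are related by $$\mathbf I_M=\frac{(-1)^{N_\Gamma}\,\tau_\Gamma^2}{\prod_{\text{over edges in }\Gamma}l^2}\int \mathbf I_{M_1}\,\mathbf I_{M_2}\prod_{i\in\mathcal E_\Gamma}da_i^*\,da_i .$$ Here $\tau_\Gamma=\dfrac{\operatorname{minor}g_1}{\operatorname{minor}g_2}$ is the torsion of the acyclic complex $$0\to\mathfrak e(3)\xrightarrow{g_1}(dx)_\Gamma\xrightarrow{g_2}(dl)_{\text{over m.r.c. in }\Gamma}\to 0,$$ $N_\Gamma$ is the number of vertices in $\Gamma$, "m.r.c. in $\Gamma$" is the chosen minimal rigid construction in $\Gamma$, and $\mathcal E_\Gamma$ is the set of edges in $\Gamma$ not entering in it.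
   Context: All notions below apply to any connected compact oriented triangulated three-dimensional manifold $M$ with $m\ge0$ boundary components (hence also to $M_1$, $M_2$). Inner vertices/edges are those not lying in $\partial M$; boundary ones lie in $\partial M$. Unperturbed coordinates. Each vertex $A$ is assigned a point $(x_A,y_A,z_A)\in\mathbb R^3$, in general position. Each tetrahedron becomes a Euclidean tetrahedron with edge lengths $l$ and nonzero oriented volume $V$ (positive iff the orientation from $M$ agrees with that of $\mathbb R^3$). The triangulations are assumed to have at least three inner vertices. Angles. Dihedral angles of a tetrahedron are functions of its six edge lengths near the unperturbed ones, taken with the sign of its oriented volume. For an inner edge $i$, the deficit angle $\omega_i$ is $2\pi$ minus the sum (modulo $2\pi$) of signed dihedral angles at $i$; for a boundary edge $i$, $\alpha_i$ is minus the sum of signed dihedral angles at $i$. The matrix of partial derivatives $\partial(\omega\text{ or }\alpha)_i/\partial l_j$ over all edges, at the unperturbed lengths, is symmetric. Complex. For sets $\mathcal C,\mathcal D$ of boundary edges of equal cardinality consider the complex $$0\to \mathfrak e(3) \xrightarrow{f_1} (dx_{\mathrm{inner}})\oplus m\,\mathfrak e(3) \xrightarrow{f_2} (dl) \xrightarrow{f_3} (d\omega,d\alpha) \xrightarrow{f_4} (dx_{\mathrm{inner}}^* )\oplus m\,\mathfrak e(3)^* \xrightarrow{f_5} \mathfrak e(3)^*\to 0 .$$ Here $\mathfrak e(3)$ is the Lie algebra of infinitesimal isometries of $\mathbb R^3$ with the basis of three translations and three rotations; $(dx_{\mathrm{inner}})$ consists of coordinate differentials of inner vertices; $m\,\mathfrak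 e(3)$ consists of sways, i.e. one infinitesimal Euclidean motion of each boundary component as a whole; $(dl)$ consists of length differentials of inner edges and edges in $\mathcal C$; $(d\omega,d\alpha)$ consists of $d\omega_i$ for inner edges and $d\alpha_k$ for $k\in\mathcal D$. $f_1$ sends $a$ to the displacements of inner vertices under $a$ and to $m$ identical sways $a$; $f_2$ gives the changes of lengths caused by inner vertex displacements and sways ($dl_i=0$ for boundary edges); $f_3$ is the matrix of partial derivatives of the angles with respect to the lengths (boundary lengths outside $\mathcal C$ fixed); $f_4=-(f_2^{\mathcal D})^{\mathrm T}$, where $f_2^{\mathcal D}$ is $f_2$ with $\mathcal C$ replaced by $\mathcal D$; $f_5=f_1^{\mathrm T}$. Minimal rigid constructions (m.r.c.). A minimal rigid construction in $M$ is a minimal set of inner edges such that, if their lengths are fixed and every boundary component is required to be rigid (to move only as a whole), all vertices of $M$ can move (infinitesimally) in $\mathbb R^3$ only as a whole. A minimal rigid construction in a connected triangulated surface is a set of the minimal number of its edges such that, if their lengths are fixed, all vertices of the surface can move (infinitesimally) in $\mathbb R^3$ only as a whole. One such construction is fixed in the manifold and one in each boundary component. For the glued manifold $M$, the minimal rigid construction is the union of those for $M_1$, $M_2$ and $\Gamma$, and the remaining boundary components keep the constructions they have in $M_1$, $M_2$. Edge sets. $\mathcal E_{\mathrm{inner}}$ is the set of inner edges not in the minimal rigid construction of $M$; $\mathcal E^{(k)}_{\mathrm{boundary}}$ is the set of edges of the $k$-th boundary component not in its minimal rigid construction; $\mathcal E=\mathcal E_{\mathrm{inner}}\cup\bigcup_k\mathcal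 E^{(k)}_{\mathrm{boundary}}$. $\tilde f_3=\bigl(\partial(\omega\text{ or }\alpha)_i/\partial l_j\bigr)_{i,j\in\mathcal E}$. Minors. Choose inner vertices $A,B,C$. $\operatorname{minor}f_1$ uses the rows of $f_1$ corresponding to $dx_A,dy_A,dz_A,dy_B,dz_B,dz_C$, and $\operatorname{minor}f_5$ the corresponding columns of $f_5$. $\operatorname{minor}f_2$ uses the rows corresponding to the edges of the minimal rigid construction of $M$ and all columns except those six; $\operatorname{minor}f_4$ is chosen symmetrically. (Any other symmetric choice of the six basis vectors of $(dx_{\mathrm{inner}})\oplus m\,\mathfrak e(3)$ with nonzero minors, e.g. the six components of one sway, gives the same ratio below.) Grassmann variables. To each edge $i\in\mathcal E$ two Grassmann (mutually anti-commuting, square-zero) generators $a_i,a_i^*$ are assigned. The Berezin integral is defined by $\int da_i=0$, $\int a_i\,da_i=1$, $\int gh\,da_i=g\int h\,da_i$ if $g$ does not depend on $a_i$; multiple integrals are iterated, the leftmost differential being integrated first. Generating function of the invariants of $M$: $$\mathbf I_M=\frac{\operatorname{minor} f_1\,\operatorname{minor} f_5}{\operatorname{minor} f_2\,\operatorname{minor} f_4}\;\frac{\prod_{\text{over all tetrahedra}}(-6V)}{\prod_{\text{over inner edges}}l^2}\int \exp\Bigl(\sum_{i,j\in\mathcal E}(\tilde f_3)_{ij}a_ia_j^*\Bigr)\prod_{i\in\mathcal E_{\mathrm{inner}}}da_i^*\,da_i ,$$ a polynomial in the generators $a_i,a_i^*$ at the edges of $\bigcup_k\mathcal E^{(k)}_{\mathrm{boundary}}$.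 Its coefficient at $\prod_{k=1}^n a_{i_k}a_{j_k}^*$ is the invariant $I_{\mathcal C,\mathcal D}(M)=\tau\prod(-6V)/\prod_{\text{inner edges}}l^2$ for the ordered sets $\mathcal C=(i_1,\dots,i_n)$, $\mathcal D=(j_1,\dots,j_n)$, where $\tau=\operatorname{minor}f_1\operatorname{minor}f_3\operatorname{minor}f_5/(\operatorname{minor}f_2\operatorname{minor}f_4)$ is the torsion of the complex. In the gluing formula, the generators $a_i,a_i^*$ with $i\in\mathcal E_\Gamma$ are the same in $\mathbf I_{M_1}$ and $\mathbf I_{M_2}$; all other generators of $M_1$ and $M_2$ are distinct. Complex for $\Gamma$. $(dx)_\Gamma$ is the space of coordinate differentials of all vertices of $\Gamma$, $(dl)_{\text{over m.r.c. in }\Gamma}$ is the space of length differentials of the edges in the m.r.c. in $\Gamma$; $g_1$ sends an infinitesimal motion to the displacements of the vertices, $g_2$ sends displacements to changes of lengths. $\operatorname{minor}g_1$ is a nonzero $6\times6$ minor (e.g. rows $dx_A,dy_A,dz_A,dy_B,dz_B,dz_C$ with $A,B,C$ vertices of $\Gamma$) and $\operatorname{minor}g_2$ uses the complementary columns and all rows. *)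

theory Defs
  imports
    "HOL-Analysis.Analysis"
    "HOL-Combinatorics.Permutations"
    "Jordan_Normal_Form.Determinant"
begin

no_notation Matrix.vec_index (infixl \<open>$\<close> 100)
no_notation Matrix.scalar_prod (infix \<open>\<bullet>\<close> 70)

section \<open>Minors indexed by finite sets\<close>

text \<open>Rows and columns are put into an arbitrary but fixed order that depends only on the index
  set. Hence a minor of a matrix and the corresponding minor of its transpose always use the same
  orders.\<close>

definition enum_set :: "'a set \<Rightarrow> 'a list" where
  "enum_set S = (SOME xs. distinct xs \<and> set xs = S)"

definition minor :: "('i \<Rightarrow> 'j \<Rightarrow> real) \<Rightarrow> 'i set \<Rightarrow> 'j set \<Rightarrow> real" where
  "minor A I J = Determinant.det
     (Matrix.mat (card I) (card J) (\<lambda>(p, q). A (enum_set I ! p) (enum_set J ! q)))"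


section \<open>Oriented triangulations\<close>

text \<open>A triangulation is given by its poset of nonempty simplices; \<open>(\<sigma>, \<tau>) \<in> face K\<close> means that
  \<open>\<sigma>\<close> is a face of \<open>\<tau>\<close> (possibly \<open>\<sigma> = \<tau>\<close>). The vertices of a simplex are distinct, but different
  simplices may have the same vertices, so that a gluing of triangulated manifolds is always
  triangulated. Simplicial complexes are the special case where \<open>verts K\<close> is injective on the cells.
  \<open>orient K t\<close> lists the vertices of a tetrahedron \<open>t\<close> in an order that is positive with respect
  to the orientation; its values at other cells are irrelevant.\<close>

record 'c triangulation =
  face :: "('c \<times> 'c) set"
  orient :: "'c \<Rightarrow> 'c list"

definition cells :: "'c triangulation \<Rightarrow> 'c set" where
  "cells K = Field (face K)"

definition vertices :: "'c triangulation \<Rightarrow> 'c set" where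
  "vertices K = {v \<in> cells K. \<forall>\<tau>. (\<tau>, v) \<in> face K \<longrightarrow> \<tau> = v}"

definition verts :: "'c triangulation \<Rightarrow> 'c \<Rightarrow> 'c set" where
  "verts K \<sigma> = {v \<in> vertices K. (v, \<sigma>) \<in> face K}"

definition edges :: "'c triangulation \<Rightarrow> 'c set" where
  "edges K = {\<sigma> \<in> cells K. card (verts K \<sigma>) = 2}"

definition triangles :: "'c triangulation \<Rightarrow> 'c set" where
  "triangles K = {\<sigma> \<in> cells K. card (verts K \<sigma>) = 3}"

definition tetrahedra :: "'c triangulation \<Rightarrow> 'c set" where
  "tetrahedra K = {\<sigma> \<in> cells K. card (verts K \<sigma>) = 4}"

definition simplicial_poset3 :: "'c triangulation \<Rightarrow> bool" where
  "simplicial_poset3 K \<longleftrightarrow>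
     finite (cells K) \<and> Partial_order (face K) \<and>
     (\<forall>\<sigma>\<in>cells K.
        bij_betw (verts K) {\<tau>. (\<tau>, \<sigma>) \<in> face K} (Pow (verts K \<sigma>) - {{}}) \<and>
        (\<forall>\<rho> \<tau>. (\<rho>, \<sigma>) \<in> face K \<and> (\<tau>, \<sigma>) \<in> face K \<longrightarrow>
           ((\<rho>, \<tau>) \<in> face K \<longleftrightarrow> verts K \<rho> \<subseteq> verts K \<tau>))) \<and>
     (\<forall>\<sigma>\<in>cells K. \<exists>t\<in>tetrahedra K. (\<sigma>, t) \<in> face K)"

text \<open>The underlying space, with the topology of pointwise convergence, is given through its
  barycentric subdivision, which is a simplicial complex with the cells of \<open>K\<close> as vertices and the
  chains of cells as simplices; \<open>f \<sigma>\<close> is the barycentric coordinate at the barycentre of \<open>\<sigma>\<close>.\<close>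

definition realization :: "'c triangulation \<Rightarrow> ('c \<Rightarrow> real) set" where
  "realization K = {f. (\<forall>\<sigma>. 0 \<le> f \<sigma>) \<and> {\<sigma>. f \<sigma> \<noteq> 0} \<subseteq> cells K \<and>
     {\<sigma>. f \<sigma> \<noteq> 0} \<in> Chains (face K) \<and> (\<Sum>\<sigma>\<in>cells K. f \<sigma>) = 1}"

definition manifold_with_boundary3 :: "'a::topological_space set \<Rightarrow> bool" where
  "manifold_with_boundary3 S \<longleftrightarrow>
     (\<forall>p\<in>S. \<exists>U W. openin (top_of_set S) U \<and> p \<in> U \<and>
        openin (top_of_set {y :: real^3. 0 \<le> y $ 1}) W \<and> U homeomorphic W)"

definition positive_order :: "'c triangulation \<Rightarrow> 'c \<Rightarrow> 'c list \<Rightarrow> bool" where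
  "positive_order K t xs \<longleftrightarrow>
     (\<exists>p. p permutes {..<4} \<and> evenperm p \<and> xs = permute_list p (orient K t))"

text \<open>The order \<open>xs\<close> of the vertices of a triangle is positive for the orientation induced from the
  tetrahedron \<open>t\<close>: the vertex opposite to the triangle comes first.\<close>

definition induces :: "'c triangulation \<Rightarrow> 'c \<Rightarrow> 'c list \<Rightarrow> bool" where
  "induces K t xs \<longleftrightarrow> (\<exists>d. positive_order K t (d # xs))"

definition coherently_oriented :: "'c triangulation \<Rightarrow> bool" where
  "coherently_oriented K \<longleftrightarrow>
     (\<forall>t\<in>tetrahedra K. distinct (orient K t) \<and> set (orient K t) = verts K t) \<and>
     (\<forall>\<phi>\<in>triangles K. \<forall>t\<in>tetrahedra K. \<forall>t'\<in>tetrahedra K.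
        t \<noteq> t' \<and> (\<phi>, t) \<in> face K \<and> (\<phi>, t') \<in> face K \<longrightarrow>
        (\<forall>xs. distinct xs \<and> set xs = verts K \<phi> \<longrightarrow> (induces K t xs \<longleftrightarrow> \<not> induces K t' xs)))"

text \<open>Compactness holds because there are finitely many cells.\<close>

definition oriented_triangulated_manifold3 :: "'c triangulation \<Rightarrow> bool" where
  "oriented_triangulated_manifold3 K \<longleftrightarrow>
     simplicial_poset3 K \<and> connected (realization K) \<and>
     manifold_with_boundary3 (realization K) \<and> coherently_oriented K"

definition boundary_cells :: "'c triangulation \<Rightarrow> 'c set" where
  "boundary_cells K = {\<sigma>. \<exists>\<phi>\<in>triangles K. (\<sigma>, \<phi>) \<in> face K \<and>
     card {t \<in> tetrahedra K. (\<phi>, t) \<in> face K} = 1}"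

text \<open>The connected components of the boundary, each given as the set of its cells.\<close>

definition boundary_components :: "'c triangulation \<Rightarrow> 'c set set" where
  "boundary_components K = boundary_cells K //
     ({(\<sigma>, \<tau>). \<sigma> \<in> boundary_cells K \<and> \<tau> \<in> boundary_cells K \<and>
        ((\<sigma>, \<tau>) \<in> face K \<or> (\<tau>, \<sigma>) \<in> face K)}\<^sup>*)"

definition inner_vertices :: "'c triangulation \<Rightarrow> 'c set" where
  "inner_vertices K = vertices K - boundary_cells K"

definition inner_edges :: "'c triangulation \<Rightarrow> 'c set" where
  "inner_edges K = edges K - boundary_cells K"

text \<open>\<open>\<Gamma>\<close> is a boundary component of both manifolds, which have no other cells in common, and it
  inherits opposite orientations from them.\<close>

definition gluable :: "'c triangulation \<Rightarrow> 'c triangulation \<Rightarrow> 'c set \<Rightarrow> bool" where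
  "gluable K1 K2 \<Gamma> \<longleftrightarrow>
     \<Gamma> \<in> boundary_components K1 \<and> \<Gamma> \<in> boundary_components K2 \<and>
     cells K1 \<inter> cells K2 = \<Gamma> \<and>
     face K1 \<inter> (\<Gamma> \<times> \<Gamma>) = face K2 \<inter> (\<Gamma> \<times> \<Gamma>) \<and>
     (\<forall>\<phi> \<in> \<Gamma> \<inter> triangles K1. \<forall>t1\<in>tetrahedra K1. \<forall>t2\<in>tetrahedra K2.
        (\<phi>, t1) \<in> face K1 \<and> (\<phi>, t2) \<in> face K2 \<longrightarrow>
        (\<forall>xs. distinct xs \<and> set xs = verts K1 \<phi> \<longrightarrow> (induces K1 t1 xs \<longleftrightarrow> \<not> induces K2 t2 xs)))"

definition glue :: "'c triangulation \<Rightarrow> 'c triangulation \<Rightarrow> 'c triangulation" where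
  "glue K1 K2 = \<lparr>face = face K1 \<union> face K2,
     orient = (\<lambda>t. if t \<in> cells K1 then orient K1 t else orient K2 t)\<rparr>"


section \<open>Lengths, volumes and angles\<close>

definition ends :: "'c set \<Rightarrow> 'c \<times> 'c" where
  "ends S = (enum_set S ! 0, enum_set S ! 1)"

definition edge_length :: "'c triangulation \<Rightarrow> ('c \<Rightarrow> real^3) \<Rightarrow> 'c \<Rightarrow> real" where
  "edge_length K x e = (case ends (verts K e) of (p, q) \<Rightarrow> dist (x p) (x q))"

definition volume :: "'c triangulation \<Rightarrow> ('c \<Rightarrow> real^3) \<Rightarrow> 'c \<Rightarrow> real" where
  "volume K x t = (let a = x (orient K t ! 0); b = x (orient K t ! 1);
                       c = x (orient K t ! 2); d = x (orient K t ! 3)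
                   in cross3 (b - a) (c - a) \<bullet> (d - a) / 6)"

definition nondegenerate :: "'c triangulation \<Rightarrow> ('c \<Rightarrow> real^3) \<Rightarrow> bool" where
  "nondegenerate K x \<longleftrightarrow> (\<forall>t\<in>tetrahedra K. volume K x t \<noteq> 0)"

text \<open>The dihedral angle at the edge \<open>ab\<close> of a tetrahedron \<open>abcd\<close> as a function of the six edge
  lengths \<open>l\<close>. Here \<open>g u v\<close> is the inner product of the edge vectors from \<open>a\<close> to \<open>u\<close> and to \<open>v\<close>;
  see \<open>dihedral_angle_dist\<close> below.\<close>

definition dihedral_angle :: "('v \<Rightarrow> 'v \<Rightarrow> real) \<Rightarrow> 'v \<Rightarrow> 'v \<Rightarrow> 'v \<Rightarrow> 'v \<Rightarrow> real" where
  "dihedral_angle l a b c d =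
     (let g = (\<lambda>u v. ((l a u)\<^sup>2 + (l a v)\<^sup>2 - (l u v)\<^sup>2) / 2) in
      arccos (((l a b)\<^sup>2 * g c d - g b c * g b d) /
        sqrt (((l a b)\<^sup>2 * (l a c)\<^sup>2 - (g b c)\<^sup>2) * ((l a b)\<^sup>2 * (l a d)\<^sup>2 - (g b d)\<^sup>2))))"

text \<open>For points of Euclidean space it is the angle between the components of \<open>ac\<close> and \<open>ad\<close>
  orthogonal to \<open>ab\<close>.\<close>

definition normal_component :: "'a::real_inner \<Rightarrow> 'a \<Rightarrow> 'a" where
  "normal_component b c = c - ((b \<bullet> c) / (b \<bullet> b)) *\<^sub>R b"

lemma dihedral_angle_dist:
  fixes p :: "'v \<Rightarrow> 'a::real_inner"
  assumes "p a \<noteq> p b"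
  shows "dihedral_angle (\<lambda>u v. dist (p u) (p v)) a b c d =
    (let u = normal_component (p b - p a) (p c - p a);
         v = normal_component (p b - p a) (p d - p a)
     in arccos (u \<bullet> v / (norm u * norm v)))"
proof -
  define B C D where "B = p b - p a" and "C = p c - p a" and "D = p d - p a"
  have B0: "B \<bullet> B > 0" using assms by (simp add: B_def)
  have polar: "((dist (p a) (p u))\<^sup>2 + (dist (p a) (p v))\<^sup>2 - (dist (p u) (p v))\<^sup>2) / 2
      = (p u - p a) \<bullet> (p v - p a)" for u v
    by (simp add: dist_norm power2_norm_eq_inner inner_diff inner_commute field_simps)
  have sq: "(dist (p a) (p u))\<^sup>2 = (p u - p a) \<bullet> (p u - p a)" for u
    by (simp add: dist_norm power2_norm_eq_inner inner_diff inner_commute algebra_simps)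
  have nc: "normal_component B X \<bullet> normal_component B Y
      = ((B \<bullet> B) * (X \<bullet> Y) - (B \<bullet> X) * (B \<bullet> Y)) / (B \<bullet> B)" for X Y
    using B0 by (simp add: normal_component_def inner_diff inner_commute field_simps)
  have n2: "(B \<bullet> B) * (X \<bullet> X) - (B \<bullet> X)\<^sup>2 = (B \<bullet> B) * (norm (normal_component B X))\<^sup>2" for X
    unfolding power2_norm_eq_inner nc using B0 by (simp add: power2_eq_square)
  have rt: "sqrt (((B \<bullet> B) * (C \<bullet> C) - (B \<bullet> C)\<^sup>2) * ((B \<bullet> B) * (D \<bullet> D) - (B \<bullet> D)\<^sup>2))
      = (B \<bullet> B) * (norm (normal_component B C) * norm (normal_component B D))"
    unfolding n2 using B0 by (intro real_sqrt_unique) (simp_all add: power_mult_distrib power2_eq_square)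
  show ?thesis
    using B0 unfolding dihedral_angle_def Let_def polar
    unfolding sq B_def[symmetric] C_def[symmetric] D_def[symmetric] rt
    by (simp add: nc)
qed

text \<open>From now on \<open>l\<close> assigns a length to every edge, independently of the vertex coordinates \<open>x\<close>.\<close>

definition edge_between :: "'c triangulation \<Rightarrow> 'c \<Rightarrow> 'c \<Rightarrow> 'c \<Rightarrow> 'c" where
  "edge_between K t a b = (THE e. (e, t) \<in> face K \<and> verts K e = {a, b})"

definition angle_in :: "'c triangulation \<Rightarrow> ('c \<Rightarrow> real) \<Rightarrow> 'c \<Rightarrow> 'c \<Rightarrow> real" where
  "angle_in K l t e = (case (ends (verts K e), ends (verts K t - verts K e)) of
     ((a, b), (c, d)) \<Rightarrow> dihedral_angle (\<lambda>u v. l (edge_between K t u v)) a b c d)"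

text \<open>\<open>\<omega>\<close> at inner edges and \<open>\<alpha>\<close> at boundary edges. As only derivatives are used, the reduction
  modulo \<open>2\<pi>\<close> is omitted.\<close>

definition curvature :: "'c triangulation \<Rightarrow> ('c \<Rightarrow> real^3) \<Rightarrow> ('c \<Rightarrow> real) \<Rightarrow> 'c \<Rightarrow> real" where
  "curvature K x l e = (if e \<in> boundary_cells K then 0 else 2 * pi) -
     (\<Sum>t | t \<in> tetrahedra K \<and> (e, t) \<in> face K. sgn (volume K x t) * angle_in K l t e)"

definition f3 :: "'c triangulation \<Rightarrow> ('c \<Rightarrow> real^3) \<Rightarrow> 'c \<Rightarrow> 'c \<Rightarrow> real" where
  "f3 K x i j =
     deriv (\<lambda>s. curvature K x ((edge_length K x)(j := s)) i) (edge_length K x j)"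


section \<open>Infinitesimal motions\<close>

text \<open>The change of length of an edge under the vertex displacements \<open>u\<close>;
  see \<open>length_change_deriv\<close> below.\<close>

definition length_change ::
  "'c triangulation \<Rightarrow> ('c \<Rightarrow> real^3) \<Rightarrow> ('c \<Rightarrow> real^3) \<Rightarrow> 'c \<Rightarrow> real" where
  "length_change K x u e = (case ends (verts K e) of (p, q) \<Rightarrow>
     (x p - x q) \<bullet> (u p - u q) / dist (x p) (x q))"

lemma length_change_deriv:
  assumes "edge_length K x e \<noteq> 0"
  shows "((\<lambda>s. edge_length K (\<lambda>v. x v + s *\<^sub>R u v) e) has_real_derivative length_change K x u e) (at 0)"
proof -
  obtain p q where pq: "ends (verts K e) = (p, q)" by (cases "ends (verts K e)")
  with assms have ne: "x p - x q \<noteq> 0" by (simp add: edge_length_def)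
  have eq: "(\<lambda>s. edge_length K (\<lambda>v. x v + s *\<^sub>R u v) e) = (\<lambda>s. norm ((x p - x q) + s *\<^sub>R (u p - u q)))"
    by (simp add: edge_length_def pq dist_norm algebra_simps)
  have "((\<lambda>s::real. (x p - x q) + s *\<^sub>R (u p - u q)) has_derivative (\<lambda>s. s *\<^sub>R (u p - u q))) (at 0)"
    by (auto intro!: derivative_eq_intros)
  moreover have "(norm has_derivative (\<lambda>h. h \<bullet> sgn (x p - x q))) (at ((x p - x q) + 0 *\<^sub>R (u p - u q)))"
    using has_derivative_norm[OF ne] by simp
  ultimately have "((\<lambda>s. norm ((x p - x q) + s *\<^sub>R (u p - u q))) has_derivative
      (\<lambda>s. (s *\<^sub>R (u p - u q)) \<bullet> sgn (x p - x q))) (at 0)"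
    by (rule has_derivative_compose)
  moreover have "(\<lambda>s. (s *\<^sub>R (u p - u q)) \<bullet> sgn (x p - x q)) = (*) (length_change K x u e)"
    by (simp add: fun_eq_iff length_change_def pq sgn_div_norm dist_norm inner_commute divide_inverse mult_ac
        del: scaleR_right_diff_distrib)
  ultimately show ?thesis unfolding eq has_field_derivative_def by simp
qed

text \<open>The displacements \<open>u\<close> move the vertices in \<open>S\<close> as a whole.\<close>

definition moves_as_whole :: "('c \<Rightarrow> real^3) \<Rightarrow> ('c \<Rightarrow> real^3) \<Rightarrow> 'c set \<Rightarrow> bool" where
  "moves_as_whole x u S \<longleftrightarrow> (\<exists>b w. \<forall>v\<in>S. u v = b + cross3 w (x v))"

definition rigid_manifold :: "'c triangulation \<Rightarrow> ('c \<Rightarrow> real^3) \<Rightarrow> 'c set \<Rightarrow> bool" where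
  "rigid_manifold K x Q \<longleftrightarrow>
     (\<forall>u. (\<forall>k\<in>boundary_components K. moves_as_whole x u (vertices K \<inter> k)) \<and>
          (\<forall>e\<in>Q. length_change K x u e = 0) \<longrightarrow>
        moves_as_whole x u (vertices K))"

definition mrc_manifold :: "'c triangulation \<Rightarrow> ('c \<Rightarrow> real^3) \<Rightarrow> 'c set \<Rightarrow> bool" where
  "mrc_manifold K x Q \<longleftrightarrow> Q \<subseteq> inner_edges K \<and> rigid_manifold K x Q \<and>
     (\<forall>Q'. Q' \<subset> Q \<longrightarrow> \<not> rigid_manifold K x Q')"

definition rigid_surface :: "'c triangulation \<Rightarrow> ('c \<Rightarrow> real^3) \<Rightarrow> 'c set \<Rightarrow> 'c set \<Rightarrow> bool" where
  "rigid_surface K x k Q \<longleftrightarrow>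
     (\<forall>u. (\<forall>e\<in>Q. length_change K x u e = 0) \<longrightarrow> moves_as_whole x u (vertices K \<inter> k))"

definition mrc_surface :: "'c triangulation \<Rightarrow> ('c \<Rightarrow> real^3) \<Rightarrow> 'c set \<Rightarrow> 'c set \<Rightarrow> bool" where
  "mrc_surface K x k Q \<longleftrightarrow> Q \<subseteq> edges K \<inter> k \<and> rigid_surface K x k Q \<and>
     (\<forall>Q'. Q' \<subseteq> edges K \<inter> k \<and> rigid_surface K x k Q' \<longrightarrow> card Q \<le> card Q')"


section \<open>The complexes\<close>

text \<open>The basis of the Lie algebra \<open>\<ee>(3)\<close>: translations along and rotations about the axes.\<close>

datatype motion = Trans 3 | Rot 3

fun displacement :: "motion \<Rightarrow> real^3 \<Rightarrow> real^3" where
  "displacement (Trans i) p = axis i 1"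
| "displacement (Rot i) p = cross3 (axis i 1) p"

text \<open>Basis vectors: coordinate differentials of vertices and sways of boundary components.\<close>

datatype 'c basis_vector = Coord 'c 3 | Sway "'c set" motion

definition basis :: "'c triangulation \<Rightarrow> 'c basis_vector set" where
  "basis K = {Coord v i | v i. v \<in> inner_vertices K} \<union>
             {Sway k a | k a. k \<in> boundary_components K}"

fun basis_displacement :: "('c \<Rightarrow> real^3) \<Rightarrow> 'c basis_vector \<Rightarrow> 'c \<Rightarrow> real^3" where
  "basis_displacement x (Coord v i) w = (if w = v then axis i 1 else 0)"
| "basis_displacement x (Sway k a) w = (if w \<in> k then displacement a (x w) else 0)"

fun f1 :: "('c \<Rightarrow> real^3) \<Rightarrow> 'c basis_vector \<Rightarrow> motion \<Rightarrow> real" where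
  "f1 x (Coord v i) a = displacement a (x v) $ i"
| "f1 x (Sway k b) a = (if b = a then 1 else 0)"

definition f2 :: "'c triangulation \<Rightarrow> ('c \<Rightarrow> real^3) \<Rightarrow> 'c \<Rightarrow> 'c basis_vector \<Rightarrow> real" where
  "f2 K x e c = length_change K x (basis_displacement x c) e"

definition f4 :: "'c triangulation \<Rightarrow> ('c \<Rightarrow> real^3) \<Rightarrow> 'c basis_vector \<Rightarrow> 'c \<Rightarrow> real" where
  "f4 K x c e = - f2 K x e c"

definition f5 :: "('c \<Rightarrow> real^3) \<Rightarrow> motion \<Rightarrow> 'c basis_vector \<Rightarrow> real" where
  "f5 x a c = f1 x c a"

text \<open>\<open>R\<close> is a choice of six basis vectors with a nonzero minor of \<open>f\<^sub>1\<close>, such as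
  \<open>{Coord A 1, Coord A 2, Coord A 3, Coord B 2, Coord B 3, Coord C 3}\<close> for inner vertices
  \<open>A\<close>, \<open>B\<close>, \<open>C\<close> in general position.\<close>

definition admissible_rows ::
  "'c triangulation \<Rightarrow> ('c \<Rightarrow> real^3) \<Rightarrow> 'c basis_vector set \<Rightarrow> bool" where
  "admissible_rows K x R \<longleftrightarrow> R \<subseteq> basis K \<and> card R = 6 \<and> minor (f1 x) R UNIV \<noteq> 0"

text \<open>The complex of \<open>\<Gamma>\<close>: \<open>g\<^sub>1\<close> and \<open>g\<^sub>2\<close> have the same entries as \<open>f\<^sub>1\<close> and \<open>f\<^sub>2\<close>, but all
  vertices of \<open>\<Gamma>\<close> are displaced independently. The sign of the torsion depends on the orders of
  the bases.\<close>

definition surface_basis :: "'c triangulation \<Rightarrow> 'c set \<Rightarrow> 'c basis_vector set" where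
  "surface_basis K \<Gamma> = {Coord v i | v i. v \<in> vertices K \<inter> \<Gamma>}"

definition surface_torsion ::
  "'c triangulation \<Rightarrow> ('c \<Rightarrow> real^3) \<Rightarrow> 'c set \<Rightarrow> 'c set \<Rightarrow> 'c basis_vector set \<Rightarrow> real" where
  "surface_torsion K x \<Gamma> Q R = minor (f1 x) R UNIV / minor (f2 K x) Q (surface_basis K \<Gamma> - R)"


section \<open>Grassmann algebra and Berezin integral\<close>

text \<open>An element is given by its coefficients at the ordered monomials, which are indexed by the
  finite sets of generators; the order of the generators is arbitrary but fixed.\<close>

type_synonym 'g grassmann = "'g set \<Rightarrow> real"

definition generator_order :: "('g \<times> 'g) set" where
  "generator_order = (SOME r. linear_order_on UNIV r)"

definition inversions :: "'g set \<Rightarrow> 'g set \<Rightarrow> nat" where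
  "inversions S T = card {(s, t). s \<in> S \<and> t \<in> T \<and> (t, s) \<in> generator_order}"

definition gr_one :: "'g grassmann" where
  "gr_one = (\<lambda>U. if U = {} then 1 else 0)"

definition gr_gen :: "'g \<Rightarrow> 'g grassmann" where
  "gr_gen a = (\<lambda>U. if U = {a} then 1 else 0)"

definition gr_mult :: "'g grassmann \<Rightarrow> 'g grassmann \<Rightarrow> 'g grassmann" where
  "gr_mult f h = (\<lambda>U. \<Sum>S\<in>Pow U. (-1) ^ inversions S (U - S) * f S * h (U - S))"

text \<open>For \<open>f\<close> without constant term, only the finitely many \<open>n \<le> card U\<close> contribute.\<close>

definition gr_exp :: "'g grassmann \<Rightarrow> 'g grassmann" where
  "gr_exp f = (\<lambda>U. \<Sum>n. (gr_mult f ^^ n) gr_one U / fact n)"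

text \<open>The integral with respect to one generator \<open>a\<close>; it moves \<open>a\<close> to the right end of a monomial
  and removes it. The lemmas below are its characteristic properties.\<close>

definition berezin :: "'g \<Rightarrow> 'g grassmann \<Rightarrow> 'g grassmann" where
  "berezin a f = (\<lambda>S. if a \<in> S then 0
     else (-1) ^ card {s \<in> S. (a, s) \<in> generator_order} * f (insert a S))"

lemma linear_generator_order: "linear_order_on UNIV (generator_order :: ('g \<times> 'g) set)"
proof -
  have "\<exists>r :: ('g \<times> 'g) set. linear_order_on UNIV r"
    using well_order_on[of "UNIV :: 'g set"] by (auto simp: well_order_on_def)
  then show ?thesis unfolding generator_order_def by (rule someI_ex)
qed

lemma gr_gen_anticommute:
  assumes "a \<noteq> b"
  shows "gr_mult (gr_gen a) (gr_gen b) U = - gr_mult (gr_gen b) (gr_gen a) U"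
proof -
  have eq: "gr_mult (gr_gen a) (gr_gen b) U =
      (if U = {a, b} then (-1) ^ inversions {a} {b} else 0)" if "a \<noteq> b" for a b :: 'a
  proof (cases "finite U")
    case True
    have "gr_mult (gr_gen a) (gr_gen b) U = (\<Sum>S\<in>Pow U. if S = {a} then
        (-1) ^ inversions {a} (U - {a}) * gr_gen b (U - {a}) else 0)"
      unfolding gr_mult_def by (intro sum.cong refl) (simp add: gr_gen_def)
    also have "\<dots> = (if a \<in> U then (-1) ^ inversions {a} (U - {a}) * gr_gen b (U - {a}) else 0)"
      using True by (simp add: sum.delta)
    also have "\<dots> = (if U = {a, b} then (-1) ^ inversions {a} {b} else 0)"
    proof (cases "U = {a, b}")
      case True
      with that have "a \<in> U" "U - {a} = {b}" by auto
      with True show ?thesis by (simp only: gr_gen_def if_True refl mult_1_right)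
    next
      case False
      have "U - {a} \<noteq> {b}" if "a \<in> U" using insert_Diff[OF that] False by metis
      with False show ?thesis by (cases "a \<in> U") (simp_all add: gr_gen_def)
    qed
    finally show ?thesis .
  next
    case False
    then show ?thesis by (auto simp: gr_mult_def)
  qed
  have one: "inversions {a} {b} = (if (b, a) \<in> generator_order then 1 else 0)" for a b :: 'a
  proof -
    have "{(s, t). s \<in> {a} \<and> t \<in> {b} \<and> (t, s) \<in> generator_order} =
        (if (b, a) \<in> generator_order then {(a, b)} else {})" by auto
    then show ?thesis by (simp add: inversions_def)
  qed
  have "total_on UNIV (generator_order :: ('a \<times> 'a) set)" "antisym (generator_order :: ('a \<times> 'a) set)"
    using linear_generator_order[where 'g = 'a] by (simp_all add: linear_order_on_def partial_order_on_def)
  then have "(a, b) \<in> generator_order \<longleftrightarrow> (b, a) \<notin> generator_order"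
    using assms antisymD[of generator_order a b] by (auto simp: total_on_def)
  moreover have "{a, b} = {b, a}" by auto
  ultimately show ?thesis using assms by (simp add: eq one)
qed

lemma gr_gen_square: "gr_mult (gr_gen a) (gr_gen a) U = 0"
  unfolding gr_mult_def by (intro sum.neutral) (auto simp: gr_gen_def)

lemma berezin_one: "berezin a gr_one = (\<lambda>_. 0)"
  by (auto simp: berezin_def gr_one_def)

lemma berezin_gen: "berezin a (gr_gen a) = gr_one"
proof
  fix S
  have "insert a S = {a} \<longleftrightarrow> S = {}" if "a \<notin> S" using that by auto
  then show "berezin a (gr_gen a) S = gr_one S"
    by (auto simp: berezin_def gr_gen_def gr_one_def)
qed

lemma berezin_mult:
  assumes "\<And>S. a \<in> S \<Longrightarrow> f S = 0"
  shows "berezin a (gr_mult f h) = gr_mult f (berezin a h)"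
proof
  fix S
  show "berezin a (gr_mult f h) S = gr_mult f (berezin a h) S"
  proof (cases "finite S \<and> a \<notin> S")
    case True
    then have fin: "finite S" and a: "a \<notin> S" by auto
    have key: "(-1::real) ^ card {s \<in> S. (a, s) \<in> generator_order} * (-1) ^ inversions T (insert a (S - T))
        = (-1) ^ inversions T (S - T) * (-1) ^ card {s \<in> S - T. (a, s) \<in> generator_order}"
      if T: "T \<subseteq> S" for T
    proof -
      have fT: "finite T" using T fin by (rule finite_subset)
      have "{(s, t). s \<in> T \<and> t \<in> insert a (S - T) \<and> (t, s) \<in> generator_order} =
          {(s, t). s \<in> T \<and> t \<in> S - T \<and> (t, s) \<in> generator_order} \<union>
          (\<lambda>s. (s, a)) ` {s \<in> T. (a, s) \<in> generator_order}" by auto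
      moreover have "card ({(s, t). s \<in> T \<and> t \<in> S - T \<and> (t, s) \<in> generator_order} \<union>
          (\<lambda>s. (s, a)) ` {s \<in> T. (a, s) \<in> generator_order}) =
          inversions T (S - T) + card {s \<in> T. (a, s) \<in> generator_order}"
      proof -
        have f1: "finite {(s, t). s \<in> T \<and> t \<in> S - T \<and> (t, s) \<in> generator_order}"
          by (rule finite_subset[of _ "T \<times> (S - T)"]) (use fT fin in auto)
        have f2: "finite ((\<lambda>s. (s, a)) ` {s \<in> T. (a, s) \<in> generator_order})" using fT by simp
        have "{(s, t). s \<in> T \<and> t \<in> S - T \<and> (t, s) \<in> generator_order} \<inter>
            (\<lambda>s. (s, a)) ` {s \<in> T. (a, s) \<in> generator_order} = {}" using a by auto
        from card_Un_disjoint[OF f1 f2 this] show ?thesis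
          by (simp add: inversions_def card_image inj_on_def)
      qed
      ultimately have 1: "inversions T (insert a (S - T)) =
          inversions T (S - T) + card {s \<in> T. (a, s) \<in> generator_order}"
        by (simp add: inversions_def)
      have "{s \<in> S. (a, s) \<in> generator_order} =
          {s \<in> T. (a, s) \<in> generator_order} \<union> {s \<in> S - T. (a, s) \<in> generator_order}"
        using T by auto
      then have 2: "card {s \<in> S. (a, s) \<in> generator_order} =
          card {s \<in> T. (a, s) \<in> generator_order} + card {s \<in> S - T. (a, s) \<in> generator_order}"
        using fT fin by (simp add: card_Un_disjoint disjoint_iff)
      show ?thesis unfolding 1 2 by (simp add: power_add flip: power_mult_distrib)
    qed
    have "gr_mult f h (insert a S) =
        (\<Sum>T\<in>Pow S. (-1) ^ inversions T (insert a S - T) * f T * h (insert a S - T))"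
      unfolding gr_mult_def using fin by (intro sum.mono_neutral_right) (auto simp: assms)
    also have "\<dots> = (\<Sum>T\<in>Pow S. (-1) ^ inversions T (insert a (S - T)) * f T * h (insert a (S - T)))"
      using a by (intro sum.cong refl) (auto simp: insert_Diff_if)
    finally have "berezin a (gr_mult f h) S = (\<Sum>T\<in>Pow S.
        ((-1) ^ card {s \<in> S. (a, s) \<in> generator_order} * (-1) ^ inversions T (insert a (S - T)))
        * (f T * h (insert a (S - T))))"
      using a by (simp add: berezin_def sum_distrib_left mult.assoc)
    also have "\<dots> = gr_mult f (berezin a h) S"
      unfolding gr_mult_def using a by (intro sum.cong refl) (auto simp: key berezin_def)
    finally show ?thesis .
  next
    case False
    show ?thesis
    proof (cases "finite S")
      case False
      then show ?thesis by (simp add: berezin_def gr_mult_def)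
    next
      case True
      with \<open>\<not> (finite S \<and> a \<notin> S)\<close> have "a \<in> S" by simp
      then have "f T * berezin a h (S - T) = 0" for T
        by (cases "a \<in> T") (simp_all add: assms berezin_def)
      then have "gr_mult f (berezin a h) S = 0"
        unfolding gr_mult_def by (intro sum.neutral) (simp add: mult.assoc)
      with \<open>a \<in> S\<close> show ?thesis by (simp add: berezin_def)
    qed
  qed
qed

datatype 'c generator = Gen 'c | GenStar 'c

text \<open>Integration with respect to the product of \<open>da\<^sub>i\<^sup>* da\<^sub>i\<close> over \<open>E\<close>, the leftmost differential
  first. Different pairs commute, so the order of \<open>E\<close> does not matter.\<close>

definition berezin_pairs :: "'c set \<Rightarrow> 'c generator grassmann \<Rightarrow> 'c generator grassmann" where
  "berezin_pairs E F = fold (\<lambda>i G. berezin (Gen i) (berezin (GenStar i) G)) (enum_set E) F"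

definition bilinear_form :: "('c \<Rightarrow> 'c \<Rightarrow> real) \<Rightarrow> 'c set \<Rightarrow> 'c generator grassmann" where
  "bilinear_form A E =
     (\<lambda>U. \<Sum>i\<in>E. \<Sum>j\<in>E. A i j * gr_mult (gr_gen (Gen i)) (gr_gen (GenStar j)) U)"


section \<open>The generating function of the invariants\<close>

text \<open>\<open>Q\<close> is the minimal rigid construction in \<open>K\<close>, \<open>B k\<close> is the one in the boundary component \<open>k\<close>,
  and \<open>R\<close> is the choice of six basis vectors used for the minors.\<close>

definition edge_set :: "'c triangulation \<Rightarrow> ('c set \<Rightarrow> 'c set) \<Rightarrow> 'c set \<Rightarrow> 'c set" where
  "edge_set K B Q = (inner_edges K - Q) \<union> (\<Union>k\<in>boundary_components K. (edges K \<inter> k) - B k)"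

definition generating_function ::
  "'c triangulation \<Rightarrow> ('c \<Rightarrow> real^3) \<Rightarrow> ('c set \<Rightarrow> 'c set) \<Rightarrow> 'c set \<Rightarrow> 'c basis_vector set
    \<Rightarrow> 'c generator grassmann" where
  "generating_function K x B Q R = (\<lambda>U.
     (minor (f1 x) R UNIV * minor (f5 x) UNIV R) /
     (minor (f2 K x) Q (basis K - R) * minor (f4 K x) (basis K - R) Q) *
     ((\<Prod>t\<in>tetrahedra K. - 6 * volume K x t) / (\<Prod>e\<in>inner_edges K. (edge_length K x e)\<^sup>2)) *
     berezin_pairs (inner_edges K - Q) (gr_exp (bilinear_form (f3 K x) (edge_set K B Q))) U)"

end

theory Submission
  imports Defs
begin

text \<open>
Every factor of the generating function is either multiplicative over the two pieces or can be made so
by choosing the bases well, and the integral over the generators on \<open>\<Gamma>\<close> glues the rest.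

\<^emph>\<open>Gluing of the triangulations.\<close> A boundary component contains the faces of its cells, so a cell of
one piece acquires no new faces from the other piece. A triangle of \<open>\<Gamma>\<close> lies
in one tetrahedron of each piece, hence is no longer a boundary triangle. Consequently the inner vertices
and edges of \<open>M\<close> are those of the pieces together with those of \<open>\<Gamma>\<close>, and the boundary components of
\<open>M\<close> are those of the pieces except \<open>\<Gamma>\<close>. The products of volumes and of lengths factor accordingly,
and the edges of \<open>\<Gamma>\<close> contribute the product of lengths in the formula.

\<^emph>\<open>Torsion.\<close> Since \<open>f\<^sub>4\<close> and \<open>f\<^sub>5\<close> are transposes of \<open>f\<^sub>2\<close> and \<open>f\<^sub>1\<close>, the quotient of
minors is, up to the sign \<open>(-1)\<close> to the number of edges in the minimal rigid construction, the square
of \<open>minor f\<^sub>1 / minor f\<^sub>2\<close> (\<open>generating_function_eq\<close>). This square does not depend on the six chosen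
basis vectors, because \<open>f\<^sub>2 f\<^sub>1 = 0\<close> (\<open>minor_sq_exchange\<close>, \<open>torsion_sq_independent\<close>). For the pieces
choose the six components of the sway of \<open>\<Gamma>\<close>, which makes \<open>minor f\<^sub>1\<close> equal to \<open>\<plusminus>1\<close>; for \<open>M\<close>
choose six coordinates of vertices of \<open>\<Gamma>\<close>. Then \<open>f\<^sub>2\<close> of \<open>M\<close> is block triangular, with one
block for each piece and a block \<open>g\<^sub>2\<close> for \<open>\<Gamma>\<close>, so the squared torsion of \<open>M\<close> is \<open>\<tau>\<^sub>\<Gamma>\<^sup>2\<close>
times those of the pieces (\<open>minor_f2_M\<close>, \<open>torsion_sq_M\<close>). The blocks are square because a minimal rigid
construction has as many edges as there are basis vectors, less six (\<open>minimal_constraints_card\<close>); for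
\<open>\<Gamma>\<close> this number is \<open>3 N\<^sub>\<Gamma> - 6\<close>, which gives the sign \<open>(-1)\<close> to the power \<open>N\<^sub>\<Gamma>\<close>.

\<^emph>\<open>Integral.\<close> The curvature of \<open>M\<close> at an edge is a constant minus a sum over tetrahedra, so the matrix
\<open>f\<^sub>3\<close> of \<open>M\<close> is the sum of those of the pieces, each extended by zero (\<open>f3_M\<close>). The two exponents
are even, hence commute, and the exponential of their sum is the product of the exponentials
(\<open>gr_exp_add\<close>). A factor that contains no generator of an integration variable can be pulled out of the
integral, so the integrals over the inner edges of each piece act on one factor only, and the integral over
\<open>\<Gamma>\<close> remains (\<open>berezin_pairs_exp_glue\<close>).
\<close>

section \<open>Squares of minors\<close>

lemma enum_set:
  assumes "finite S"
  shows "distinct (enum_set S)" "set (enum_set S) = S" "length (enum_set S) = card S"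
proof -
  have "distinct (enum_set S) \<and> set (enum_set S) = S"
    unfolding enum_set_def by (rule someI_ex) (use finite_distinct_list[OF assms] in blast)
  then show "distinct (enum_set S)" "set (enum_set S) = S" by auto
  then show "length (enum_set S) = card S" using distinct_card by metis
qed

lemma bij_betw_enum_set: "finite S \<Longrightarrow> bij_betw ((!) (enum_set S)) {..<card S} S"
  by (rule bij_betw_nth) (simp_all add: enum_set)

lemma list_permutation:
  assumes "distinct xs" "distinct ys" "set xs = set ys"
  obtains p where "p permutes {0..<length xs}" "\<And>i. i < length xs \<Longrightarrow> ys ! p i = xs ! i"
proof -
  have "mset ys = mset xs" using assms set_eq_iff_mset_eq_distinct by blast
  then obtain p where p: "p permutes {..<length ys}" "permute_list p ys = xs"
    using mset_eq_permutation[of xs ys] by metis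
  have len: "length xs = length ys" using assms by (metis distinct_card)
  show ?thesis
  proof
    show "p permutes {0..<length xs}" using p len by (simp add: lessThan_atLeast0)
    show "ys ! p i = xs ! i" if "i < length xs" for i
      using that p len permute_list_nth[of p ys i] by auto
  qed
qed

text \<open>A reordering of the rows or columns multiplies a minor by a sign. The square is therefore
  independent of the orders, and may be computed with whatever lists of indices show the block structure.\<close>

lemma minor_sq_lists:
  assumes "distinct xs" "distinct ys" "length xs = length ys"
  shows "(minor A (set xs) (set ys))\<^sup>2 =
    (Determinant.det (Matrix.mat (length xs) (length ys) (\<lambda>(i, j). A (xs ! i) (ys ! j))))\<^sup>2"
proof -
  define n where "n = length xs"
  let ?M = "\<lambda>xs ys. Matrix.mat n n (\<lambda>(i, j). A (xs ! i) (ys ! j))"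
  have sign_sq: "(signof p * d)\<^sup>2 = (d :: real)\<^sup>2" for p d
    by (simp add: sign_def power_mult_distrib)
  have rows: "(Determinant.det (?M xs ys))\<^sup>2 = (Determinant.det (?M xs' ys))\<^sup>2"
    if d: "distinct xs" "distinct xs'" "set xs = set xs'" and len: "length xs = n" for xs xs' :: "'a list" and ys :: "'b list"
  proof -
    obtain p where p: "p permutes {0..<n}" "\<And>i. i < n \<Longrightarrow> xs' ! p i = xs ! i"
      using list_permutation[OF d] len by metis
    have lt: "p i < n" if "i < n" for i using p(1) that permutes_in_image by fastforce
    have "?M xs ys = Matrix.mat n n (\<lambda>(i, j). ?M xs' ys $$ (p i, j))"
      by (intro eq_matI) (auto simp: p lt)
    also have "Determinant.det \<dots> = signof p * Determinant.det (?M xs' ys)"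
      by (rule det_permute_rows[OF _ p(1)]) simp
    finally show ?thesis by (simp add: sign_sq)
  qed
  have cols: "(Determinant.det (?M xs ys))\<^sup>2 = (Determinant.det (?M xs ys'))\<^sup>2"
    if d: "distinct ys" "distinct ys'" "set ys = set ys'" and len: "length ys = n" for xs :: "'a list" and ys ys' :: "'b list"
  proof -
    obtain p where p: "p permutes {0..<n}" "\<And>i. i < n \<Longrightarrow> ys' ! p i = ys ! i"
      using list_permutation[OF d] len by metis
    have lt: "p i < n" if "i < n" for i using p(1) that permutes_in_image by fastforce
    have "transpose_mat (?M xs ys) = Matrix.mat n n (\<lambda>(i, j). transpose_mat (?M xs ys') $$ (p i, j))"
      by (intro eq_matI) (auto simp: p lt)
    also have "Determinant.det \<dots> = signof p * Determinant.det (transpose_mat (?M xs ys'))"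
      by (rule det_permute_rows[OF _ p(1)]) simp
    finally show ?thesis
      by (simp add: sign_sq det_transpose[of _ n])
  qed
  have card: "card (set xs) = n" "card (set ys) = n" using assms by (simp_all add: n_def distinct_card)
  have "(minor A (set xs) (set ys))\<^sup>2 = (Determinant.det (?M (enum_set (set xs)) (enum_set (set ys))))\<^sup>2"
    by (simp add: minor_def card)
  also have "\<dots> = (Determinant.det (?M xs (enum_set (set ys))))\<^sup>2"
    by (rule rows) (use assms card in \<open>simp_all add: enum_set\<close>)
  also have "\<dots> = (Determinant.det (?M xs ys))\<^sup>2"
    by (rule cols) (use assms card in \<open>simp_all add: enum_set\<close>)
  finally show ?thesis using assms by (simp add: n_def)
qed

lemma minor_cong:
  assumes "finite I" "finite J" "\<And>i j. i \<in> I \<Longrightarrow> j \<in> J \<Longrightarrow> A i j = A' i j"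
  shows "minor A I J = minor A' I J"
proof -
  have "enum_set I ! p \<in> I" if "p < card I" for p
    using enum_set[OF assms(1)] that by (metis nth_mem)
  moreover have "enum_set J ! p \<in> J" if "p < card J" for p
    using enum_set[OF assms(2)] that by (metis nth_mem)
  ultimately show ?thesis
    unfolding minor_def using assms(3) by (intro arg_cong[of _ _ Determinant.det] eq_matI) auto
qed

lemma minor_nonsquare: "card I \<noteq> card J \<Longrightarrow> minor A I J = 0"
  by (simp add: minor_def Determinant.det_def)

lemma minor_transpose: "minor (\<lambda>j i. A i j) J I = minor A I J"
proof (cases "card I = card J")
  case True
  have "Matrix.mat (card J) (card I) (\<lambda>(p, q). A (enum_set I ! q) (enum_set J ! p)) =
      transpose_mat (Matrix.mat (card I) (card J) (\<lambda>(p, q). A (enum_set I ! p) (enum_set J ! q)))"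
    by (intro eq_matI) auto
  then show ?thesis unfolding minor_def using True by (simp add: det_transpose[of _ "card I"])
qed (simp add: minor_nonsquare)

lemma minor_minus: "minor (\<lambda>i j. - A i j) I J = (-1) ^ card J * minor A I J"
proof -
  have "Matrix.mat (card I) (card J) (\<lambda>(p, q). - A (enum_set I ! p) (enum_set J ! q)) =
      (-1) \<cdot>\<^sub>m Matrix.mat (card I) (card J) (\<lambda>(p, q). A (enum_set I ! p) (enum_set J ! q))"
    by (intro eq_matI) auto
  then show ?thesis unfolding minor_def by simp
qed

lemma minor_sq_image:
  assumes "finite I" "finite J" "inj_on g I" "inj_on h J" "card I = card J"
  shows "(minor A (g ` I) (h ` J))\<^sup>2 = (minor (\<lambda>i j. A (g i) (h j)) I J)\<^sup>2"
proof -
  let ?xs = "enum_set I" and ?ys = "enum_set J"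
  note e = enum_set[OF assms(1)] enum_set[OF assms(2)]
  have "(minor A (set (map g ?xs)) (set (map h ?ys)))\<^sup>2 =
    (Determinant.det (Matrix.mat (length (map g ?xs)) (length (map h ?ys)) (\<lambda>(i, j). A (map g ?xs ! i) (map h ?ys ! j))))\<^sup>2"
    by (rule minor_sq_lists) (use assms e in \<open>auto simp: distinct_map\<close>)
  also have "Matrix.mat (length (map g ?xs)) (length (map h ?ys)) (\<lambda>(i, j). A (map g ?xs ! i) (map h ?ys ! j)) =
    Matrix.mat (card I) (card J) (\<lambda>(p, q). A (g (?xs ! p)) (h (?ys ! q)))"
    by (intro eq_matI) (auto simp: e)
  finally show ?thesis using e by (simp add: minor_def)
qed

lemma minor_sq_block_triangular:
  assumes fin: "finite I1" "finite I2" "finite J1" "finite J2"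
    and disj: "I1 \<inter> I2 = {}" "J1 \<inter> J2 = {}"
    and card: "card I1 = card J1" "card I2 = card J2"
    and zero: "\<And>i j. i \<in> I1 \<Longrightarrow> j \<in> J2 \<Longrightarrow> A i j = 0"
  shows "(minor A (I1 \<union> I2) (J1 \<union> J2))\<^sup>2 = (minor A I1 J1)\<^sup>2 * (minor A I2 J2)\<^sup>2"
proof -
  note e = fin[THEN enum_set(1)] fin[THEN enum_set(2)] fin[THEN enum_set(3)]
  let ?M = "\<lambda>I J. Matrix.mat (card I) (card J) (\<lambda>(p, q). A (enum_set I ! p) (enum_set J ! q))"
  let ?xs = "enum_set I1 @ enum_set I2" and ?ys = "enum_set J1 @ enum_set J2"
  have mem: "enum_set I ! p \<in> I" if "finite I" "p < card I" for I :: "'x set" and p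
    using enum_set[OF that(1)] that(2) by (metis nth_mem)
  have "(minor A (set ?xs) (set ?ys))\<^sup>2 =
    (Determinant.det (Matrix.mat (length ?xs) (length ?ys) (\<lambda>(i, j). A (?xs ! i) (?ys ! j))))\<^sup>2"
    by (rule minor_sq_lists) (use disj e card in auto)
  also have "Matrix.mat (length ?xs) (length ?ys) (\<lambda>(i, j). A (?xs ! i) (?ys ! j)) =
    four_block_mat (?M I1 J1) (0\<^sub>m (card I1) (card J2)) (?M I2 J1) (?M I2 J2)"
  proof (rule eq_matI, goal_cases)
    case (1 i j)
    then have ij: "i < card I1 + card I2" "j < card J1 + card J2" by auto
    show ?case
    proof (cases "i < card I1")
      case True
      show ?thesis
      proof (cases "j < card J1")
        case False
        then have "A (enum_set I1 ! i) (enum_set J2 ! (j - card J1)) = 0"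
          using True ij by (intro zero mem fin) auto
        then show ?thesis using True False ij card by (simp add: e nth_append)
      qed (use True ij card in \<open>simp add: e nth_append\<close>)
    next
      case False
      then show ?thesis using ij card by (simp add: e nth_append)
    qed
  qed (simp_all add: e)
  also have "Determinant.det \<dots> = Determinant.det (?M I1 J1) * Determinant.det (?M I2 J2)"
    by (rule det_four_block_mat_upper_right_zero) (use card in auto)
  finally show ?thesis by (simp add: e minor_def power_mult_distrib)
qed

lemma minor_mult:
  assumes "finite J" "card I = card J" "card K = card J"
  shows "minor A I J * minor B J K = minor (\<lambda>i k. \<Sum>j\<in>J. A i j * B j k) I K"
proof -
  let ?n = "card J"
  let ?M = "\<lambda>A I J. Matrix.mat ?n ?n (\<lambda>(p, q). A (enum_set I ! p) (enum_set J ! q))"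
  have "?M A I J * ?M B J K = ?M (\<lambda>i k. \<Sum>j\<in>J. A i j * B j k) I K"
  proof (rule eq_matI, goal_cases)
    case (1 p r)
    then have "(?M A I J * ?M B J K) $$ (p, r) =
        (\<Sum>q = 0..<?n. A (enum_set I ! p) (enum_set J ! q) * B (enum_set J ! q) (enum_set K ! r))"
      by (simp add: scalar_prod_def)
    also have "\<dots> = (\<Sum>j\<in>J. A (enum_set I ! p) j * B j (enum_set K ! r))"
      using bij_betw_enum_set[OF assms(1)]
      by (intro sum.reindex_bij_betw) (simp add: atLeast0LessThan)
    finally show ?case using 1 by simp
  qed simp_all
  then have "Determinant.det (?M (\<lambda>i k. \<Sum>j\<in>J. A i j * B j k) I K) =
      Determinant.det (?M A I J) * Determinant.det (?M B J K)"
    using det_mult[of "?M A I J" ?n "?M B J K"] by simp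
  then show ?thesis using assms by (simp add: minor_def)
qed

lemma minor_delta:
  assumes "finite I"
  shows "minor (\<lambda>i j. if i = j then 1 else 0) I I = 1"
proof -
  have "Matrix.mat (card I) (card I) (\<lambda>(p, q). if enum_set I ! p = enum_set I ! q then 1 else 0) = (1\<^sub>m (card I) :: real mat)"
    using enum_set[OF assms] by (intro eq_matI) (auto simp: nth_eq_iff_index_eq)
  then show ?thesis unfolding minor_def by (simp only: det_one)
qed

text \<open>Torsion does not depend on the basis vectors chosen for its minors. Stack the
  rows \<open>B\<close> on unit rows at \<open>R'\<close>, and put the columns \<open>A\<close> next to unit columns outside \<open>R\<close>. Up to
  sign, the determinants of these square matrices are \<open>minor B Q (X - R')\<close> and \<open>minor A R T\<close>; their
  product has the zero block \<open>B A\<close> and its determinant is, up to sign,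
  \<open>minor B Q (X - R)\<close> times \<open>minor A R' T\<close>.\<close>

lemma minor_sq_exchange:
  fixes A :: "'c \<Rightarrow> 'm \<Rightarrow> real" and B :: "'e \<Rightarrow> 'c \<Rightarrow> real"
  assumes fin: "finite X" "finite T" "finite Q"
    and R: "R \<subseteq> X" "card R = card T" and R': "R' \<subseteq> X" "card R' = card T"
    and card: "card Q + card T = card X"
    and complex: "\<And>e a. e \<in> Q \<Longrightarrow> a \<in> T \<Longrightarrow> (\<Sum>c\<in>X. B e c * A c a) = 0"
  shows "(minor A R T * minor B Q (X - R'))\<^sup>2 = (minor A R' T * minor B Q (X - R))\<^sup>2"
proof -
  note finR = finite_subset[OF R(1) fin(1)] finite_subset[OF R'(1) fin(1)]
  have cardX: "card (X - R) = card Q" "card (X - R') = card Q"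
    using card R R' fin finR by (simp_all add: card_Diff_subset)
  define S where "S = (\<lambda>i c. case i of Inl e \<Rightarrow> B e c | Inr r \<Rightarrow> if r = c then 1 else (0::real))"
  define P where "P = (\<lambda>c j. case j of Inl a \<Rightarrow> A c a | Inr d \<Rightarrow> if c = d then 1 else (0::real))"
  define I where "I = Inr ` R' \<union> (Inl ` Q :: ('e + 'c) set)"
  define J where "J = (Inl ` T \<union> Inr ` (X - R) :: ('m + 'c) set)"
  note cards = card_image[OF inj_Inl] card_image[OF inj_Inr] card_image
  have cI: "card I = card X" unfolding I_def
    by (subst card_Un_disjoint) (use fin finR card R' in \<open>auto simp: card_image\<close>)
  have cJ: "card J = card X" unfolding J_def
    by (subst card_Un_disjoint) (use fin finR card cardX in \<open>auto simp: card_image\<close>)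
  have detS: "(minor S I X)\<^sup>2 = (minor B Q (X - R'))\<^sup>2"
  proof -
    have "(minor S I (R' \<union> (X - R')))\<^sup>2 = (minor S (Inr ` R') R')\<^sup>2 * (minor S (Inl ` Q) (X - R'))\<^sup>2"
      unfolding I_def by (rule minor_sq_block_triangular)
        (use fin finR cardX in \<open>auto simp: card_image S_def\<close>)
    moreover have "(minor S (Inr ` R') (id ` R'))\<^sup>2 = 1"
      by (subst minor_sq_image) (use finR in \<open>simp_all add: S_def minor_delta\<close>)
    moreover have "(minor S (Inl ` Q) (id ` (X - R')))\<^sup>2 = (minor B Q (X - R'))\<^sup>2"
      by (subst minor_sq_image) (use fin cardX in \<open>simp_all add: S_def\<close>)
    moreover have "R' \<union> (X - R') = X" using R' by auto
    ultimately show ?thesis by simp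
  qed
  have detP: "(minor P X J)\<^sup>2 = (minor A R T)\<^sup>2"
  proof -
    have "(minor P (R \<union> (X - R)) J)\<^sup>2 = (minor P R (Inl ` T))\<^sup>2 * (minor P (X - R) (Inr ` (X - R)))\<^sup>2"
      unfolding J_def by (rule minor_sq_block_triangular)
        (use fin finR R in \<open>auto simp: card_image P_def\<close>)
    moreover have "(minor P (id ` R) (Inl ` T))\<^sup>2 = (minor A R T)\<^sup>2"
      by (subst minor_sq_image) (use fin finR R in \<open>simp_all add: P_def\<close>)
    moreover have "(minor P (id ` (X - R)) (Inr ` (X - R)))\<^sup>2 = 1"
      by (subst minor_sq_image) (use fin in \<open>simp_all add: P_def minor_delta\<close>)
    moreover have "R \<union> (X - R) = X" using R by auto
    ultimately show ?thesis by simp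
  qed
  let ?SP = "\<lambda>i j. \<Sum>c\<in>X. S i c * P c j"
  have detSP: "(minor ?SP I J)\<^sup>2 = (minor A R' T)\<^sup>2 * (minor B Q (X - R))\<^sup>2"
  proof -
    have "I = Inl ` Q \<union> Inr ` R'" "J = Inr ` (X - R) \<union> Inl ` T" unfolding I_def J_def by auto
    then have "(minor ?SP I J)\<^sup>2 = (minor ?SP (Inl ` Q) (Inr ` (X - R)))\<^sup>2 * (minor ?SP (Inr ` R') (Inl ` T))\<^sup>2"
      by (simp only:, intro minor_sq_block_triangular)
        (use fin finR cardX R' in \<open>auto simp: card_image S_def P_def complex\<close>)
    moreover have "(minor ?SP (Inl ` Q) (Inr ` (X - R)))\<^sup>2 = (minor B Q (X - R))\<^sup>2"
    proof (subst minor_sq_image)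
      have "minor (\<lambda>e d. \<Sum>c\<in>X. S (Inl e) c * P c (Inr d)) Q (X - R) = minor B Q (X - R)"
        by (rule minor_cong) (use fin in \<open>auto simp: S_def P_def sum.delta' if_distrib cong: if_cong\<close>)
      then show "(minor (\<lambda>e d. \<Sum>c\<in>X. S (Inl e) c * P c (Inr d)) Q (X - R))\<^sup>2 = (minor B Q (X - R))\<^sup>2"
        by simp
    qed (use fin cardX in auto)
    moreover have "(minor ?SP (Inr ` R') (Inl ` T))\<^sup>2 = (minor A R' T)\<^sup>2"
    proof (subst minor_sq_image)
      have "(\<Sum>c\<in>X. S (Inr r) c * P c (Inl a)) = A r a" if "r \<in> R'" for r a
      proof -
        have "(\<Sum>c\<in>X. S (Inr r) c * P c (Inl a)) = (\<Sum>c\<in>X. if r = c then A c a else 0)"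
          by (intro sum.cong) (auto simp: S_def P_def)
        then show ?thesis using that R' fin by (auto simp: sum.delta)
      qed
      then have "minor (\<lambda>r a. \<Sum>c\<in>X. S (Inr r) c * P c (Inl a)) R' T = minor A R' T"
        by (intro minor_cong) (use fin finR in auto)
      then show "(minor (\<lambda>r a. \<Sum>c\<in>X. S (Inr r) c * P c (Inl a)) R' T)\<^sup>2 = (minor A R' T)\<^sup>2"
        by simp
    qed (use fin finR R' in auto)
    ultimately show ?thesis by simp
  qed
  have "minor S I X * minor P X J = minor ?SP I J"
    by (rule minor_mult) (use fin cI cJ in auto)
  then have "(minor S I X)\<^sup>2 * (minor P X J)\<^sup>2 = (minor ?SP I J)\<^sup>2"
    by (metis power_mult_distrib)
  then show ?thesis unfolding detS detP detSP by (simp add: power_mult_distrib mult_ac)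
qed

section \<open>Homogeneous systems and the number of minimal constraints\<close>

lemma homogeneous_system_nontrivial:
  fixes a :: "'i \<Rightarrow> 'j \<Rightarrow> real"
  assumes "finite I" "finite J" "card I < card J"
  shows "\<exists>y. (\<exists>j\<in>J. y j \<noteq> 0) \<and> (\<forall>i\<in>I. (\<Sum>j\<in>J. a i j * y j) = 0)"
  using assms
proof (induction I arbitrary: J a rule: finite_induct)
  case empty
  then obtain j where "j \<in> J" by (metis card_gt_0_iff ex_in_conv card.empty)
  then show ?case by (intro exI[of _ "\<lambda>_. 1"]) auto
next
  case (insert i I)
  show ?case
  proof (cases "\<forall>j\<in>J. a i j = 0")
    case True
    obtain y where "\<exists>j\<in>J. y j \<noteq> 0" "\<forall>i\<in>I. (\<Sum>j\<in>J. a i j * y j) = 0"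
      using insert.IH[of J a] insert.hyps insert.prems by auto
    then show ?thesis using True by (intro exI[of _ y]) auto
  next
    case False
    then obtain k where k: "k \<in> J" "a i k \<noteq> 0" by auto
    define J' where "J' = J - {k}"
    have J': "finite J'" "card I < card J'" "k \<notin> J'" "J = insert k J'"
      using insert k by (auto simp: J'_def)
    obtain y where y: "\<exists>j\<in>J'. y j \<noteq> 0"
        "\<And>i'. i' \<in> I \<Longrightarrow> (\<Sum>j\<in>J'. (a i' j - a i' k * a i j / a i k) * y j) = 0"
      using insert.IH[OF J'(1,2), of "\<lambda>i' j. a i' j - a i' k * a i j / a i k"] by blast
    define z where "z = y(k := - (\<Sum>j\<in>J'. a i j * y j) / a i k)"
    have eq: "(\<Sum>j\<in>J. a i' j * z j) = (\<Sum>j\<in>J'. (a i' j - a i' k * a i j / a i k) * y j)" for i'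
    proof -
      have "(\<Sum>j\<in>J'. a i' j * z j) = (\<Sum>j\<in>J'. a i' j * y j)"
        using J'(3) by (intro sum.cong) (auto simp: z_def)
      then have "(\<Sum>j\<in>J. a i' j * z j) = a i' k * z k + (\<Sum>j\<in>J'. a i' j * y j)"
        using J' by simp
      also have "a i' k * z k = - (\<Sum>j\<in>J'. a i' k * a i j / a i k * y j)"
        by (simp add: z_def sum_distrib_left sum_divide_distrib mult.assoc)
      finally show ?thesis by (simp add: left_diff_distrib sum_subtractf)
    qed
    have "(\<Sum>j\<in>J'. (a i j - a i k * a i j / a i k) * y j) = 0" using k by simp
    then have "\<forall>i'\<in>insert i I. (\<Sum>j\<in>J. a i' j * z j) = 0" using y(2) eq by auto
    moreover have "\<exists>j\<in>J. z j \<noteq> 0" using y(1) J'(3,4) by (auto simp: z_def)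
    ultimately show ?thesis by blast
  qed
qed

lemma minor_nonzero_right:
  assumes fin: "finite I" "finite J" and nz: "minor A I J \<noteq> 0"
    and zero: "\<And>i. i \<in> I \<Longrightarrow> (\<Sum>j\<in>J. A i j * y j) = 0" and "j \<in> J"
  shows "y j = 0"
proof -
  define n where "n = card J"
  have card: "card I = n" using nz minor_nonsquare[of I J A] by (auto simp: n_def)
  let ?M = "Matrix.mat n n (\<lambda>(p, q). A (enum_set I ! p) (enum_set J ! q))"
  define v where "v = Matrix.vec n (\<lambda>q. y (enum_set J ! q))"
  have "?M *\<^sub>v v = 0\<^sub>v n"
  proof (rule eq_vecI, goal_cases)
    case (1 p)
    then have p: "p < n" by simp
    then have "enum_set I ! p \<in> I" using enum_set[OF fin(1)] card by (metis nth_mem)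
    then have "0 = (\<Sum>j\<in>J. A (enum_set I ! p) j * y j)" using zero by simp
    also have "\<dots> = (\<Sum>q = 0..<n. A (enum_set I ! p) (enum_set J ! q) * y (enum_set J ! q))"
      using bij_betw_enum_set[OF fin(2)]
      by (intro sum.reindex_bij_betw[symmetric]) (simp add: atLeast0LessThan n_def)
    finally show ?case using p by (simp add: scalar_prod_def v_def)
  qed simp
  moreover have "Determinant.det ?M \<noteq> 0" using nz card by (simp add: minor_def n_def)
  moreover have "v \<in> carrier_vec n" by (simp add: v_def)
  ultimately have "v = 0\<^sub>v n"
    using det_0_iff_vec_prod_zero_field[of ?M n] mat_carrier by blast
  then have "y (enum_set J ! q) = 0" if "q < n" for q
    using that by (auto simp: v_def vec_eq_iff)
  moreover obtain q where "q < n" "j = enum_set J ! q"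
    using \<open>j \<in> J\<close> enum_set[OF fin(2)] by (metis in_set_conv_nth n_def)
  ultimately show ?thesis by blast
qed

lemma minor_nonzero_left:
  assumes "finite I" "finite J" "minor A I J \<noteq> 0"
    and "\<And>j. j \<in> J \<Longrightarrow> (\<Sum>i\<in>I. y i * A i j) = 0" and "i \<in> I"
  shows "y i = 0"
proof (rule minor_nonzero_right[OF assms(2,1) _ _ assms(5), where A = "\<lambda>j i. A i j"])
  show "minor (\<lambda>j i. A i j) J I \<noteq> 0" using assms(3) minor_transpose[of A J I] by metis
  show "(\<Sum>i\<in>I. A i j * y i) = 0" if "j \<in> J" for j
    using assms(4)[OF that] by (simp add: mult.commute)
qed

text \<open>The constraints \<open>B\<close> cut out exactly the image of the injective map \<open>A\<close>. A
  vector supported outside \<open>R\<close> and satisfying them lies in this image and vanishes on \<open>R\<close>, hence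
  is zero; so there are at least \<open>card (X - R)\<close> constraints. Conversely, more constraints would have a linear
  relation outside \<open>R\<close>, and because \<open>B A = 0\<close> it extends to a relation on all of \<open>X\<close>; then some
  constraint follows from the others, against minimality.\<close>

lemma minimal_constraints_card:
  fixes A :: "'c \<Rightarrow> 'm \<Rightarrow> real" and B :: "'e \<Rightarrow> 'c \<Rightarrow> real"
  assumes fin: "finite X" "finite T" "finite Q"
    and R: "R \<subseteq> X" "minor A R T \<noteq> 0"
    and complex: "\<And>e a. e \<in> Q \<Longrightarrow> a \<in> T \<Longrightarrow> (\<Sum>c\<in>X. B e c * A c a) = 0"
    and rigid: "\<And>y. (\<And>e. e \<in> Q \<Longrightarrow> (\<Sum>c\<in>X. B e c * y c) = 0) \<Longrightarrow>
        \<exists>z. \<forall>c\<in>X. y c = (\<Sum>a\<in>T. A c a * z a)"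
    and minimal: "\<And>e0. e0 \<in> Q \<Longrightarrow> \<exists>y. (\<forall>e\<in>Q - {e0}. (\<Sum>c\<in>X. B e c * y c) = 0) \<and>
        \<not> (\<exists>z. \<forall>c\<in>X. y c = (\<Sum>a\<in>T. A c a * z a))"
  shows "card Q + card T = card X"
proof -
  have finR: "finite R" using R fin by (auto intro: finite_subset)
  have cR: "card R = card T" using R minor_nonsquare by metis
  have cX: "card (X - R) = card X - card T" "card T \<le> card X"
    using R fin finR cR by (auto simp: card_Diff_subset intro: card_mono simp flip: cR)
  have "\<not> card Q < card (X - R)"
  proof
    assume "card Q < card (X - R)"
    then obtain y where y: "\<exists>c\<in>X - R. y c \<noteq> 0" "\<And>e. e \<in> Q \<Longrightarrow> (\<Sum>c\<in>X - R. B e c * y c) = 0"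
      using homogeneous_system_nontrivial[of Q "X - R" B] fin by auto
    define y' where "y' c = (if c \<in> R then 0 else y c)" for c
    have "(\<Sum>c\<in>X. B e c * y' c) = 0" if "e \<in> Q" for e
    proof -
      have "(\<Sum>c\<in>X. B e c * y' c) = (\<Sum>c\<in>X - R. B e c * y c)"
        by (intro sum.mono_neutral_cong_right) (use fin in \<open>auto simp: y'_def\<close>)
      then show ?thesis using y(2) that by simp
    qed
    then obtain z where z: "\<And>c. c \<in> X \<Longrightarrow> y' c = (\<Sum>a\<in>T. A c a * z a)" using rigid[of y'] by blast
    have "z a = 0" if "a \<in> T" for a
    proof (rule minor_nonzero_right[OF finR fin(2) R(2) _ that])
      fix c assume "c \<in> R"
      then show "(\<Sum>a\<in>T. A c a * z a) = 0" using z[of c] R(1) by (auto simp: y'_def)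
    qed
    then have "y' c = 0" if "c \<in> X" for c using z[OF that] by simp
    then show False using y(1) by (force simp: y'_def)
  qed
  moreover have "\<not> card (X - R) < card Q"
  proof
    assume "card (X - R) < card Q"
    then obtain l where l: "\<exists>e\<in>Q. l e \<noteq> 0" "\<And>c. c \<in> X - R \<Longrightarrow> (\<Sum>e\<in>Q. B e c * l e) = 0"
      using homogeneous_system_nontrivial[of "X - R" Q "\<lambda>c e. B e c"] fin by auto
    \<comment> \<open>the linear combination of the constraints, a functional that vanishes outside R and on the image of A\<close>
    define \<phi> where "\<phi> c = (\<Sum>e\<in>Q. B e c * l e)" for c
    have swap: "(\<Sum>c\<in>X. \<phi> c * y c) = (\<Sum>e\<in>Q. l e * (\<Sum>c\<in>X. B e c * y c))" for y
      unfolding \<phi>_def sum_distrib_left sum_distrib_right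
      by (subst sum.swap) (simp add: mult_ac)
    have "\<phi> c = 0" if "c \<in> R" for c
    proof (rule minor_nonzero_left[OF finR fin(2) R(2) _ that])
      fix a assume a: "a \<in> T"
      have "(\<Sum>c\<in>R. \<phi> c * A c a) = (\<Sum>c\<in>X. \<phi> c * A c a)"
        by (intro sum.mono_neutral_left) (use fin R l(2) in \<open>auto simp: \<phi>_def\<close>)
      also have "\<dots> = 0" unfolding swap using complex a by simp
      finally show "(\<Sum>c\<in>R. \<phi> c * A c a) = 0" .
    qed
    then have \<phi>0: "\<phi> c = 0" if "c \<in> X" for c using l(2)[of c] that by (auto simp: \<phi>_def)
    obtain e0 where e0: "e0 \<in> Q" "l e0 \<noteq> 0" using l(1) by blast
    obtain y where y: "\<forall>e\<in>Q - {e0}. (\<Sum>c\<in>X. B e c * y c) = 0"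
        "\<not> (\<exists>z. \<forall>c\<in>X. y c = (\<Sum>a\<in>T. A c a * z a))"
      using minimal[OF e0(1)] by blast
    have "0 = (\<Sum>e\<in>Q. l e * (\<Sum>c\<in>X. B e c * y c))" using \<phi>0 swap[of y] by simp
    also have "\<dots> = l e0 * (\<Sum>c\<in>X. B e0 c * y c)"
      using y(1) fin e0 by (subst sum.remove[of _ e0]) auto
    finally have "(\<Sum>c\<in>X. B e0 c * y c) = 0" using e0 by simp
    then have "(\<Sum>c\<in>X. B e c * y c) = 0" if "e \<in> Q" for e using y(1) that by (cases "e = e0") auto
    then show False using rigid[of y] y(2) by blast
  qed
  ultimately show ?thesis using cX by simp
qed

section \<open>Products, exponentials and integrals of Grassmann elements\<close>

lemma inversions_Un_left:
  assumes "finite S" "finite S'" "finite T" "S \<inter> S' = {}"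
  shows "inversions (S \<union> S') T = inversions S T + inversions S' T"
proof -
  let ?A = "\<lambda>S. {(s, t). s \<in> S \<and> t \<in> T \<and> (t, s) \<in> generator_order}"
  have "finite (?A S)" if "finite S" for S
    by (rule finite_subset[of _ "S \<times> T"]) (use that assms in auto)
  then have "card (?A S \<union> ?A S') = card (?A S) + card (?A S')"
    by (intro card_Un_disjoint) (use assms in auto)
  moreover have "?A (S \<union> S') = ?A S \<union> ?A S'" by auto
  ultimately show ?thesis by (simp add: inversions_def)
qed

lemma inversions_Un_right:
  assumes "finite S" "finite T" "finite T'" "T \<inter> T' = {}"
  shows "inversions S (T \<union> T') = inversions S T + inversions S T'"
proof -
  let ?A = "\<lambda>T. {(s, t). s \<in> S \<and> t \<in> T \<and> (t, s) \<in> generator_order}"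
  have "finite (?A T)" if "finite T" for T
    by (rule finite_subset[of _ "S \<times> T"]) (use that assms in auto)
  then have "card (?A T \<union> ?A T') = card (?A T) + card (?A T')"
    by (intro card_Un_disjoint) (use assms in auto)
  moreover have "?A (T \<union> T') = ?A T \<union> ?A T'" by auto
  ultimately show ?thesis by (simp add: inversions_def)
qed

lemma generator_order_swap:
  assumes "a \<noteq> b"
  shows "(b, a) \<in> generator_order \<longleftrightarrow> (a, b) \<notin> generator_order"
proof -
  have "total_on UNIV (generator_order :: ('a \<times> 'a) set)" "antisym (generator_order :: ('a \<times> 'a) set)"
    using linear_generator_order[where 'g = 'a] by (simp_all add: linear_order_on_def partial_order_on_def)
  then show ?thesis using assms antisymD[of generator_order a b] by (auto simp: total_on_def)
qed

text \<open>Each pair of generators is inverted in exactly one of the two orders.\<close>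

lemma inversions_swap:
  assumes "finite S" "finite T" "S \<inter> T = {}"
  shows "inversions S T + inversions T S = card S * card T"
proof -
  let ?A = "{(s, t). s \<in> S \<and> t \<in> T \<and> (t, s) \<in> generator_order}"
  let ?B = "{(s, t). s \<in> S \<and> t \<in> T \<and> (s, t) \<in> generator_order}"
  have ne: "s \<noteq> t" if "s \<in> S" "t \<in> T" for s t using that assms by auto
  have "?B = prod.swap ` {(s, t). s \<in> T \<and> t \<in> S \<and> (t, s) \<in> generator_order}" by force
  then have B: "card ?B = inversions T S"
    unfolding inversions_def by (simp add: card_image)
  have sub: "?A \<subseteq> S \<times> T" "?B \<subseteq> S \<times> T" by auto
  have "card (?A \<union> ?B) = card ?A + card ?B"
    by (intro card_Un_disjoint finite_subset[OF sub(1)] finite_subset[OF sub(2)])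
      (use assms ne generator_order_swap in \<open>fastforce+\<close>)
  moreover have "?A \<union> ?B = S \<times> T" using ne generator_order_swap by fastforce
  ultimately show ?thesis using B by (simp add: inversions_def card_cartesian_product)
qed

lemma gr_mult_infinite: "infinite U \<Longrightarrow> gr_mult f h U = 0"
  by (simp add: gr_mult_def)

lemma gr_mult_assoc: "gr_mult (gr_mult f g) h = gr_mult f (gr_mult g h)"
proof
  fix U
  show "gr_mult (gr_mult f g) h U = gr_mult f (gr_mult g h) U"
  proof (cases "finite U")
    case True
    let ?s = "\<lambda>S T. (-1 :: real) ^ inversions S T"
    have "gr_mult (gr_mult f g) h U = (\<Sum>S\<in>Pow U. \<Sum>T\<in>Pow S.
        ?s S (U - S) * ?s T (S - T) * (f T * g (S - T) * h (U - S)))"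
      unfolding gr_mult_def by (simp add: sum_distrib_left sum_distrib_right mult_ac)
    also have "\<dots> = (\<Sum>(S, T)\<in>Sigma (Pow U) Pow.
        ?s S (U - S) * ?s T (S - T) * (f T * g (S - T) * h (U - S)))"
      using True by (intro sum.Sigma) (auto intro: finite_subset)
    also have "\<dots> = (\<Sum>(T, V)\<in>Sigma (Pow U) (\<lambda>T. Pow (U - T)).
        ?s T (U - T) * ?s V (U - T - V) * (f T * g V * h (U - T - V)))"
    proof (rule sum.reindex_bij_witness[where i = "\<lambda>(T, V). (T \<union> V, T)" and j = "\<lambda>(S, T). (T, S - T)"])
      fix a assume "a \<in> Sigma (Pow U) Pow"
      then obtain S T where a: "a = (S, T)" "S \<subseteq> U" "T \<subseteq> S" by auto
      have fin: "finite T" "finite (S - T)" "finite (U - S)" using True a by (auto intro: finite_subset)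
      have "inversions S (U - S) = inversions T (U - S) + inversions (S - T) (U - S)"
        using inversions_Un_left[of T "S - T" "U - S"] fin a by (simp add: Un_absorb1)
      moreover have "inversions T (U - T) = inversions T (S - T) + inversions T (U - S)"
      proof -
        have "U - T = (S - T) \<union> (U - S)" using a by auto
        then show ?thesis using inversions_Un_right[of T "S - T" "U - S"] fin by auto
      qed
      moreover have "U - T - (S - T) = U - S" using a by auto
      ultimately show "(case case a of (S, T) \<Rightarrow> (T, S - T) of (T, V) \<Rightarrow>
          ?s T (U - T) * ?s V (U - T - V) * (f T * g V * h (U - T - V))) =
          (case a of (S, T) \<Rightarrow> ?s S (U - S) * ?s T (S - T) * (f T * g (S - T) * h (U - S)))"
        using a by (simp add: power_add mult_ac)
    qed auto
    also have "\<dots> = (\<Sum>T\<in>Pow U. \<Sum>V\<in>Pow (U - T).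
        ?s T (U - T) * ?s V (U - T - V) * (f T * g V * h (U - T - V)))"
      using True by (intro sum.Sigma[symmetric]) auto
    also have "\<dots> = gr_mult f (gr_mult g h) U"
      unfolding gr_mult_def by (simp add: sum_distrib_left mult_ac)
    finally show ?thesis .
  qed (simp add: gr_mult_infinite)
qed

definition gr_even :: "'g grassmann \<Rightarrow> bool" where
  "gr_even f \<longleftrightarrow> (\<forall>U. f U \<noteq> 0 \<longrightarrow> finite U \<and> even (card U))"

text \<open>Moving a monomial of even degree past another monomial takes an even number of
  transpositions.\<close>

lemma gr_mult_commute:
  assumes "gr_even f"
  shows "gr_mult f g = gr_mult g f"
proof
  fix U
  show "gr_mult f g U = gr_mult g f U"
  proof (cases "finite U")
    case True
    have "gr_mult f g U = (\<Sum>S\<in>Pow U. (-1) ^ inversions (U - S) S * f (U - S) * g S)"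
      unfolding gr_mult_def
      by (rule sum.reindex_bij_witness[where i = "\<lambda>S. U - S" and j = "\<lambda>S. U - S"])
        (auto simp: double_diff)
    also have "\<dots> = gr_mult g f U"
      unfolding gr_mult_def
    proof (rule sum.cong)
      fix S assume S: "S \<in> Pow U"
      show "(-1) ^ inversions (U - S) S * f (U - S) * g S = (-1) ^ inversions S (U - S) * g S * f (U - S)"
      proof (cases "f (U - S) = 0")
        case False
        then have "even (card (U - S))" using assms by (auto simp: gr_even_def)
        moreover have "inversions S (U - S) + inversions (U - S) S = card S * card (U - S)"
          by (rule inversions_swap) (use True S in \<open>auto intro: finite_subset\<close>)
        ultimately have "even (inversions S (U - S) + inversions (U - S) S)" by simp
        then show ?thesis by (simp add: minus_one_power_iff)
      qed simp
    qed simp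
    finally show ?thesis .
  qed (simp add: gr_mult_infinite)
qed

lemma gr_mult_scale:
  "gr_mult (\<lambda>U. c * f U) h = (\<lambda>U. c * gr_mult f h U)"
  "gr_mult f (\<lambda>U. c * h U) = (\<lambda>U. c * gr_mult f h U)"
  by (simp_all add: gr_mult_def sum_distrib_left mult_ac)

lemma gr_mult_sum:
  "gr_mult (\<lambda>U. \<Sum>i\<in>I. f i U) h U = (\<Sum>i\<in>I. gr_mult (f i) h U)"
  "gr_mult g (\<lambda>U. \<Sum>i\<in>I. f i U) U = (\<Sum>i\<in>I. gr_mult g (f i) U)"
  unfolding gr_mult_def sum_distrib_left sum_distrib_right
  by (rule sum.swap)+

lemma gr_mult_add_left:
  "gr_mult (\<lambda>U. f U + g U) h U = gr_mult f h U + gr_mult g h U"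
  by (simp add: gr_mult_def algebra_simps sum.distrib)

lemma gr_mult_one_left: "finite U \<Longrightarrow> gr_mult gr_one f U = f U"
proof -
  assume "finite U"
  have "gr_mult gr_one f U = (\<Sum>S\<in>Pow U. if S = {} then f U else 0)"
    unfolding gr_mult_def by (intro sum.cong) (auto simp: gr_one_def inversions_def)
  then show ?thesis using \<open>finite U\<close> by (simp add: sum.delta)
qed

text \<open>The terms \<open>f ^ n / n!\<close> of the exponential series. With the factorials included,
  the binomial theorem has no coefficients.\<close>

definition gr_divided_power :: "'g grassmann \<Rightarrow> nat \<Rightarrow> 'g grassmann" where
  "gr_divided_power f n = (\<lambda>U. (gr_mult f ^^ n) gr_one U / fact n)"

lemma gr_divided_power_0: "gr_divided_power f 0 = gr_one"
  by (simp add: gr_divided_power_def)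

lemma gr_divided_power_Suc:
  "gr_mult f (gr_divided_power f n) = (\<lambda>U. real (Suc n) * gr_divided_power f (Suc n) U)"
proof -
  have "gr_divided_power f n = (\<lambda>U. (1 / fact n) * (gr_mult f ^^ n) gr_one U)"
    by (simp add: gr_divided_power_def)
  then show ?thesis
    by (simp only: gr_mult_scale) (simp add: gr_divided_power_def fun_eq_iff field_simps del: of_nat_Suc)
qed

text \<open>Every factor \<open>f\<close> contributes at least one generator, so the series is finite at
  each monomial.\<close>

lemma gr_divided_power_vanish:
  assumes "f {} = 0" "infinite U \<or> card U < n"
  shows "gr_divided_power f n U = 0"
proof -
  have "(gr_mult f ^^ n) gr_one U = 0" using assms(2)
  proof (induction n arbitrary: U)
    case 0
    then show ?case by (auto simp: gr_one_def)
  next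
    case (Suc n)
    have "f S * (gr_mult f ^^ n) gr_one (U - S) = 0" if "finite U" "S \<subseteq> U" for S
    proof (cases "S = {}")
      case False
      then have "card (U - S) < card U"
        using that by (intro psubset_card_mono) auto
      then have "card (U - S) < n" using Suc.prems that by auto
      then show ?thesis using Suc.IH by simp
    qed (simp add: assms)
    then have "gr_mult f ((gr_mult f ^^ n) gr_one) U = 0" if "finite U"
      using that unfolding gr_mult_def[of f "(gr_mult f ^^ n) gr_one"] mult.assoc
      by (intro sum.neutral) auto
    then show ?case using gr_mult_infinite by fastforce
  qed
  then show ?thesis by (simp add: gr_divided_power_def)
qed

lemma gr_exp_eq_sum:
  assumes "f {} = 0" "card U \<le> N"
  shows "gr_exp f U = (\<Sum>n\<le>N. gr_divided_power f n U)"
proof -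
  have "gr_exp f U = (\<Sum>n. gr_divided_power f n U)" by (simp add: gr_exp_def gr_divided_power_def)
  also have "\<dots> = (\<Sum>n\<le>N. gr_divided_power f n U)"
    by (rule suminf_finite) (use assms in \<open>auto intro!: gr_divided_power_vanish\<close>)
  finally show ?thesis .
qed

lemma gr_exp_infinite:
  assumes "f {} = 0" "infinite U" shows "gr_exp f U = 0"
  using gr_exp_eq_sum[of f U 0] assms gr_divided_power_vanish[of f U 0] by simp

text \<open>The binomial theorem, by induction from \<open>(n + 1) d (n + 1) = (f + g) d n\<close>: in the
  product with the \<open>i\<close>-th term of the sum, \<open>f\<close> gives the factor \<open>i + 1\<close> and \<open>g\<close> the factor
  \<open>n - i + 1\<close>, so that each new term is counted \<open>n + 1\<close> times in total.\<close>

lemma gr_divided_power_add: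
  assumes "gr_even g"
  shows "gr_divided_power (\<lambda>U. f U + g U) n U =
    (\<Sum>i\<le>n. gr_mult (gr_divided_power f i) (gr_divided_power g (n - i)) U)"
proof (induction n arbitrary: U)
  case 0
  show ?case
  proof (cases "finite U")
    case False
    then have "gr_one U = 0" by (auto simp: gr_one_def)
    then show ?thesis using False by (simp add: gr_divided_power_0 gr_mult_infinite)
  qed (simp add: gr_divided_power_0 gr_mult_one_left)
next
  case (Suc n)
  let ?h = "\<lambda>U. f U + g U" and ?d = gr_divided_power
  let ?X = "\<lambda>i. gr_mult (?d f i) (?d g (Suc n - i)) U"
  have IH: "?d ?h n = (\<lambda>U. \<Sum>i\<le>n. gr_mult (?d f i) (?d g (n - i)) U)" using Suc.IH by (intro ext)
  have left: "gr_mult f (gr_mult (?d f i) (?d g (n - i))) U = real (Suc i) * ?X (Suc i)" for i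
    by (simp only: gr_mult_assoc[symmetric] gr_divided_power_Suc gr_mult_scale diff_Suc_Suc)
  have right: "gr_mult g (gr_mult (?d f i) (?d g (n - i))) U = real (Suc n - i) * ?X i" if "i \<le> n" for i
  proof -
    have "gr_mult g (gr_mult (?d f i) (?d g (n - i))) = gr_mult (?d f i) (gr_mult g (?d g (n - i)))"
      by (metis gr_mult_assoc gr_mult_commute[OF assms])
    then show ?thesis
      using that by (simp only: gr_divided_power_Suc gr_mult_scale Suc_diff_le)
  qed
  have "real (Suc n) * ?d ?h (Suc n) U = gr_mult ?h (?d ?h n) U"
    by (simp only: gr_divided_power_Suc)
  also have "\<dots> = (\<Sum>i\<le>n. real (Suc i) * ?X (Suc i)) + (\<Sum>i\<le>n. real (Suc n - i) * ?X i)"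
    unfolding gr_mult_add_left IH gr_mult_sum left using right by simp
  also have "(\<Sum>i\<le>n. real (Suc i) * ?X (Suc i)) = (\<Sum>i\<le>Suc n. real i * ?X i)"
    by (subst sum.atMost_Suc_shift) simp
  also have "(\<Sum>i\<le>n. real (Suc n - i) * ?X i) = (\<Sum>i\<le>Suc n. real (Suc n - i) * ?X i)" by simp
  also have "(\<Sum>i\<le>Suc n. real i * ?X i) + (\<Sum>i\<le>Suc n. real (Suc n - i) * ?X i) =
      (\<Sum>i\<le>Suc n. real (Suc n) * ?X i)"
    unfolding sum.distrib[symmetric] by (intro sum.cong) (auto simp: algebra_simps of_nat_diff)
  also have "\<dots> = real (Suc n) * (\<Sum>i\<le>Suc n. ?X i)" by (rule sum_distrib_left[symmetric])
  finally show ?case by (simp del: of_nat_Suc)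
qed

text \<open>Up to the degree of a given monomial, the product of the two series is a sum over a
  square of exponents; the terms beyond the diagonal vanish for degree reasons, and the triangle is
  summed by the binomial theorem.\<close>

lemma gr_exp_add:
  assumes "gr_even g" "f {} = 0" "g {} = 0"
  shows "gr_exp (\<lambda>U. f U + g U) = gr_mult (gr_exp f) (gr_exp g)"
proof
  fix U
  let ?d = gr_divided_power
  show "gr_exp (\<lambda>U. f U + g U) U = gr_mult (gr_exp f) (gr_exp g) U"
  proof (cases "finite U")
    case True
    define N where "N = card U"
    let ?X = "\<lambda>i j. gr_mult (?d f i) (?d g j) U"
    have vanish: "?X i j = 0" if "N < i + j" for i j
    proof -
      have "?d f i S * ?d g j (U - S) = 0" if "S \<subseteq> U" for S
      proof -
        have "card U = card S + card (U - S)"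
          using True that by (simp add: card_Diff_subset card_mono finite_subset)
        then have "card S < i \<or> card (U - S) < j" using \<open>N < i + j\<close> by (auto simp: N_def)
        then show ?thesis using gr_divided_power_vanish assms by fastforce
      qed
      then show ?thesis unfolding gr_mult_def mult.assoc by (intro sum.neutral) auto
    qed
    have "gr_mult (gr_exp f) (gr_exp g) U =
        gr_mult (\<lambda>U. \<Sum>i\<le>N. ?d f i U) (\<lambda>U. \<Sum>j\<le>N. ?d g j U) U"
      unfolding gr_mult_def
      by (intro sum.cong arg_cong2[of _ _ _ _ "(*)"] refl gr_exp_eq_sum assms)
        (use True in \<open>auto simp: N_def card_mono\<close>)
    also have "\<dots> = (\<Sum>i\<le>N. \<Sum>j\<le>N. ?X i j)"
      unfolding gr_mult_sum by simp
    also have "\<dots> = (\<Sum>(i, j)\<in>{..N} \<times> {..N}. ?X i j)" by (rule sum.cartesian_product)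
    also have "\<dots> = (\<Sum>(i, j)\<in>{(i, j). i + j \<le> N}. ?X i j)"
    proof (intro sum.mono_neutral_right ballI, goal_cases)
      case (3 p)
      then show ?case using vanish[of "fst p" "snd p"] by (auto simp: not_le)
    qed auto
    also have "\<dots> = (\<Sum>k\<le>N. \<Sum>i\<le>k. ?X i (k - i))" by (rule sum.triangle_reindex_eq)
    also have "\<dots> = (\<Sum>k\<le>N. ?d (\<lambda>U. f U + g U) k U)"
      by (simp add: gr_divided_power_add[OF assms(1)])
    also have "\<dots> = gr_exp (\<lambda>U. f U + g U) U"
      by (rule gr_exp_eq_sum[symmetric]) (use assms in \<open>simp_all add: N_def\<close>)
    finally show ?thesis by simp
  next
    case False
    then show ?thesis by (simp add: gr_mult_infinite gr_exp_infinite assms)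
  qed
qed

lemma gr_mult_nonzeroE:
  assumes "gr_mult f g U \<noteq> 0"
  obtains S where "finite U" "S \<subseteq> U" "f S \<noteq> 0" "g (U - S) \<noteq> 0"
proof -
  have "finite U" using assms gr_mult_infinite by metis
  moreover obtain S where "S \<in> Pow U" "(-1) ^ inversions S (U - S) * f S * g (U - S) \<noteq> 0"
    using assms unfolding gr_mult_def by (meson sum.not_neutral_contains_not_neutral)
  ultimately show ?thesis using that[of S] by auto
qed

text \<open>The monomials of an exponential are disjoint unions of monomials of the exponent.
  Parity and the set of occurring generators are obtained from this.\<close>

lemma gr_exp_closed:
  assumes one: "P {}" and Un: "\<And>S T. P S \<Longrightarrow> P T \<Longrightarrow> S \<inter> T = {} \<Longrightarrow> finite S \<Longrightarrow> finite T \<Longrightarrow> P (S \<union> T)"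
    and f: "\<And>S. f S \<noteq> 0 \<Longrightarrow> P S" and nz: "gr_exp f U \<noteq> 0" and f0: "f {} = 0"
  shows "P U"
proof -
  have pow: "P U" if "(gr_mult f ^^ n) gr_one U \<noteq> 0" for n U
    using that
  proof (induction n arbitrary: U)
    case 0
    then show ?case using one by (auto simp: gr_one_def split: if_splits)
  next
    case (Suc n)
    then have "gr_mult f ((gr_mult f ^^ n) gr_one) U \<noteq> 0" by simp
    then obtain S where S: "finite U" "S \<subseteq> U" "f S \<noteq> 0" "(gr_mult f ^^ n) gr_one (U - S) \<noteq> 0"
      by (rule gr_mult_nonzeroE)
    then have "P (S \<union> (U - S))"
      using f Suc.IH by (intro Un) (auto intro: finite_subset)
    then show ?case using S by (simp add: Un_absorb1)
  qed
  obtain n where "gr_divided_power f n U \<noteq> 0"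
    using nz f0 gr_exp_eq_sum[of f U "card U"] by (metis order_refl sum.neutral)
  then show ?thesis using pow[of n U] by (auto simp: gr_divided_power_def)
qed

lemma gr_even_exp:
  assumes "gr_even f" "f {} = 0"
  shows "gr_even (gr_exp f)"
  unfolding gr_even_def
proof (intro allI impI)
  fix U assume "gr_exp f U \<noteq> 0"
  then show "finite U \<and> even (card U)"
    by (rule gr_exp_closed[where f = f and P = "\<lambda>U. finite U \<and> even (card U)", rotated 3])
      (use assms in \<open>auto simp: gr_even_def card_Un_disjoint\<close>)
qed

definition gr_over :: "'g set \<Rightarrow> 'g grassmann \<Rightarrow> bool" where
  "gr_over G f \<longleftrightarrow> (\<forall>U. f U \<noteq> 0 \<longrightarrow> U \<subseteq> G)"

lemma gr_over_exp:
  assumes "gr_over G f" "f {} = 0"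
  shows "gr_over G (gr_exp f)"
  unfolding gr_over_def
proof (intro allI impI)
  fix U assume "gr_exp f U \<noteq> 0"
  then show "U \<subseteq> G"
    by (rule gr_exp_closed[where f = f and P = "\<lambda>U. U \<subseteq> G", rotated 3])
      (use assms in \<open>auto simp: gr_over_def\<close>)
qed

lemma bilinear_form_nonzero:
  assumes "bilinear_form A E U \<noteq> 0"
  obtains i j where "i \<in> E" "j \<in> E" "U = {Gen i, GenStar j}"
proof -
  obtain i where i: "i \<in> E" "(\<Sum>j\<in>E. A i j * gr_mult (gr_gen (Gen i)) (gr_gen (GenStar j)) U) \<noteq> 0"
    using assms unfolding bilinear_form_def by (meson sum.not_neutral_contains_not_neutral)
  then obtain j where j: "j \<in> E" "A i j * gr_mult (gr_gen (Gen i)) (gr_gen (GenStar j)) U \<noteq> 0"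
    by (meson sum.not_neutral_contains_not_neutral)
  then have "gr_mult (gr_gen (Gen i)) (gr_gen (GenStar j)) U \<noteq> 0" by simp
  then obtain S where "S \<subseteq> U" "gr_gen (Gen i) S \<noteq> 0" "gr_gen (GenStar j) (U - S) \<noteq> 0"
    by (rule gr_mult_nonzeroE)
  then have "U = {Gen i, GenStar j}" by (auto simp: gr_gen_def split: if_splits)
  then show ?thesis using that i j by blast
qed

lemma gr_even_bilinear_form: "gr_even (bilinear_form A E)"
  unfolding gr_even_def by (auto elim!: bilinear_form_nonzero)

lemma bilinear_form_empty: "bilinear_form A E {} = 0"
  by (rule ccontr) (auto elim!: bilinear_form_nonzero)

lemma gr_over_bilinear_form: "gr_over (Gen ` E \<union> GenStar ` E) (bilinear_form A E)"
  unfolding gr_over_def by (auto elim!: bilinear_form_nonzero)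

lemma bilinear_form_add:
  fixes E1 E2 :: "'c set"
  assumes fin: "finite E1" "finite E2"
    and A: "\<And>i j. i \<in> E1 \<union> E2 \<Longrightarrow> j \<in> E1 \<union> E2 \<Longrightarrow>
      A i j = (if i \<in> E1 \<and> j \<in> E1 then A1 i j else 0) + (if i \<in> E2 \<and> j \<in> E2 then A2 i j else 0)"
  shows "bilinear_form A (E1 \<union> E2) = (\<lambda>U. bilinear_form A1 E1 U + bilinear_form A2 E2 U)"
proof
  fix U :: "'c generator set"
  let ?g = "\<lambda>i j. gr_mult (gr_gen (Gen i)) (gr_gen (GenStar j)) U"
  let ?E = "E1 \<union> E2"
  have extend: "(\<Sum>i\<in>?E. \<Sum>j\<in>?E. (if i \<in> E \<and> j \<in> E then C i j else 0) * ?g i j) =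
      bilinear_form C E U" if "E \<subseteq> ?E" for E C
  proof -
    have "(\<Sum>j\<in>?E. (if i \<in> E \<and> j \<in> E then C i j else 0) * ?g i j) = (\<Sum>j\<in>E. C i j * ?g i j)"
      if "i \<in> E" for i
      by (intro sum.mono_neutral_cong_right) (use fin that \<open>E \<subseteq> ?E\<close> in auto)
    then show ?thesis unfolding bilinear_form_def
      by (intro sum.mono_neutral_cong_right) (use fin that in auto)
  qed
  have "bilinear_form A ?E U = (\<Sum>i\<in>?E. \<Sum>j\<in>?E. (if i \<in> E1 \<and> j \<in> E1 then A1 i j else 0) * ?g i j) +
      (\<Sum>i\<in>?E. \<Sum>j\<in>?E. (if i \<in> E2 \<and> j \<in> E2 then A2 i j else 0) * ?g i j)"
    unfolding bilinear_form_def sum.distrib[symmetric] distrib_right[symmetric]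
    by (intro sum.cong refl) (simp add: A)
  then show "bilinear_form A ?E U = bilinear_form A1 E1 U + bilinear_form A2 E2 U"
    by (simp add: extend)
qed

text \<open>Anticommutation of integrals can fail at infinite monomials, where the cardinality in
  the sign of \<open>berezin\<close> degenerates to zero.\<close>

definition gr_finitary :: "'g grassmann \<Rightarrow> bool" where
  "gr_finitary f \<longleftrightarrow> (\<forall>U. infinite U \<longrightarrow> f U = 0)"

lemma gr_finitary_mult: "gr_finitary (gr_mult f g)"
  by (simp add: gr_finitary_def gr_mult_infinite)

lemma gr_finitary_berezin: "gr_finitary f \<Longrightarrow> gr_finitary (berezin a f)"
  by (simp add: gr_finitary_def berezin_def)

lemma berezin_anticommute:
  assumes "gr_finitary f" "a \<noteq> b"
  shows "berezin a (berezin b f) = (\<lambda>S. - berezin b (berezin a f) S)"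
proof
  fix S
  let ?c = "\<lambda>a S. card {s \<in> S. (a, s) \<in> generator_order}"
  show "berezin a (berezin b f) S = - berezin b (berezin a f) S"
  proof (cases "finite S \<and> a \<notin> S \<and> b \<notin> S")
    case True
    have "{s \<in> insert b S. (a, s) \<in> generator_order} =
        (if (a, b) \<in> generator_order then {b} else {}) \<union> {s \<in> S. (a, s) \<in> generator_order}"
      for a b by auto
    then have c: "?c a (insert b S) = (if (a, b) \<in> generator_order then 1 else 0) + ?c a S"
      if "b \<notin> S" for a b using that True by auto
    have "insert a (insert b S) = insert b (insert a S)" by auto
    then show ?thesis
      using True assms(2) generator_order_swap[OF assms(2)] by (simp add: berezin_def c[unfolded insert_iff])
  next
    case False
    then show ?thesis
      using assms by (auto simp: berezin_def gr_finitary_def)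
  qed
qed

lemma berezin_uminus: "berezin a (\<lambda>S. - f S) = (\<lambda>S. - berezin a f S)"
  by (auto simp: berezin_def)

definition berezin_pair :: "'c \<Rightarrow> 'c generator grassmann \<Rightarrow> 'c generator grassmann" where
  "berezin_pair i F = berezin (Gen i) (berezin (GenStar i) F)"

lemma berezin_pair_commute:
  assumes "gr_finitary F"
  shows "berezin_pair i (berezin_pair j F) = berezin_pair j (berezin_pair i F)"
proof (cases "i = j")
  case False
  have pull: "berezin c (berezin_pair j F) = berezin_pair j (berezin c F)"
    if "c \<noteq> Gen j" "c \<noteq> GenStar j" "gr_finitary F" for c F
  proof -
    have "berezin c (berezin_pair j F) = (\<lambda>S. - berezin (Gen j) (berezin c (berezin (GenStar j) F)) S)"
      unfolding berezin_pair_def using that by (intro berezin_anticommute gr_finitary_berezin)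
    also have "berezin c (berezin (GenStar j) F) = (\<lambda>S. - berezin (GenStar j) (berezin c F) S)"
      using that by (intro berezin_anticommute)
    finally show ?thesis by (simp add: berezin_uminus berezin_pair_def)
  qed
  show ?thesis
    unfolding berezin_pair_def[of i] using False assms by (simp add: pull gr_finitary_berezin)
qed simp

lemma gr_finitary_berezin_pair: "gr_finitary F \<Longrightarrow> gr_finitary (berezin_pair i F)"
  by (simp add: berezin_pair_def gr_finitary_berezin)

lemma berezin_pairs_fold: "berezin_pairs E F = fold berezin_pair (enum_set E) F"
  by (simp add: berezin_pairs_def berezin_pair_def[abs_def])

text \<open>Pairs of integrals commute, so the order of the edges is immaterial.\<close>

lemma berezin_pairs_eq_fold:
  assumes "gr_finitary F" "distinct xs"
  shows "berezin_pairs (set xs) F = fold berezin_pair xs F"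
proof -
  \<comment> \<open>after truncation to finite monomials, the pairs commute as functions on all elements\<close>
  define P where "P i F = berezin_pair i (\<lambda>U. if finite U then F U else 0)" for i :: 'a and F
  have fin: "gr_finitary (P i F)" for i F
    unfolding P_def by (intro gr_finitary_berezin_pair) (simp add: gr_finitary_def)
  have P: "P i F = berezin_pair i F" if "gr_finitary F" for i F
    using that by (simp add: P_def gr_finitary_def if_distrib cong: if_cong) (metis (full_types))
  have fold_P: "fold berezin_pair ys F = fold P ys F" if "gr_finitary F" for ys F
    using that
  proof (induction ys arbitrary: F)
    case (Cons y ys)
    then show ?case using gr_finitary_berezin_pair[of F y] by (simp add: P)
  qed simp
  have "P i \<circ> P j = P j \<circ> P i" for i j
  proof
    fix F :: "'a generator grassmann"
    let ?F = "\<lambda>U. if finite U then F U else 0"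
    have "gr_finitary ?F" by (simp add: gr_finitary_def)
    then have "berezin_pair i (berezin_pair j ?F) = berezin_pair j (berezin_pair i ?F)"
      by (rule berezin_pair_commute)
    moreover have "P i (P j F) = berezin_pair i (P j F)" "P j (P i F) = berezin_pair j (P i F)"
      by (rule P[OF fin])+
    ultimately show "(P i \<circ> P j) F = (P j \<circ> P i) F" by (simp add: P_def[of _ F])
  qed
  moreover have "mset (enum_set (set xs)) = mset xs"
    using assms by (metis enum_set(1,2) finite_set set_eq_iff_mset_eq_distinct)
  ultimately have "fold P (enum_set (set xs)) = fold P xs"
    by (intro fold_multiset_equiv)
  then show ?thesis by (simp add: berezin_pairs_fold fold_P[OF assms(1)])
qed

lemma berezin_pairs_Un:
  assumes "gr_finitary F" "finite E" "finite E'" "E \<inter> E' = {}"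
  shows "berezin_pairs (E \<union> E') F = berezin_pairs E' (berezin_pairs E F)"
  using berezin_pairs_eq_fold[OF assms(1), of "enum_set E @ enum_set E'"] assms
  by (simp add: enum_set berezin_pairs_fold)

lemma berezin_pairs_mult:
  assumes "gr_over G f" "finite E" "\<And>i. i \<in> E \<Longrightarrow> Gen i \<notin> G \<and> GenStar i \<notin> G"
  shows "berezin_pairs E (gr_mult f h) = gr_mult f (berezin_pairs E h)"
proof -
  have "berezin a (gr_mult f h) = gr_mult f (berezin a h)" if "a \<notin> G" for a h
    using assms(1) that by (intro berezin_mult) (auto simp: gr_over_def)
  then have "berezin_pair i (gr_mult f h) = gr_mult f (berezin_pair i h)" if "i \<in> E" for i h
    using assms(3)[OF that] by (simp add: berezin_pair_def)
  then have "fold berezin_pair xs (gr_mult f h) = gr_mult f (fold berezin_pair xs h)" if "set xs \<subseteq> E" for xs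
    using that by (induction xs arbitrary: h) auto
  then show ?thesis using assms(2) by (simp add: berezin_pairs_fold enum_set)
qed

lemma gr_over_berezin_pairs:
  assumes "gr_over G f"
  shows "gr_over G (berezin_pairs E f)"
proof -
  have "gr_over G (berezin a f)" if "gr_over G f" for a f
    using that by (auto simp: gr_over_def berezin_def split: if_splits)
  then have "gr_over G (berezin_pair i f)" if "gr_over G f" for i f
    using that by (simp add: berezin_pair_def)
  then have "gr_over G (fold berezin_pair xs f)" for xs
    using assms by (induction xs arbitrary: f) auto
  then show ?thesis by (simp add: berezin_pairs_fold)
qed

lemma berezin_scale: "berezin a (\<lambda>S. c * f S) = (\<lambda>S. c * berezin a f S)"
  by (auto simp: berezin_def)

lemma berezin_pairs_scale:
  "berezin_pairs E (\<lambda>S. c * f S) = (\<lambda>S. c * berezin_pairs E f S)"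
proof -
  have pair: "berezin_pair i (\<lambda>S. c * f S) = (\<lambda>S. c * berezin_pair i f S)" for i f
    by (simp add: berezin_pair_def berezin_scale)
  have "fold berezin_pair xs (\<lambda>S. c * f S) = (\<lambda>S. c * fold berezin_pair xs f S)" for xs
    by (induction xs arbitrary: f) (simp_all add: pair)
  then show ?thesis by (simp add: berezin_pairs_fold)
qed

text \<open>The generators over \<open>I1\<close> occur only in the first exponential and those over
  \<open>I2\<close> only in the second one. Factors are pulled out of an integral to the left, so the even first
  exponential is moved to the right before it is integrated.\<close>

lemma berezin_pairs_exp_glue:
  assumes fin: "finite E1" "finite E2"
    and sub: "I1 \<subseteq> E1 - E2" "I2 \<subseteq> E2 - E1" "G \<subseteq> E1 \<inter> E2"
    and A: "\<And>i j. i \<in> E1 \<union> E2 \<Longrightarrow> j \<in> E1 \<union> E2 \<Longrightarrow>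
      A i j = (if i \<in> E1 \<and> j \<in> E1 then A1 i j else 0) + (if i \<in> E2 \<and> j \<in> E2 then A2 i j else 0)"
  shows "berezin_pairs (I1 \<union> I2 \<union> G) (gr_exp (bilinear_form A (E1 \<union> E2))) =
    berezin_pairs G (gr_mult (berezin_pairs I1 (gr_exp (bilinear_form A1 E1)))
                             (berezin_pairs I2 (gr_exp (bilinear_form A2 E2))))"
proof -
  let ?F1 = "gr_exp (bilinear_form A1 E1)" and ?F2 = "gr_exp (bilinear_form A2 E2)"
  have finI: "finite I1" "finite I2" "finite G" using fin sub by (auto intro: finite_subset)
  have even: "gr_even ?F1" "gr_even ?F2"
    by (simp_all add: gr_even_exp gr_even_bilinear_form bilinear_form_empty)
  have over: "gr_over (Gen ` E1 \<union> GenStar ` E1) ?F1" "gr_over (Gen ` E2 \<union> GenStar ` E2) ?F2"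
    by (simp_all add: gr_over_exp gr_over_bilinear_form bilinear_form_empty)
  have "gr_exp (bilinear_form A (E1 \<union> E2)) = gr_mult ?F2 ?F1"
  proof -
    have "bilinear_form A (E1 \<union> E2) = (\<lambda>U. bilinear_form A1 E1 U + bilinear_form A2 E2 U)"
      using A by (intro bilinear_form_add fin)
    then have "gr_exp (bilinear_form A (E1 \<union> E2)) = gr_mult ?F1 ?F2"
      by (simp add: gr_exp_add gr_even_bilinear_form bilinear_form_empty)
    then show ?thesis using gr_mult_commute[OF even(1)] by simp
  qed
  then have "berezin_pairs (I1 \<union> I2 \<union> G) (gr_exp (bilinear_form A (E1 \<union> E2))) =
      berezin_pairs G (berezin_pairs I2 (berezin_pairs I1 (gr_mult ?F2 ?F1)))"
  proof -
    have "I1 \<inter> I2 = {}" "(I1 \<union> I2) \<inter> G = {}" using sub by auto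
    then show ?thesis
      using \<open>gr_exp (bilinear_form A (E1 \<union> E2)) = gr_mult ?F2 ?F1\<close> finI
      by (simp add: berezin_pairs_Un gr_finitary_mult)
  qed
  also have "berezin_pairs I1 (gr_mult ?F2 ?F1) = gr_mult ?F2 (berezin_pairs I1 ?F1)"
    by (rule berezin_pairs_mult[OF over(2) finI(1)]) (use sub in auto)
  also have "\<dots> = gr_mult (berezin_pairs I1 ?F1) ?F2" by (rule gr_mult_commute[OF even(2)])
  also have "berezin_pairs I2 \<dots> = gr_mult (berezin_pairs I1 ?F1) (berezin_pairs I2 ?F2)"
  proof (rule berezin_pairs_mult[OF _ finI(2)])
    show "gr_over (Gen ` E1 \<union> GenStar ` E1) (berezin_pairs I1 ?F1)"
      by (rule gr_over_berezin_pairs[OF over(1)])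
  qed (use sub in auto)
  finally show ?thesis .
qed

section \<open>Boundary components and gluing of triangulations\<close>

context
  fixes K :: "'c triangulation"
  assumes poset: "simplicial_poset3 K"
begin

lemma finite_cells: "finite (cells K)"
  using poset unfolding simplicial_poset3_def by blast

lemma partial_order_face: "Partial_order (face K)"
  using poset unfolding simplicial_poset3_def by blast

lemma bij_betw_verts:
  "\<sigma> \<in> cells K \<Longrightarrow> bij_betw (verts K) {\<tau>. (\<tau>, \<sigma>) \<in> face K} (Pow (verts K \<sigma>) - {{}})"
  using poset unfolding simplicial_poset3_def by blast

lemma face_cells: "(\<sigma>, \<tau>) \<in> face K \<Longrightarrow> \<sigma> \<in> cells K \<and> \<tau> \<in> cells K"
  by (auto simp: cells_def intro: FieldI1 FieldI2)

lemma face_refl: "\<sigma> \<in> cells K \<Longrightarrow> (\<sigma>, \<sigma>) \<in> face K"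
  using partial_order_face by (simp add: partial_order_on_def preorder_on_def refl_on_def cells_def)

lemma face_trans: "(\<rho>, \<sigma>) \<in> face K \<Longrightarrow> (\<sigma>, \<tau>) \<in> face K \<Longrightarrow> (\<rho>, \<tau>) \<in> face K"
  using partial_order_face transD[of "face K"] unfolding partial_order_on_def preorder_on_def by blast

lemma verts_subset: "verts K \<sigma> \<subseteq> vertices K" "vertices K \<subseteq> cells K"
  by (auto simp: verts_def vertices_def)

lemma finite_verts: "finite (verts K \<sigma>)"
  using finite_subset[OF _ finite_cells] verts_subset by blast

lemma verts_mono: "(\<sigma>, \<tau>) \<in> face K \<Longrightarrow> verts K \<sigma> \<subseteq> verts K \<tau>"
  by (auto simp: verts_def intro: face_trans)

lemma face_with_verts_unique:
  assumes "(\<rho>, \<sigma>) \<in> face K" "(\<tau>, \<sigma>) \<in> face K" "verts K \<rho> = verts K \<tau>"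
  shows "\<rho> = \<tau>"
  using bij_betw_verts[of \<sigma>] face_cells[OF assms(1)] assms by (auto simp: bij_betw_def inj_on_def)

lemma face_with_verts_exists:
  assumes "\<sigma> \<in> cells K" "S \<subseteq> verts K \<sigma>" "S \<noteq> {}"
  obtains \<tau> where "(\<tau>, \<sigma>) \<in> face K" "verts K \<tau> = S"
proof -
  have "verts K ` {\<tau>. (\<tau>, \<sigma>) \<in> face K} = Pow (verts K \<sigma>) - {{}}"
    using bij_betw_verts[OF assms(1)] by (rule bij_betw_imp_surj_on)
  then have "S \<in> verts K ` {\<tau>. (\<tau>, \<sigma>) \<in> face K}" using assms by blast
  then show ?thesis using that by blast
qed

lemma cell_in_tetrahedron:
  assumes "\<sigma> \<in> cells K"
  obtains t where "t \<in> tetrahedra K" "(\<sigma>, t) \<in> face K"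
  using poset assms unfolding simplicial_poset3_def by blast

lemma triangle_face_of_triangle:
  assumes "(\<phi>, \<psi>) \<in> face K" "\<phi> \<in> triangles K" "\<psi> \<in> triangles K"
  shows "\<phi> = \<psi>"
proof -
  have "verts K \<phi> = verts K \<psi>"
    using verts_mono[OF assms(1)] finite_verts assms(2,3)
    by (intro card_subset_eq) (auto simp: triangles_def)
  then show ?thesis
    using assms face_refl face_with_verts_unique[of \<phi> \<psi> \<psi>] by (auto simp: triangles_def)
qed

lemma edge_verts:
  assumes "e \<in> edges K"
  obtains p q where "p \<noteq> q" "verts K e = {p, q}" "ends (verts K e) = (p, q)"
    "p \<in> vertices K" "q \<in> vertices K" "(p, e) \<in> face K" "(q, e) \<in> face K"
proof -
  define xs where "xs = enum_set (verts K e)"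
  have xs: "distinct xs" "set xs = verts K e" "length xs = 2"
    using assms enum_set[OF finite_verts[of e]] by (auto simp: xs_def edges_def)
  then obtain p q where "xs = [p, q]" by (auto simp: length_Suc_conv numeral_2_eq_2)
  then have "p \<noteq> q" "verts K e = {p, q}" "ends (verts K e) = (p, q)"
    using xs by (auto simp: ends_def simp flip: xs_def)
  then show ?thesis using that[of p q] by (auto simp: verts_def set_eq_iff)
qed

lemma boundary_cells_subset: "boundary_cells K \<subseteq> cells K"
  by (auto simp: boundary_cells_def dest: face_cells)

lemma boundary_cells_face: "(\<sigma>, \<tau>) \<in> face K \<Longrightarrow> \<tau> \<in> boundary_cells K \<Longrightarrow> \<sigma> \<in> boundary_cells K"
  by (auto simp: boundary_cells_def intro: face_trans)

lemma boundary_triangle: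
  assumes "\<phi> \<in> triangles K"
  shows "\<phi> \<in> boundary_cells K \<longleftrightarrow> card {t \<in> tetrahedra K. (\<phi>, t) \<in> face K} = 1"
  using assms triangle_face_of_triangle face_refl
  by (auto simp: boundary_cells_def triangles_def)

lemma tetrahedron_not_boundary: "t \<in> tetrahedra K \<Longrightarrow> t \<notin> boundary_cells K"
proof
  assume "t \<in> tetrahedra K" "t \<in> boundary_cells K"
  then obtain \<phi> where "(t, \<phi>) \<in> face K" "card (verts K \<phi>) = 3" "card (verts K t) = 4"
    by (auto simp: boundary_cells_def triangles_def tetrahedra_def)
  then show False using verts_mono[of t \<phi>] card_mono[OF finite_verts, of "verts K t" \<phi>] by simp
qed

end

definition boundary_adjacency :: "'c triangulation \<Rightarrow> ('c \<times> 'c) set" where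
  "boundary_adjacency K = {(\<sigma>, \<tau>). \<sigma> \<in> boundary_cells K \<and> \<tau> \<in> boundary_cells K \<and>
     ((\<sigma>, \<tau>) \<in> face K \<or> (\<tau>, \<sigma>) \<in> face K)}"

lemma boundary_components_eq:
  "boundary_components K = (\<lambda>\<sigma>. (boundary_adjacency K)\<^sup>* `` {\<sigma>}) ` boundary_cells K"
  by (auto simp: boundary_components_def boundary_adjacency_def quotient_def)

lemma equiv_boundary_adjacency: "equiv UNIV ((boundary_adjacency K)\<^sup>*)"
proof (rule equivI)
  show "sym ((boundary_adjacency K)\<^sup>*)"
    by (intro sym_rtrancl symI) (auto simp: boundary_adjacency_def)
qed (auto intro: refl_rtrancl trans_rtrancl)

lemma boundary_component_closed:
  assumes "k \<in> boundary_components K" "\<sigma> \<in> k" "(\<sigma>, \<tau>) \<in> boundary_adjacency K"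
  shows "\<tau> \<in> k"
  using assms by (auto simp: boundary_components_eq intro: rtrancl.rtrancl_into_rtrancl)

lemma boundary_component_subset:
  assumes "k \<in> boundary_components K"
  shows "k \<subseteq> boundary_cells K"
proof
  fix \<tau> assume "\<tau> \<in> k"
  then obtain \<sigma> where "\<sigma> \<in> boundary_cells K" "(\<sigma>, \<tau>) \<in> (boundary_adjacency K)\<^sup>*"
    using assms by (auto simp: boundary_components_eq)
  from this(2,1) show "\<tau> \<in> boundary_cells K"
    by (induction rule: rtrancl_induct) (auto simp: boundary_adjacency_def)
qed

lemma boundary_components_cover: "\<sigma> \<in> boundary_cells K \<Longrightarrow> \<exists>k\<in>boundary_components K. \<sigma> \<in> k"
  by (auto simp: boundary_components_eq)

lemma boundary_component_class:
  assumes "k \<in> boundary_components K" "\<sigma> \<in> k"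
  shows "k = (boundary_adjacency K)\<^sup>* `` {\<sigma>}"
proof -
  obtain \<rho> where \<rho>: "k = (boundary_adjacency K)\<^sup>* `` {\<rho>}"
    using assms by (auto simp: boundary_components_eq)
  then have "(\<rho>, \<sigma>) \<in> (boundary_adjacency K)\<^sup>*" using assms by blast
  from equiv_class_eq[OF equiv_boundary_adjacency this] show ?thesis using \<rho> by simp
qed

lemma boundary_components_disjoint:
  assumes "k \<in> boundary_components K" "k' \<in> boundary_components K" "\<sigma> \<in> k" "\<sigma> \<in> k'"
  shows "k = k'"
  using assms boundary_component_class by metis

lemma boundary_component_face:
  assumes "simplicial_poset3 K" "k \<in> boundary_components K" "\<sigma> \<in> k" "(\<tau>, \<sigma>) \<in> face K"
  shows "\<tau> \<in> k"
proof (rule boundary_component_closed[OF assms(2,3)])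
  show "(\<sigma>, \<tau>) \<in> boundary_adjacency K"
    using assms boundary_component_subset[OF assms(2)] boundary_cells_face[OF assms(1,4)]
    by (auto simp: boundary_adjacency_def)
qed

lemma boundary_component_triangle:
  assumes "simplicial_poset3 K" "k \<in> boundary_components K"
  obtains \<phi> where "\<phi> \<in> triangles K" "\<phi> \<in> k"
proof -
  obtain \<sigma> where \<sigma>: "\<sigma> \<in> k" "\<sigma> \<in> boundary_cells K" using assms by (auto simp: boundary_components_eq)
  then obtain \<phi> where \<phi>: "\<phi> \<in> triangles K" "(\<sigma>, \<phi>) \<in> face K" "card {t \<in> tetrahedra K. (\<phi>, t) \<in> face K} = 1"
    by (auto simp: boundary_cells_def)
  then have "\<phi> \<in> boundary_cells K" using boundary_triangle[OF assms(1)] by blast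
  then have "\<phi> \<in> k"
    using boundary_component_closed[OF assms(2) \<sigma>(1), of \<phi>] \<sigma>(2) \<phi> by (auto simp: boundary_adjacency_def)
  then show ?thesis using that \<phi> by blast
qed

lemma finite_boundary_components:
  assumes "simplicial_poset3 K" shows "finite (boundary_components K)"
  using finite_subset[OF boundary_cells_subset[OF assms] finite_cells[OF assms]]
  by (simp add: boundary_components_eq)

text \<open>The gluing data enter symmetrically, in contrast to \<open>glue\<close>, which prefers the
  orientation of the first triangulation. Thus every statement about \<open>M1\<close> holds for \<open>M2\<close> as well, by
  \<open>swap\<close>.\<close>

locale gluing =
  fixes M M1 M2 :: "'c triangulation" and \<Gamma> :: "'c set"
  assumes poset1: "simplicial_poset3 M1" and poset2: "simplicial_poset3 M2"
    and \<Gamma>1: "\<Gamma> \<in> boundary_components M1" and \<Gamma>2: "\<Gamma> \<in> boundary_components M2"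
    and inter: "cells M1 \<inter> cells M2 = \<Gamma>"
    and agree: "face M1 \<inter> (\<Gamma> \<times> \<Gamma>) = face M2 \<inter> (\<Gamma> \<times> \<Gamma>)"
    and face_M: "face M = face M1 \<union> face M2"
    and orient1: "t \<in> tetrahedra M1 \<Longrightarrow> orient M t = orient M1 t"
    and orient2: "t \<in> tetrahedra M2 \<Longrightarrow> orient M t = orient M2 t"
begin

lemma swap: "gluing M M2 M1 \<Gamma>"
  using poset1 poset2 \<Gamma>1 \<Gamma>2 inter agree face_M orient1 orient2 by unfold_locales auto

lemma face_down1: "\<sigma> \<in> \<Gamma> \<Longrightarrow> (\<tau>, \<sigma>) \<in> face M1 \<Longrightarrow> \<tau> \<in> \<Gamma>"
  using boundary_component_face[OF poset1 \<Gamma>1] by blast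

lemma face_down2: "\<sigma> \<in> \<Gamma> \<Longrightarrow> (\<tau>, \<sigma>) \<in> face M2 \<Longrightarrow> \<tau> \<in> \<Gamma>"
  using boundary_component_face[OF poset2 \<Gamma>2] by blast

lemma cells_M: "cells M = cells M1 \<union> cells M2"
  by (simp add: cells_def face_M Field_Un)

lemma \<Gamma>_cells1: "\<sigma> \<in> \<Gamma> \<Longrightarrow> \<sigma> \<in> cells M1"
  using inter by auto

text \<open>A face in \<open>M2\<close> of a cell of \<open>M1\<close> belongs to \<open>\<Gamma>\<close>, where the face relations
  agree.\<close>

lemma face_M1: "\<sigma> \<in> cells M1 \<Longrightarrow> (\<tau>, \<sigma>) \<in> face M \<longleftrightarrow> (\<tau>, \<sigma>) \<in> face M1"
proof
  assume "\<sigma> \<in> cells M1" "(\<tau>, \<sigma>) \<in> face M"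
  then consider "(\<tau>, \<sigma>) \<in> face M1" | "(\<tau>, \<sigma>) \<in> face M2" by (auto simp: face_M)
  then show "(\<tau>, \<sigma>) \<in> face M1"
  proof cases
    case 2
    then have "\<sigma> \<in> \<Gamma>" using face_cells[OF poset2] \<open>\<sigma> \<in> cells M1\<close> inter by blast
    then show ?thesis using 2 face_down2 agree by blast
  qed
qed (simp add: face_M)

lemma coface_M1: "\<sigma> \<in> cells M1 - \<Gamma> \<Longrightarrow> (\<sigma>, \<tau>) \<in> face M \<longleftrightarrow> (\<sigma>, \<tau>) \<in> face M1"
  using face_cells[OF poset2] inter by (auto simp: face_M)

lemma vertices_M1: "v \<in> cells M1 \<Longrightarrow> v \<in> vertices M \<longleftrightarrow> v \<in> vertices M1"
  by (auto simp: vertices_def cells_M face_M1)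

lemma verts_M1: "\<sigma> \<in> cells M1 \<Longrightarrow> verts M \<sigma> = verts M1 \<sigma>"
  using face_cells[OF poset1] by (auto simp: verts_def face_M1 vertices_M1 verts_subset(2)[OF poset1])

lemma edges_M1: "\<sigma> \<in> cells M1 \<Longrightarrow> \<sigma> \<in> edges M \<longleftrightarrow> \<sigma> \<in> edges M1"
  and triangles_M1: "\<sigma> \<in> cells M1 \<Longrightarrow> \<sigma> \<in> triangles M \<longleftrightarrow> \<sigma> \<in> triangles M1"
  and tetrahedra_M1: "\<sigma> \<in> cells M1 \<Longrightarrow> \<sigma> \<in> tetrahedra M \<longleftrightarrow> \<sigma> \<in> tetrahedra M1"
  by (auto simp: edges_def triangles_def tetrahedra_def cells_M verts_M1)

lemma tetrahedra1_not_M2: "t \<in> tetrahedra M1 \<Longrightarrow> t \<in> cells M1 \<and> t \<notin> \<Gamma> \<and> t \<notin> cells M2"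
  using tetrahedron_not_boundary[OF poset1] boundary_component_subset[OF \<Gamma>1] inter
  by (auto simp: tetrahedra_def)

end

context gluing begin

lemmas face_M2 = gluing.face_M1[OF swap]
  and vertices_M2 = gluing.vertices_M1[OF swap] and verts_M2 = gluing.verts_M1[OF swap]
  and edges_M2 = gluing.edges_M1[OF swap] and triangles_M2 = gluing.triangles_M1[OF swap]
  and tetrahedra_M2 = gluing.tetrahedra_M1[OF swap]
  and tetrahedra2_not_M1 = gluing.tetrahedra1_not_M2[OF swap]
  and \<Gamma>_cells2 = gluing.\<Gamma>_cells1[OF swap]

lemma vertices_M: "vertices M = vertices M1 \<union> vertices M2"
  using vertices_M1 vertices_M2 cells_M by (auto simp: vertices_def)

lemma edges_M: "edges M = edges M1 \<union> edges M2"
  using edges_M1 edges_M2 cells_M by (auto simp: edges_def)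

lemma triangles_M: "triangles M = triangles M1 \<union> triangles M2"
  using triangles_M1 triangles_M2 cells_M by (auto simp: triangles_def)

lemma tetrahedra_M: "tetrahedra M = tetrahedra M1 \<union> tetrahedra M2" "tetrahedra M1 \<inter> tetrahedra M2 = {}"
proof -
  show "tetrahedra M = tetrahedra M1 \<union> tetrahedra M2"
    using tetrahedra_M1 tetrahedra_M2 cells_M by (auto simp: tetrahedra_def)
  show "tetrahedra M1 \<inter> tetrahedra M2 = {}" using tetrahedra1_not_M2 tetrahedra2_not_M1 by blast
qed

lemma tetrahedra_at:
  "{t \<in> tetrahedra M. (\<sigma>, t) \<in> face M} =
     {t \<in> tetrahedra M1. (\<sigma>, t) \<in> face M1} \<union> {t \<in> tetrahedra M2. (\<sigma>, t) \<in> face M2}"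
  unfolding tetrahedra_M(1) using face_M1 face_M2 tetrahedra1_not_M2 tetrahedra2_not_M1 by blast

lemma boundary_cells_\<Gamma>: "\<Gamma> \<subseteq> boundary_cells M1" "\<Gamma> \<subseteq> boundary_cells M2"
  using boundary_component_subset \<Gamma>1 \<Gamma>2 by auto

lemma boundary_triangle_M1:
  assumes "\<phi> \<in> triangles M1" "\<phi> \<notin> \<Gamma>"
  shows "card {t \<in> tetrahedra M. (\<phi>, t) \<in> face M} = card {t \<in> tetrahedra M1. (\<phi>, t) \<in> face M1}"
proof -
  have "\<phi> \<notin> cells M2" using assms inter by (auto simp: triangles_def)
  then have "{t \<in> tetrahedra M2. (\<phi>, t) \<in> face M2} = {}" using face_cells[OF poset2] by auto
  then show ?thesis by (simp only: tetrahedra_at Un_empty_right)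
qed

text \<open>Such a triangle has one tetrahedron on each side, so it is no longer a boundary
  triangle.\<close>

lemma inner_triangle_\<Gamma>:
  assumes "\<phi> \<in> triangles M" "\<phi> \<in> \<Gamma>"
  shows "card {t \<in> tetrahedra M. (\<phi>, t) \<in> face M} = 2"
proof -
  have tri: "\<phi> \<in> triangles M1" "\<phi> \<in> triangles M2"
    using assms triangles_M1 triangles_M2 \<Gamma>_cells1 \<Gamma>_cells2 by blast+
  have "card {t \<in> tetrahedra M1. (\<phi>, t) \<in> face M1} = 1" "card {t \<in> tetrahedra M2. (\<phi>, t) \<in> face M2} = 1"
    using boundary_triangle[OF poset1 tri(1)] boundary_triangle[OF poset2 tri(2)]
      boundary_cells_\<Gamma> assms by auto
  then show ?thesis unfolding tetrahedra_at
    using tetrahedra_M(2) by (subst card_Un_disjoint) (auto intro: card_ge_0_finite)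
qed

lemma boundary_cells_M1:
  assumes "\<sigma> \<in> cells M1"
  shows "\<sigma> \<in> boundary_cells M \<longleftrightarrow> \<sigma> \<in> boundary_cells M1 - \<Gamma>"
proof
  assume "\<sigma> \<in> boundary_cells M"
  then obtain \<phi> where \<phi>: "\<phi> \<in> triangles M" "(\<sigma>, \<phi>) \<in> face M" "card {t \<in> tetrahedra M. (\<phi>, t) \<in> face M} = 1"
    by (auto simp: boundary_cells_def)
  have "\<phi> \<notin> \<Gamma>" using inner_triangle_\<Gamma>[of \<phi>] \<phi> by auto
  have main: "\<sigma> \<in> boundary_cells N - \<Gamma>"
    if N: "simplicial_poset3 N" "\<Gamma> \<in> boundary_components N" "\<phi> \<in> triangles N" "(\<sigma>, \<phi>) \<in> face N"
      "card {t \<in> tetrahedra N. (\<phi>, t) \<in> face N} = 1" for N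
  proof -
    have \<sigma>: "\<sigma> \<in> boundary_cells N" using N by (auto simp: boundary_cells_def)
    moreover have "\<phi> \<in> boundary_cells N" using boundary_triangle[OF N(1,3)] N(5) by simp
    ultimately have "\<sigma> \<notin> \<Gamma>"
      using boundary_component_closed[OF N(2), of \<sigma> \<phi>] \<open>\<phi> \<notin> \<Gamma>\<close> N(4) by (auto simp: boundary_adjacency_def)
    then show ?thesis using \<sigma> by simp
  qed
  show "\<sigma> \<in> boundary_cells M1 - \<Gamma>"
  proof (cases "\<phi> \<in> cells M1")
    case True
    then have "\<phi> \<in> triangles M1" "(\<sigma>, \<phi>) \<in> face M1" using \<phi> triangles_M1 face_M1 by auto
    then show ?thesis using main[OF poset1 \<Gamma>1] \<phi>(3) boundary_triangle_M1 \<open>\<phi> \<notin> \<Gamma>\<close> by simp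
  next
    case False
    then have "\<phi> \<in> cells M2" using \<phi>(1) cells_M by (auto simp: triangles_def)
    then have "\<phi> \<in> triangles M2" "(\<sigma>, \<phi>) \<in> face M2" using \<phi> triangles_M2 face_M2 by auto
    then have "\<sigma> \<in> boundary_cells M2 - \<Gamma>"
      using main[OF poset2 \<Gamma>2] \<phi>(3) gluing.boundary_triangle_M1[OF swap] \<open>\<phi> \<notin> \<Gamma>\<close> by simp
    then have "\<sigma> \<in> cells M2 - \<Gamma>" using boundary_cells_subset[OF poset2] by auto
    then show ?thesis using assms inter by auto
  qed
next
  assume \<sigma>: "\<sigma> \<in> boundary_cells M1 - \<Gamma>"
  then obtain \<phi> where \<phi>: "\<phi> \<in> triangles M1" "(\<sigma>, \<phi>) \<in> face M1" "card {t \<in> tetrahedra M1. (\<phi>, t) \<in> face M1} = 1"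
    by (auto simp: boundary_cells_def)
  have "\<phi> \<notin> \<Gamma>" using face_down1 \<phi> \<sigma> by auto
  then show "\<sigma> \<in> boundary_cells M"
    using \<phi> boundary_triangle_M1[OF \<phi>(1)] by (auto simp: boundary_cells_def triangles_M face_M)
qed

lemmas boundary_cells_M2 = gluing.boundary_cells_M1[OF swap]

lemma boundary_cells_M: "boundary_cells M = (boundary_cells M1 \<union> boundary_cells M2) - \<Gamma>"
proof -
  have "boundary_cells M \<subseteq> cells M"
    by (auto simp: boundary_cells_def cells_def intro: FieldI1)
  then show ?thesis
    using boundary_cells_M1 boundary_cells_M2 boundary_cells_subset[OF poset1]
      boundary_cells_subset[OF poset2] cells_M by blast
qed

text \<open>A path of adjacent boundary cells that starts outside \<open>\<Gamma>\<close> cannot enter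
  \<open>\<Gamma>\<close>, a full component of the boundary of \<open>M1\<close>, and can only reach \<open>M2\<close> through
  \<open>\<Gamma>\<close>.\<close>

lemma boundary_class_M1:
  assumes "\<sigma> \<in> boundary_cells M1 - \<Gamma>"
  shows "(boundary_adjacency M)\<^sup>* `` {\<sigma>} = (boundary_adjacency M1)\<^sup>* `` {\<sigma>}"
proof -
  have "(\<sigma>, \<tau>) \<in> (boundary_adjacency M)\<^sup>* \<and> \<tau> \<in> boundary_cells M1 - \<Gamma>"
    if "(\<sigma>, \<tau>) \<in> (boundary_adjacency M1)\<^sup>*" for \<tau>
    using that
  proof (induction rule: rtrancl_induct)
    case (step \<tau> \<rho>)
    then have \<rho>: "\<rho> \<in> boundary_cells M1" by (auto simp: boundary_adjacency_def)
    have "(\<rho>, \<tau>) \<in> boundary_adjacency M1" using step by (auto simp: boundary_adjacency_def)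
    then have "\<rho> \<notin> \<Gamma>" using boundary_component_closed[OF \<Gamma>1, of \<rho> \<tau>] step.IH by blast
    then have "(\<tau>, \<rho>) \<in> boundary_adjacency M"
      using step \<rho> by (auto simp: boundary_adjacency_def boundary_cells_M face_M)
    then show ?case using step \<rho> \<open>\<rho> \<notin> \<Gamma>\<close> by (auto intro: rtrancl.rtrancl_into_rtrancl)
  qed (use assms in auto)
  moreover have "(\<sigma>, \<tau>) \<in> (boundary_adjacency M1)\<^sup>* \<and> \<tau> \<in> boundary_cells M1 - \<Gamma>"
    if "(\<sigma>, \<tau>) \<in> (boundary_adjacency M)\<^sup>*" for \<tau>
    using that
  proof (induction rule: rtrancl_induct)
    case (step \<tau> \<rho>)
    then have \<tau>: "\<tau> \<in> cells M1 - \<Gamma>" using boundary_cells_subset[OF poset1] by auto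
    have \<rho>: "\<rho> \<in> boundary_cells M" "(\<tau>, \<rho>) \<in> face M \<or> (\<rho>, \<tau>) \<in> face M"
      using step by (auto simp: boundary_adjacency_def)
    then have face: "(\<tau>, \<rho>) \<in> face M1 \<or> (\<rho>, \<tau>) \<in> face M1" using \<tau> coface_M1 face_M1 by blast
    then have "\<rho> \<in> boundary_cells M1 - \<Gamma>"
      using boundary_cells_M1 \<rho>(1) face_cells[OF poset1] by blast
    then show ?case using step face
      by (auto simp: boundary_adjacency_def intro: rtrancl.rtrancl_into_rtrancl)
  qed (use assms in auto)
  ultimately show ?thesis by blast
qed

lemma boundary_components_M:
  "boundary_components M = (boundary_components M1 \<union> boundary_components M2) - {\<Gamma>}"
proof -
  have cls: "(boundary_adjacency N)\<^sup>* `` {\<sigma>} = \<Gamma> \<longleftrightarrow> \<sigma> \<in> \<Gamma>"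
    if "\<Gamma> \<in> boundary_components N" for N \<sigma>
    using boundary_component_class[OF that] by auto
  have minus: "boundary_components N - {\<Gamma>} =
      (\<lambda>\<sigma>. (boundary_adjacency N)\<^sup>* `` {\<sigma>}) ` (boundary_cells N - \<Gamma>)"
    if "\<Gamma> \<in> boundary_components N" for N
    unfolding boundary_components_eq using cls[OF that] by auto
  have "boundary_components M = (\<lambda>\<sigma>. (boundary_adjacency M)\<^sup>* `` {\<sigma>}) ` (boundary_cells M1 - \<Gamma>) \<union>
      (\<lambda>\<sigma>. (boundary_adjacency M)\<^sup>* `` {\<sigma>}) ` (boundary_cells M2 - \<Gamma>)"
    unfolding boundary_components_eq boundary_cells_M by (auto simp: image_iff)
  also have "\<dots> = (\<lambda>\<sigma>. (boundary_adjacency M1)\<^sup>* `` {\<sigma>}) ` (boundary_cells M1 - \<Gamma>) \<union>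
      (\<lambda>\<sigma>. (boundary_adjacency M2)\<^sup>* `` {\<sigma>}) ` (boundary_cells M2 - \<Gamma>)"
    using boundary_class_M1 gluing.boundary_class_M1[OF swap] by (intro arg_cong2[of _ _ _ _ "(\<union>)"] image_cong) auto
  also have "\<dots> = (boundary_components M1 - {\<Gamma>}) \<union> (boundary_components M2 - {\<Gamma>})"
    using minus[OF \<Gamma>1] minus[OF \<Gamma>2] by simp
  finally show ?thesis by blast
qed

lemma component1_disjoint:
  assumes "k \<in> boundary_components M1" "k \<noteq> \<Gamma>"
  shows "k \<subseteq> cells M1 - \<Gamma>" "k \<inter> cells M2 = {}" "k \<notin> boundary_components M2"
proof -
  show k: "k \<subseteq> cells M1 - \<Gamma>"
    using boundary_component_subset[OF assms(1)] boundary_cells_subset[OF poset1]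
      boundary_components_disjoint[OF assms(1) \<Gamma>1] assms(2) by blast
  then show M2: "k \<inter> cells M2 = {}" using inter by auto
  show "k \<notin> boundary_components M2"
  proof
    assume "k \<in> boundary_components M2"
    then have "k \<subseteq> cells M2" using boundary_component_subset boundary_cells_subset[OF poset2] by blast
    moreover have "k \<noteq> {}" using assms by (auto simp: boundary_components_eq)
    ultimately show False using M2 by auto
  qed
qed

lemmas component2_disjoint = gluing.component1_disjoint[OF swap]

lemma inner_vertices_M: "inner_vertices M = inner_vertices M1 \<union> inner_vertices M2 \<union> (vertices M \<inter> \<Gamma>)"
proof -
  have "v \<in> cells M1 \<or> v \<in> cells M2" if "v \<in> vertices M" for v
    using that cells_M by (auto simp: vertices_def)
  then show ?thesis
    using vertices_M1 vertices_M2 boundary_cells_M1 boundary_cells_M2 boundary_cells_\<Gamma>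
    by (auto simp: inner_vertices_def vertices_M verts_subset(2)[THEN subsetD, OF poset1]
      verts_subset(2)[THEN subsetD, OF poset2])
qed

lemma inner_edges_M: "inner_edges M = inner_edges M1 \<union> inner_edges M2 \<union> (edges M \<inter> \<Gamma>)"
proof -
  have c: "e \<in> edges M1 \<Longrightarrow> e \<in> cells M1" "e \<in> edges M2 \<Longrightarrow> e \<in> cells M2" for e
    by (auto simp: edges_def)
  show ?thesis
    using boundary_cells_M1 boundary_cells_M2 boundary_cells_\<Gamma>
    by (auto simp: inner_edges_def edges_M dest: c)
qed

lemma inner1_not_M2:
  "inner_vertices M1 \<subseteq> cells M1 - cells M2" "inner_edges M1 \<subseteq> cells M1 - cells M2"
  using boundary_cells_\<Gamma> inter by (auto simp: inner_vertices_def inner_edges_def vertices_def edges_def)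

lemmas inner2_not_M1 = gluing.inner1_not_M2[OF swap]

lemma edge_set_M:
  assumes "Q1 \<subseteq> inner_edges M1" "Q2 \<subseteq> inner_edges M2" "B \<Gamma> \<subseteq> edges M \<inter> \<Gamma>"
  shows "inner_edges M - (Q1 \<union> Q2 \<union> B \<Gamma>) =
      (inner_edges M1 - Q1) \<union> (inner_edges M2 - Q2) \<union> (edges M \<inter> \<Gamma> - B \<Gamma>)" (is ?inner)
    and "edge_set M B (Q1 \<union> Q2 \<union> B \<Gamma>) = edge_set M1 B Q1 \<union> edge_set M2 B Q2" (is ?all)
proof -
  have disj: "inner_edges M1 \<inter> inner_edges M2 = {}" "inner_edges M1 \<inter> \<Gamma> = {}" "inner_edges M2 \<inter> \<Gamma> = {}"
    using inner1_not_M2 inner2_not_M1 inter by blast+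
  show ?inner unfolding inner_edges_M using assms disj by blast
  have k1: "edges M \<inter> k = edges M1 \<inter> k" if "k \<in> boundary_components M1" for k
    using boundary_component_subset[OF that] boundary_cells_subset[OF poset1] edges_M1 by blast
  have k2: "edges M \<inter> k = edges M2 \<inter> k" if "k \<in> boundary_components M2" for k
    using boundary_component_subset[OF that] boundary_cells_subset[OF poset2] edges_M2 by blast
  have "(\<Union>k\<in>boundary_components M. edges M \<inter> k - B k) \<union> (edges M \<inter> \<Gamma> - B \<Gamma>) =
      (\<Union>k\<in>boundary_components M1. edges M \<inter> k - B k) \<union> (\<Union>k\<in>boundary_components M2. edges M \<inter> k - B k)"
    using \<Gamma>1 \<Gamma>2 unfolding boundary_components_M by blast
  also have "\<dots> = (\<Union>k\<in>boundary_components M1. edges M1 \<inter> k - B k) \<union> (\<Union>k\<in>boundary_components M2. edges M2 \<inter> k - B k)"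
    using k1 k2 by auto
  finally have union: "(\<Union>k\<in>boundary_components M. edges M \<inter> k - B k) \<union> (edges M \<inter> \<Gamma> - B \<Gamma>) =
      (\<Union>k\<in>boundary_components M1. edges M1 \<inter> k - B k) \<union> (\<Union>k\<in>boundary_components M2. edges M2 \<inter> k - B k)" .
  have "(I1 \<union> I2 \<union> G) \<union> U = (I1 \<union> U1) \<union> (I2 \<union> U2)" if "U \<union> G = U1 \<union> U2" for I1 I2 G U U1 U2 :: "'c set"
    using that by blast
  from this[OF union] show ?all unfolding edge_set_def \<open>?inner\<close> .
qed

end

section \<open>Infinitesimal motions and the size of minimal rigid constructions\<close>

lemma UNIV_motion: "(UNIV :: motion set) = range Trans \<union> range Rot"
proof -
  have "a \<in> range Trans \<union> range Rot" for a by (cases a) auto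
  then show ?thesis by auto
qed

lemma finite_motion: "finite (UNIV :: motion set)"
  by (simp add: UNIV_motion)

lemma sum_motion: "(\<Sum>a\<in>UNIV. f a) = (\<Sum>i\<in>UNIV. f (Trans i)) + (\<Sum>i\<in>UNIV. f (Rot i))"
  unfolding UNIV_motion
  by (subst sum.union_disjoint) (auto simp: sum.reindex inj_on_def)

lemma card_motion: "card (UNIV :: motion set) = 6"
  using sum_motion[of "\<lambda>_. 1 :: nat"] by simp

text \<open>The velocity field of the infinitesimal isometry with components \<open>z\<close> in the basis of
  \<open>\<ee>(3)\<close>.\<close>

definition motion_field :: "(motion \<Rightarrow> real) \<Rightarrow> real^3 \<Rightarrow> real^3" where
  "motion_field z p = (\<Sum>a\<in>UNIV. z a *\<^sub>R displacement a p)"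

lemma motion_field_eq:
  "motion_field z p = (\<chi> i. z (Trans i)) + cross3 (\<chi> i. z (Rot i)) p"
  by (simp add: motion_field_def sum_motion sum_3 Finite_Cartesian_Product.vec_eq_iff forall_3 cross3_def axis_def)

lemma motion_field_nth: "motion_field z p $ i = (\<Sum>a\<in>UNIV. displacement a p $ i * z a)"
  by (simp add: motion_field_def mult.commute)

lemma motion_field_diff: "motion_field (\<lambda>a. z a - z' a) p = motion_field z p - motion_field z' p"
  by (simp add: motion_field_def scaleR_diff_left sum_subtractf)

lemma moves_as_whole_iff:
  "moves_as_whole x u S \<longleftrightarrow> (\<exists>z. \<forall>v\<in>S. u v = motion_field z (x v))"
proof
  assume "moves_as_whole x u S"
  then obtain b w where bw: "\<forall>v\<in>S. u v = b + cross3 w (x v)" by (auto simp: moves_as_whole_def)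
  define z where "z a = (case a of Trans i \<Rightarrow> b $ i | Rot i \<Rightarrow> w $ i)" for a
  have "(\<chi> i. z (Trans i)) = b" "(\<chi> i. z (Rot i)) = w" by (simp_all add: z_def)
  then show "\<exists>z. \<forall>v\<in>S. u v = motion_field z (x v)" using bw motion_field_eq by metis
next
  assume "\<exists>z. \<forall>v\<in>S. u v = motion_field z (x v)"
  then show "moves_as_whole x u S" unfolding moves_as_whole_def motion_field_eq by blast
qed

text \<open>Six times the oriented volume of the tetrahedron \<open>abcd\<close>.\<close>

definition six_volume :: "real^3 \<Rightarrow> real^3 \<Rightarrow> real^3 \<Rightarrow> real^3 \<Rightarrow> real" where
  "six_volume a b c d = cross3 (b - a) (c - a) \<bullet> (d - a)"

lemma six_volume_abs_swap:
  "\<bar>six_volume b a c d\<bar> = \<bar>six_volume a b c d\<bar>"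
  "\<bar>six_volume a c b d\<bar> = \<bar>six_volume a b c d\<bar>"
  "\<bar>six_volume a b d c\<bar> = \<bar>six_volume a b c d\<bar>"
proof -
  have "six_volume b a c d = - six_volume a b c d" "six_volume a c b d = - six_volume a b c d"
    "six_volume a b d c = - six_volume a b c d"
    by (simp_all add: six_volume_def cross3_def inner_vec_def sum_3 algebra_simps)
  then show "\<bar>six_volume b a c d\<bar> = \<bar>six_volume a b c d\<bar>"
    "\<bar>six_volume a c b d\<bar> = \<bar>six_volume a b c d\<bar>" "\<bar>six_volume a b d c\<bar> = \<bar>six_volume a b c d\<bar>" by simp_all
qed

text \<open>The absolute value is symmetric, as transpositions of neighbours generate all
  permutations.\<close>

lemma six_volume_abs_permute:
  assumes "distinct [p, q, r, s]" "{p, q, r, s} = {a, b, c, d}"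
  shows "\<bar>six_volume (x p) (x q) (x r) (x s)\<bar> = \<bar>six_volume (x a) (x b) (x c) (x d)\<bar>"
proof -
  have ne: "p \<noteq> q" "p \<noteq> r" "p \<noteq> s" "q \<noteq> r" "q \<noteq> s" "r \<noteq> s" using assms(1) by auto
  have "p \<in> {a, b, c, d}" "q \<in> {a, b, c, d}" "r \<in> {a, b, c, d}" "s \<in> {a, b, c, d}"
    unfolding assms(2)[symmetric] by simp_all
  then show ?thesis
    unfolding insert_iff empty_iff simp_thms
    by (elim disjE) (use ne in \<open>simp_all add: six_volume_abs_swap\<close>)
qed

text \<open>An infinitesimal isometry that fixes three points not on a line is zero. Its rotation
  part \<open>w\<close> satisfies \<open>w \<times> D = w \<times> E = 0\<close> for two independent edge vectors; expanding
  \<open>w\<close> in the basis \<open>D\<close>, \<open>E\<close>, \<open>F\<close> by Cramer's rule, all coefficients vanish.\<close>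

lemma motion_field_zero:
  assumes "six_volume p q r s \<noteq> 0"
    and zero: "motion_field z p = 0" "motion_field z q = 0" "motion_field z r = 0"
  shows "z a = 0"
proof -
  define b w where "b = (\<chi> i. z (Trans i))" and "w = (\<chi> i. z (Rot i))"
  have eq: "b + cross3 w p = 0" "b + cross3 w q = 0" "b + cross3 w r = 0"
    using zero by (simp_all add: motion_field_eq b_def w_def)
  define D E F where "D = q - p" and "E = r - p" and "F = s - p"
  have "cross3 w D = (b + cross3 w q) - (b + cross3 w p)" "cross3 w E = (b + cross3 w r) - (b + cross3 w p)"
    by (simp_all add: D_def E_def right_diff_distrib cross3_simps)
  then have DE: "cross3 w D = 0" "cross3 w E = 0" using eq by simp_all
  have "(cross3 D E \<bullet> F) *\<^sub>R w = (cross3 w E \<bullet> F) *\<^sub>R D - (cross3 w D \<bullet> F) *\<^sub>R E + (cross3 w D \<bullet> E) *\<^sub>R F"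
    by (simp add: Finite_Cartesian_Product.vec_eq_iff forall_3 cross3_def inner_vec_def sum_3 algebra_simps)
  also have "\<dots> = 0" using DE by simp
  finally have "w = 0" using assms(1) by (simp add: six_volume_def D_def E_def F_def)
  moreover from this have "b = 0" using eq by (simp add: cross3_def Finite_Cartesian_Product.vec_eq_iff forall_3)
  ultimately have "z (Trans i) = 0" "z (Rot i) = 0" for i
    by (simp_all add: b_def w_def Finite_Cartesian_Product.vec_eq_iff)
  then show ?thesis by (cases a) auto
qed

text \<open>The part of \<open>coherently_oriented\<close> that concerns single tetrahedra. It gives the
  oriented volumes their meaning and passes to the glued triangulation directly.\<close>

definition tetrahedra_oriented :: "'c triangulation \<Rightarrow> bool" where
  "tetrahedra_oriented K \<longleftrightarrow>
     (\<forall>t\<in>tetrahedra K. distinct (orient K t) \<and> set (orient K t) = verts K t)"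

lemma tetrahedron_six_volume_nonzero:
  assumes "tetrahedra_oriented K" "nondegenerate K x" "t \<in> tetrahedra K"
    and "distinct [p, q, r, s]" "verts K t = {p, q, r, s}"
  shows "six_volume (x p) (x q) (x r) (x s) \<noteq> 0"
proof -
  define xs where "xs = orient K t"
  have xs: "distinct xs" "set xs = verts K t" using assms(1,3) by (auto simp: tetrahedra_oriented_def xs_def)
  have "card (verts K t) = 4" using assms(3) by (simp add: tetrahedra_def)
  then have "length xs = 4" using xs distinct_card by metis
  then obtain a b c d where abcd: "xs = [a, b, c, d]"
    by (auto simp: length_Suc_conv numeral_eq_Suc)
  have "volume K x t = six_volume (x a) (x b) (x c) (x d) / 6"
    by (simp add: volume_def six_volume_def Let_def abcd flip: xs_def)
  then have "\<bar>six_volume (x a) (x b) (x c) (x d)\<bar> \<noteq> 0"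
    using assms(2,3) by (auto simp: nondegenerate_def)
  moreover have "{p, q, r, s} = {a, b, c, d}" using xs(2) assms(5) abcd by simp
  ultimately show ?thesis using six_volume_abs_permute[OF assms(4), of a b c d x] by auto
qed

text \<open>A boundary component contains a triangle, and its vertices are not on a line because it
  is a face of a nondegenerate tetrahedron.\<close>

lemma boundary_component_rigid:
  assumes K: "simplicial_poset3 K" "tetrahedra_oriented K" "nondegenerate K x"
    and k: "k \<in> boundary_components K"
    and zero: "\<And>v. v \<in> vertices K \<inter> k \<Longrightarrow> motion_field z (x v) = 0"
  shows "z a = 0"
proof -
  obtain \<phi> where \<phi>: "\<phi> \<in> triangles K" "\<phi> \<in> k"
    using boundary_component_triangle[OF K(1) k] by blast
  then obtain t where t: "t \<in> tetrahedra K" "(\<phi>, t) \<in> face K"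
    using cell_in_tetrahedron[OF K(1), of \<phi>] by (auto simp: triangles_def)
  have "card (verts K \<phi>) = 3" "card (verts K t) = 4" using \<phi> t by (simp_all add: triangles_def tetrahedra_def)
  then obtain p q r where pqr: "verts K \<phi> = {p, q, r}" "distinct [p, q, r]"
    by (auto simp: card_3_iff)
  have sub: "verts K \<phi> \<subseteq> verts K t" using verts_mono[OF K(1)] t by blast
  then have "card (verts K t - verts K \<phi>) = 1"
    using \<open>card (verts K \<phi>) = 3\<close> \<open>card (verts K t) = 4\<close> finite_verts[OF K(1)] by (simp add: card_Diff_subset)
  then obtain s where "verts K t - verts K \<phi> = {s}" by (auto simp: card_1_singleton_iff)
  then have "verts K t = {p, q, r, s}" "distinct [p, q, r, s]" using pqr sub by auto
  then have "six_volume (x p) (x q) (x r) (x s) \<noteq> 0"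
    by (intro tetrahedron_six_volume_nonzero[OF K(2,3) t(1)])
  moreover have "v \<in> vertices K \<inter> k" if "v \<in> verts K \<phi>" for v
    using boundary_component_face[OF K(1) k \<phi>(2)] that by (auto simp: verts_def)
  ultimately show ?thesis using motion_field_zero zero pqr(1) by (metis insertCI)
qed

lemma length_change_cong:
  assumes "simplicial_poset3 K" "e \<in> edges K" "\<And>v. v \<in> verts K e \<Longrightarrow> u v = u' v"
  shows "length_change K x u e = length_change K x u' e"
proof -
  obtain p q where pq: "verts K e = {p, q}" "ends (verts K e) = (p, q)" using edge_verts[OF assms(1,2)] by metis
  have "u p = u' p" "u q = u' q" by (rule assms(3); simp add: pq(1))+
  then show ?thesis by (simp add: length_change_def pq(2))
qed

lemma length_change_zero:
  assumes "simplicial_poset3 K" "e \<in> edges K" "\<And>v. v \<in> verts K e \<Longrightarrow> u v = 0"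
  shows "length_change K x u e = 0"
  by (subst length_change_cong[OF assms(1,2), of u "\<lambda>_. 0"])
    (use assms(3) in \<open>auto simp: length_change_def split: prod.splits\<close>)

lemma length_change_sum:
  "length_change K x (\<lambda>v. \<Sum>c\<in>X. y c *\<^sub>R b c v) e = (\<Sum>c\<in>X. length_change K x (b c) e * y c)"
proof -
  obtain p q where pq: "ends (verts K e) = (p, q)" by fastforce
  have "(x p - x q) \<bullet> ((\<Sum>c\<in>X. y c *\<^sub>R b c p) - (\<Sum>c\<in>X. y c *\<^sub>R b c q)) =
      (\<Sum>c\<in>X. (x p - x q) \<bullet> (b c p - b c q) * y c)"
    unfolding sum_subtractf[symmetric] scaleR_diff_right[symmetric] inner_sum_right
    by (simp add: mult.commute)
  then show ?thesis by (simp add: length_change_def pq sum_divide_distrib)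
qed

lemma length_change_motion:
  "length_change K x (\<lambda>v. motion_field z (x v)) e = 0"
proof -
  obtain p q where pq: "ends (verts K e) = (p, q)" by fastforce
  have "(x p - x q) \<bullet> (motion_field z (x p) - motion_field z (x q)) = 0"
    by (simp add: motion_field_eq cross3_def inner_vec_def sum_3 algebra_simps)
  then show ?thesis by (simp add: length_change_def pq)
qed

text \<open>The vertices in \<open>F\<close> move freely, and each set in \<open>C\<close> moves as a whole. This covers
  the bases for a manifold (\<open>F\<close> inner vertices, \<open>C\<close> boundary components) and for a surface
  (\<open>C\<close> empty).\<close>

definition motion_basis :: "'c set \<Rightarrow> 'c set set \<Rightarrow> 'c basis_vector set" where
  "motion_basis F C = {Coord v i | v i. v \<in> F} \<union> {Sway k a | k a. k \<in> C}"

lemma basis_eq: "basis K = motion_basis (inner_vertices K) (boundary_components K)"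
  by (simp add: basis_def motion_basis_def)

lemma surface_basis_eq: "surface_basis K \<Gamma> = motion_basis (vertices K \<inter> \<Gamma>) {}"
  by (simp add: surface_basis_def motion_basis_def)

lemma motion_basis_image:
  "motion_basis F C = (\<lambda>(v, i). Coord v i) ` (F \<times> UNIV) \<union> (\<lambda>(k, a). Sway k a) ` (C \<times> UNIV)"
  by (auto simp: motion_basis_def)

lemma motion_basis_Un: "motion_basis (F \<union> F') (C \<union> C') = motion_basis F C \<union> motion_basis F' C'"
  by (auto simp: motion_basis_def)

lemma motion_basis_disjoint: "F \<inter> F' = {} \<Longrightarrow> C \<inter> C' = {} \<Longrightarrow> motion_basis F C \<inter> motion_basis F' C' = {}"
  by (auto simp: motion_basis_def)

lemma finite_motion_basis: "finite F \<Longrightarrow> finite C \<Longrightarrow> finite (motion_basis F C)"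
  by (simp add: motion_basis_image finite_motion)

lemma card_motion_basis:
  assumes "finite F" "finite C"
  shows "card (motion_basis F C) = 3 * card F + 6 * card C"
proof -
  have "card (motion_basis F C) = card ((\<lambda>(v, i). Coord v i) ` (F \<times> (UNIV :: 3 set))) +
      card ((\<lambda>(k, a). Sway k a) ` (C \<times> (UNIV :: motion set)) :: 'a basis_vector set)"
    unfolding motion_basis_image by (rule card_Un_disjoint) (use assms finite_motion in auto)
  also have "\<dots> = card (F \<times> (UNIV :: 3 set)) + card (C \<times> (UNIV :: motion set))"
    by (intro arg_cong2[of _ _ _ _ "(+)"] card_image) (auto simp: inj_on_def)
  finally show ?thesis by (simp add: card_cartesian_product card_motion)
qed

text \<open>\<open>V\<close> is the set of all vertices considered. By the last assumption a sway is determined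
  by the displacements that it causes, so the coordinates of a displacement in the basis are unique.\<close>

locale motion_blocks =
  fixes x :: "'c \<Rightarrow> real^3" and F :: "'c set" and C :: "'c set set" and V :: "'c set"
  assumes finF: "finite F" and finC: "finite C"
    and F_block: "k \<in> C \<Longrightarrow> F \<inter> k = {}"
    and block_disjoint: "k \<in> C \<Longrightarrow> k' \<in> C \<Longrightarrow> v \<in> k \<Longrightarrow> v \<in> k' \<Longrightarrow> k = k'"
    and F_sub: "F \<subseteq> V" and cover: "V \<subseteq> F \<union> \<Union>C"
    and block_rigid: "k \<in> C \<Longrightarrow> (\<And>v. v \<in> V \<inter> k \<Longrightarrow> motion_field z (x v) = 0) \<Longrightarrow> z a = 0"
begin

lemma finX: "finite (motion_basis F C)"
  using finF finC by (rule finite_motion_basis)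

definition displacements :: "('c basis_vector \<Rightarrow> real) \<Rightarrow> 'c \<Rightarrow> real^3" where
  "displacements y v = (\<Sum>c\<in>motion_basis F C. y c *\<^sub>R basis_displacement x c v)"

lemma displacements_split:
  "displacements y v = (\<Sum>w\<in>F. \<Sum>i\<in>UNIV. y (Coord w i) *\<^sub>R basis_displacement x (Coord w i) v) +
     (\<Sum>k\<in>C. \<Sum>a\<in>UNIV. y (Sway k a) *\<^sub>R basis_displacement x (Sway k a) v)"
proof -
  let ?g = "\<lambda>c. y c *\<^sub>R basis_displacement x c v"
  have "displacements y v = (\<Sum>c\<in>(\<lambda>(v, i). Coord v i) ` (F \<times> UNIV). ?g c) +
      (\<Sum>c\<in>(\<lambda>(k, a). Sway k a) ` (C \<times> UNIV). ?g c)"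
    unfolding displacements_def motion_basis_image
    by (rule sum.union_disjoint) (use finF finC finite_motion in auto)
  also have "(\<Sum>c\<in>(\<lambda>(v, i). Coord v i) ` (F \<times> UNIV). ?g c) = (\<Sum>(w, i)\<in>F \<times> UNIV. ?g (Coord w i))"
    by (subst sum.reindex) (auto simp: inj_on_def case_prod_beta)
  also have "(\<Sum>c\<in>(\<lambda>(k, a). Sway k a) ` (C \<times> UNIV). ?g c) = (\<Sum>(k, a)\<in>C \<times> UNIV. ?g (Sway k a))"
    by (subst sum.reindex) (auto simp: inj_on_def case_prod_beta)
  finally show ?thesis by (simp only: sum.cartesian_product)
qed

lemma displacements_free:
  assumes "v \<in> F"
  shows "displacements y v = (\<chi> i. y (Coord v i))"
proof -
  have "(\<Sum>k\<in>C. \<Sum>a\<in>UNIV. y (Sway k a) *\<^sub>R basis_displacement x (Sway k a) v) = 0"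
    by (intro sum.neutral ballI) (use assms F_block in auto)
  moreover have "(\<Sum>w\<in>F. \<Sum>i\<in>UNIV. y (Coord w i) *\<^sub>R basis_displacement x (Coord w i) v) =
      (\<Sum>w\<in>F. if w = v then \<Sum>i\<in>UNIV. y (Coord v i) *\<^sub>R axis i 1 else 0)"
    by (intro sum.cong) auto
  moreover have "(\<Sum>i\<in>UNIV. y (Coord v i) *\<^sub>R axis i 1) = (\<chi> i. y (Coord v i))"
    by (simp add: Finite_Cartesian_Product.vec_eq_iff sum_3 forall_3 axis_def)
  ultimately show ?thesis using assms finF by (simp add: displacements_split)
qed

lemma displacements_block:
  assumes "k \<in> C" "v \<in> k"
  shows "displacements y v = motion_field (\<lambda>a. y (Sway k a)) (x v)"
proof -
  have "(\<Sum>w\<in>F. \<Sum>i\<in>UNIV. y (Coord w i) *\<^sub>R basis_displacement x (Coord w i) v) = 0"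
    by (intro sum.neutral ballI) (use assms F_block[of k] in auto)
  moreover have "(\<Sum>k'\<in>C. \<Sum>a\<in>UNIV. y (Sway k' a) *\<^sub>R basis_displacement x (Sway k' a) v) =
      (\<Sum>k'\<in>C. if k' = k then motion_field (\<lambda>a. y (Sway k a)) (x v) else 0)"
  proof (intro sum.cong refl)
    fix k' assume "k' \<in> C"
    then have "v \<notin> k'" if "k' \<noteq> k" using block_disjoint[of k' k v] assms that by blast
    then show "(\<Sum>a\<in>UNIV. y (Sway k' a) *\<^sub>R basis_displacement x (Sway k' a) v) =
        (if k' = k then motion_field (\<lambda>a. y (Sway k a)) (x v) else 0)"
      using assms(2) by (cases "k' = k") (simp_all add: motion_field_def)
  qed
  ultimately show ?thesis using assms finC by (simp add: displacements_split)
qed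

lemma displacements_f1:
  assumes "v \<in> V"
  shows "displacements (\<lambda>c. f1 x c a) v = displacement a (x v)"
proof (cases "v \<in> F")
  case True
  then show ?thesis by (simp add: displacements_free Finite_Cartesian_Product.vec_eq_iff)
next
  case False
  then obtain k where "k \<in> C" "v \<in> k" using assms cover by auto
  then show ?thesis
    by (simp add: displacements_block motion_field_def if_distrib[of "\<lambda>r. r *\<^sub>R _"] sum.delta finite_motion
        cong: if_cong)
qed

lemma f2_f1:
  assumes "simplicial_poset3 K" "e \<in> edges K" "verts K e \<subseteq> V"
  shows "(\<Sum>c\<in>motion_basis F C. f2 K x e c * f1 x c a) = 0"
proof -
  have "(\<Sum>c\<in>motion_basis F C. f2 K x e c * f1 x c a) = length_change K x (displacements (\<lambda>c. f1 x c a)) e"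
    unfolding displacements_def[abs_def] length_change_sum f2_def ..
  also have "\<dots> = length_change K x (\<lambda>v. motion_field (\<lambda>b. if b = a then 1 else 0) (x v)) e"
  proof (rule length_change_cong[OF assms(1,2)])
    fix v assume "v \<in> verts K e"
    then have "displacements (\<lambda>c. f1 x c a) v = displacement a (x v)" using assms(3) by (auto intro: displacements_f1)
    also have "\<dots> = motion_field (\<lambda>b. if b = a then 1 else 0) (x v)"
      by (simp add: motion_field_def if_distrib[of "\<lambda>r. r *\<^sub>R _"] sum.delta finite_motion cong: if_cong)
    finally show "displacements (\<lambda>c. f1 x c a) v = motion_field (\<lambda>b. if b = a then 1 else 0) (x v)" .
  qed
  also have "\<dots> = 0" by (rule length_change_motion)
  finally show ?thesis .
qed

lemma rigid_motions:
  assumes "\<And>v. v \<in> V \<Longrightarrow> displacements y v = motion_field z (x v)" "c \<in> motion_basis F C"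
  shows "y c = (\<Sum>a\<in>UNIV. f1 x c a * z a)"
proof (cases c)
  case (Coord v i)
  then have "v \<in> F" using assms(2) by (auto simp: motion_basis_def)
  then have "(\<chi> i. y (Coord v i)) = motion_field z (x v)" using assms(1) F_sub displacements_free by fastforce
  then have "y c = motion_field z (x v) $ i" using Coord by (metis vec_lambda_beta)
  then show ?thesis using Coord by (simp add: motion_field_nth)
next
  case (Sway k b)
  then have k: "k \<in> C" using assms(2) by (auto simp: motion_basis_def)
  have "y (Sway k b) - z b = 0"
  proof (rule block_rigid[OF k, where z = "\<lambda>a. y (Sway k a) - z a"])
    fix v assume v: "v \<in> V \<inter> k"
    then have "motion_field (\<lambda>a. y (Sway k a)) (x v) = motion_field z (x v)"
      using assms(1)[of v] displacements_block[OF k] by simp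
    then show "motion_field (\<lambda>a. y (Sway k a) - z a) (x v) = 0" by (simp add: motion_field_diff)
  qed
  then show ?thesis using Sway
    by (simp add: if_distrib[of "\<lambda>r. r * _"] sum.delta finite_motion cong: if_cong)
qed

lemma block_motion_displacements:
  assumes "\<And>k. k \<in> C \<Longrightarrow> moves_as_whole x u (V \<inter> k)"
  obtains y where "\<And>v. v \<in> V \<Longrightarrow> displacements y v = u v"
proof -
  obtain m where m: "\<And>k v. k \<in> C \<Longrightarrow> v \<in> V \<inter> k \<Longrightarrow> u v = motion_field (m k) (x v)"
    using assms unfolding moves_as_whole_iff by metis
  define y where "y c = (case c of Coord v i \<Rightarrow> u v $ i | Sway k a \<Rightarrow> m k a)" for c
  have "displacements y v = u v" if v: "v \<in> V" for v
  proof (cases "v \<in> F")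
    case False
    then obtain k where "k \<in> C" "v \<in> k" using v cover by auto
    then show ?thesis using m[of k v] v by (simp add: displacements_block y_def)
  qed (simp add: displacements_free y_def)
  then show ?thesis using that by blast
qed

text \<open>Rigidity and minimality speak of displacements of all vertices. On \<open>V\<close>, the
  displacements that move the blocks as a whole correspond to the vectors of coordinates, so they become the
  hypotheses of \<open>minimal_constraints_card\<close>.\<close>

lemma rigid_constraints_card:
  assumes K: "simplicial_poset3 K" and Q: "finite Q" "Q \<subseteq> edges K" "\<And>e. e \<in> Q \<Longrightarrow> verts K e \<subseteq> V"
    and R: "R \<subseteq> motion_basis F C" "minor (f1 x) R UNIV \<noteq> 0"
    and rigid: "\<And>u. (\<And>k. k \<in> C \<Longrightarrow> moves_as_whole x u (V \<inter> k)) \<Longrightarrow>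
        (\<And>e. e \<in> Q \<Longrightarrow> length_change K x u e = 0) \<Longrightarrow> moves_as_whole x u V"
    and minimal: "\<And>e0. e0 \<in> Q \<Longrightarrow> \<exists>u. (\<forall>k\<in>C. moves_as_whole x u (V \<inter> k)) \<and>
        (\<forall>e\<in>Q - {e0}. length_change K x u e = 0) \<and> \<not> moves_as_whole x u V"
  shows "card Q + 6 = card (motion_basis F C)"
proof -
  have f2_sum: "(\<Sum>c\<in>motion_basis F C. f2 K x e c * y c) = length_change K x (displacements y) e" for e y
    unfolding displacements_def[abs_def] length_change_sum f2_def ..
  have "card Q + card (UNIV :: motion set) = card (motion_basis F C)"
  proof (rule minimal_constraints_card[OF finX finite_motion Q(1) R])
    show "(\<Sum>c\<in>motion_basis F C. f2 K x e c * f1 x c a) = 0" if "e \<in> Q" for e a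
      using f2_f1[OF K _ Q(3)[OF that]] Q(2) that by blast
  next
    fix y assume y: "\<And>e. e \<in> Q \<Longrightarrow> (\<Sum>c\<in>motion_basis F C. f2 K x e c * y c) = 0"
    have "moves_as_whole x (displacements y) V"
    proof (rule rigid)
      show "moves_as_whole x (displacements y) (V \<inter> k)" if "k \<in> C" for k
        unfolding moves_as_whole_iff using displacements_block[OF that] by blast
      show "length_change K x (displacements y) e = 0" if "e \<in> Q" for e
        using y[OF that] f2_sum by simp
    qed
    then obtain z where "\<And>v. v \<in> V \<Longrightarrow> displacements y v = motion_field z (x v)"
      unfolding moves_as_whole_iff by blast
    then show "\<exists>z. \<forall>c\<in>motion_basis F C. y c = (\<Sum>a\<in>UNIV. f1 x c a * z a)"
      using rigid_motions by blast
  next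
    fix e0 assume "e0 \<in> Q"
    then obtain u where u: "\<forall>k\<in>C. moves_as_whole x u (V \<inter> k)"
        "\<forall>e\<in>Q - {e0}. length_change K x u e = 0" "\<not> moves_as_whole x u V"
      using minimal by blast
    obtain y where y: "\<And>v. v \<in> V \<Longrightarrow> displacements y v = u v"
      using block_motion_displacements[of u] u(1) by blast
    have "(\<Sum>c\<in>motion_basis F C. f2 K x e c * y c) = 0" if "e \<in> Q - {e0}" for e
    proof -
      have "length_change K x (displacements y) e = length_change K x u e"
        by (rule length_change_cong[OF K]) (use that Q y in auto)
      then show ?thesis using u(2) that f2_sum by simp
    qed
    moreover have "\<not> (\<exists>z. \<forall>c\<in>motion_basis F C. y c = (\<Sum>a\<in>UNIV. f1 x c a * z a))"
    proof
      assume "\<exists>z. \<forall>c\<in>motion_basis F C. y c = (\<Sum>a\<in>UNIV. f1 x c a * z a)"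
      then obtain z where z: "\<And>c. c \<in> motion_basis F C \<Longrightarrow> y c = (\<Sum>a\<in>UNIV. f1 x c a * z a)" by blast
      have "u v = motion_field z (x v)" if "v \<in> V" for v
      proof -
        have "u v = (\<Sum>c\<in>motion_basis F C. \<Sum>a\<in>UNIV. z a *\<^sub>R f1 x c a *\<^sub>R basis_displacement x c v)"
          unfolding y[OF that, symmetric] displacements_def
          by (intro sum.cong refl) (simp add: z scaleR_sum_left mult.commute)
        also have "\<dots> = (\<Sum>a\<in>UNIV. z a *\<^sub>R displacements (\<lambda>c. f1 x c a) v)"
          unfolding displacements_def scaleR_sum_right by (rule sum.swap)
        also have "\<dots> = motion_field z (x v)" using displacements_f1[OF that] by (simp add: motion_field_def)
        finally show ?thesis .
      qed
      then show False using u(3) unfolding moves_as_whole_iff by blast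
    qed
    ultimately show "\<exists>y. (\<forall>e\<in>Q - {e0}. (\<Sum>c\<in>motion_basis F C. f2 K x e c * y c) = 0) \<and>
        \<not> (\<exists>z. \<forall>c\<in>motion_basis F C. y c = (\<Sum>a\<in>UNIV. f1 x c a * z a))" by blast
  qed
  then show ?thesis by (simp add: card_motion)
qed

end

lemma motion_blocks_manifold:
  assumes K: "simplicial_poset3 K" "tetrahedra_oriented K" "nondegenerate K x"
  shows "motion_blocks x (inner_vertices K) (boundary_components K) (vertices K)"
proof
  show "finite (inner_vertices K)"
    using finite_subset[OF _ finite_cells[OF K(1)]] by (auto simp: inner_vertices_def vertices_def)
  show "vertices K \<subseteq> inner_vertices K \<union> \<Union> (boundary_components K)"
    unfolding inner_vertices_def using boundary_components_cover[of _ K] by blast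
  show "inner_vertices K \<inter> k = {}" if "k \<in> boundary_components K" for k
    using boundary_component_subset[OF that] by (auto simp: inner_vertices_def)
  show "finite (boundary_components K)" by (rule finite_boundary_components[OF K(1)])
  show "inner_vertices K \<subseteq> vertices K" by (auto simp: inner_vertices_def)
  show "k = k'" if "k \<in> boundary_components K" "k' \<in> boundary_components K" "v \<in> k" "v \<in> k'" for k k' v
    using boundary_components_disjoint that .
  show "z a = 0" if "k \<in> boundary_components K" "\<And>v. v \<in> vertices K \<inter> k \<Longrightarrow> motion_field z (x v) = 0" for k z a
    using boundary_component_rigid[OF K] that .
qed

lemma motion_blocks_surface:
  assumes "finite (vertices K)"
  shows "motion_blocks x (vertices K \<inter> \<Gamma>) {} (vertices K \<inter> \<Gamma>)"
  by unfold_locales (use assms in auto)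

lemma card_mrc_manifold:
  assumes K: "simplicial_poset3 K" "tetrahedra_oriented K" "nondegenerate K x"
    and Q: "mrc_manifold K x Q" and R: "admissible_rows K x R"
  shows "card Q + 6 = card (basis K)"
proof -
  interpret motion_blocks x "inner_vertices K" "boundary_components K" "vertices K"
    by (rule motion_blocks_manifold[OF K])
  have Q': "Q \<subseteq> inner_edges K" "rigid_manifold K x Q" "\<And>Q'. Q' \<subset> Q \<Longrightarrow> \<not> rigid_manifold K x Q'"
    using Q by (auto simp: mrc_manifold_def)
  show ?thesis unfolding basis_eq
  proof (rule rigid_constraints_card[OF K(1)])
    show "finite Q"
      using finite_subset[OF _ finite_cells[OF K(1)]] Q'(1) by (auto simp: inner_edges_def edges_def)
    show "Q \<subseteq> edges K" using Q'(1) by (auto simp: inner_edges_def)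
    show "R \<subseteq> motion_basis (inner_vertices K) (boundary_components K)" "minor (f1 x) R UNIV \<noteq> 0"
      using R by (simp_all add: admissible_rows_def basis_eq)
    show "moves_as_whole x u (vertices K)"
      if "\<And>k. k \<in> boundary_components K \<Longrightarrow> moves_as_whole x u (vertices K \<inter> k)"
        "\<And>e. e \<in> Q \<Longrightarrow> length_change K x u e = 0" for u
      using Q'(2) that by (auto simp: rigid_manifold_def)
    show "\<exists>u. (\<forall>k\<in>boundary_components K. moves_as_whole x u (vertices K \<inter> k)) \<and>
        (\<forall>e\<in>Q - {e0}. length_change K x u e = 0) \<and> \<not> moves_as_whole x u (vertices K)" if "e0 \<in> Q" for e0
      using Q'(3)[of "Q - {e0}"] that unfolding rigid_manifold_def by blast
  qed (use verts_subset(1)[OF K(1)] in auto)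
qed

lemma card_mrc_surface:
  assumes K: "simplicial_poset3 K" and \<Gamma>: "\<Gamma> \<in> boundary_components K"
    and Q: "mrc_surface K x \<Gamma> Q"
    and R: "R \<subseteq> surface_basis K \<Gamma>" "minor (f1 x) R UNIV \<noteq> 0"
  shows "card Q + 6 = card (surface_basis K \<Gamma>)"
proof -
  have fin: "finite (vertices K)"
    using finite_subset[OF _ finite_cells[OF K]] by (auto simp: vertices_def)
  interpret motion_blocks x "vertices K \<inter> \<Gamma>" "{}" "vertices K \<inter> \<Gamma>"
    by (rule motion_blocks_surface[OF fin])
  have Q': "Q \<subseteq> edges K \<inter> \<Gamma>" "rigid_surface K x \<Gamma> Q"
    and min: "\<And>Q'. Q' \<subseteq> edges K \<inter> \<Gamma> \<Longrightarrow> rigid_surface K x \<Gamma> Q' \<Longrightarrow> card Q \<le> card Q'"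
    using Q by (auto simp: mrc_surface_def)
  have finQ: "finite Q"
    using finite_subset[OF _ finite_cells[OF K]] Q'(1) by (auto simp: edges_def)
  show ?thesis unfolding surface_basis_eq
  proof (rule rigid_constraints_card[OF K finQ])
    show "Q \<subseteq> edges K" using Q'(1) by auto
    show "verts K e \<subseteq> vertices K \<inter> \<Gamma>" if "e \<in> Q" for e
      using boundary_component_face[OF K \<Gamma>, of e] that Q'(1) by (auto simp: verts_def)
    show "R \<subseteq> motion_basis (vertices K \<inter> \<Gamma>) {}" "minor (f1 x) R UNIV \<noteq> 0"
      using R by (simp_all add: surface_basis_eq)
    show "moves_as_whole x u (vertices K \<inter> \<Gamma>)"
      if "\<And>e. e \<in> Q \<Longrightarrow> length_change K x u e = 0" for u
      using Q'(2) that by (auto simp: rigid_surface_def)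
    show "\<exists>u. (\<forall>k\<in>{}. moves_as_whole x u (vertices K \<inter> \<Gamma> \<inter> k)) \<and>
        (\<forall>e\<in>Q - {e0}. length_change K x u e = 0) \<and> \<not> moves_as_whole x u (vertices K \<inter> \<Gamma>)" if "e0 \<in> Q" for e0
    proof -
      have "card (Q - {e0}) < card Q" using that finQ by (rule card_Diff1_less[rotated])
      then have "\<not> rigid_surface K x \<Gamma> (Q - {e0})" using min[of "Q - {e0}"] Q'(1) by auto
      then show ?thesis unfolding rigid_surface_def by blast
    qed
  qed
qed

section \<open>Dihedral angles and their derivatives\<close>

lemma ends_doubleton:
  assumes "u \<noteq> v" "ends {u, v} = (p, q)"
  shows "(p = u \<and> q = v) \<or> (p = v \<and> q = u)"
proof -
  define xs where "xs = enum_set {u, v}"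
  have xs: "distinct xs" "set xs = {u, v}" "length xs = 2"
    using assms(1) enum_set[of "{u, v}"] by (auto simp: xs_def)
  then obtain a b where "xs = [a, b]" by (auto simp: length_Suc_conv numeral_2_eq_2)
  moreover from this have "a = p" "b = q" using assms(2) by (simp_all add: ends_def flip: xs_def)
  ultimately show ?thesis using xs by (auto simp: doubleton_eq_iff)
qed

lemma edge_length_verts:
  assumes "u \<noteq> v" "verts K e = {u, v}"
  shows "edge_length K x e = dist (x u) (x v)"
proof -
  obtain p q where pq: "ends {u, v} = (p, q)" by fastforce
  show ?thesis using ends_doubleton[OF assms(1) pq] by (auto simp: edge_length_def assms(2) pq dist_commute)
qed

text \<open>With \<open>P = B \<times> C\<close> and \<open>Q = B \<times> D\<close>, the left side is
  \<open>\<bar>P\<bar>\<^sup>2 \<bar>Q\<bar>\<^sup>2 - (P \<bullet> Q)\<^sup>2 = \<bar>P \<times> Q\<bar>\<^sup>2\<close>, and \<open>P \<times> Q\<close> is the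
  multiple of \<open>B\<close> by the triple product.\<close>

lemma six_volume_gram:
  fixes a b c d :: "real^3"
  defines "B \<equiv> b - a" and "C \<equiv> c - a" and "D \<equiv> d - a"
  shows "((B \<bullet> B) * (C \<bullet> C) - (B \<bullet> C)\<^sup>2) * ((B \<bullet> B) * (D \<bullet> D) - (B \<bullet> D)\<^sup>2) -
    ((B \<bullet> B) * (C \<bullet> D) - (B \<bullet> C) * (B \<bullet> D))\<^sup>2 = (B \<bullet> B) * (six_volume a b c d)\<^sup>2"
proof -
  have cross: "cross3 (cross3 B C) (cross3 B D) = six_volume a b c d *\<^sub>R B"
    unfolding six_volume_def B_def[symmetric] C_def[symmetric] D_def[symmetric]
    by (simp add: Finite_Cartesian_Product.vec_eq_iff forall_3 cross3_def inner_vec_def sum_3 algebra_simps)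
  have dot: "cross3 B X \<bullet> cross3 B Y = (B \<bullet> B) * (X \<bullet> Y) - (B \<bullet> X) * (B \<bullet> Y)" for X Y
    by (simp add: dot_cross inner_commute mult.commute)
  have "cross3 P Q \<bullet> cross3 P Q = (P \<bullet> P) * (Q \<bullet> Q) - (P \<bullet> Q)\<^sup>2" for P Q
    by (simp add: dot_cross inner_commute power2_eq_square)
  from this[of "cross3 B C" "cross3 B D"] show ?thesis
    unfolding cross dot by (simp add: power2_eq_square mult_ac)
qed

text \<open>By \<open>six_volume_gram\<close>, nonzero volume keeps the argument of \<open>arccos\<close> strictly
  between \<open>-1\<close> and \<open>1\<close> and the radicand positive. Differentiability is needed because \<open>deriv\<close> is
  additive only on differentiable functions.\<close>

lemma dihedral_angle_differentiable:
  fixes l :: "real \<Rightarrow> 'v \<Rightarrow> 'v \<Rightarrow> real" and p :: "'v \<Rightarrow> real^3"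
  assumes diff: "\<And>u v. (\<lambda>s. l s u v) field_differentiable at s0"
    and dist: "\<And>u v. u \<in> {a, b, c, d} \<Longrightarrow> v \<in> {a, b, c, d} \<Longrightarrow> u \<noteq> v \<Longrightarrow> l s0 u v = dist (p u) (p v)"
    and "distinct [a, b, c, d]"
    and nz: "six_volume (p a) (p b) (p c) (p d) \<noteq> 0"
  shows "(\<lambda>s. dihedral_angle (l s) a b c d) field_differentiable at s0"
proof -
  define g where "g s u v = ((l s a u)\<^sup>2 + (l s a v)\<^sup>2 - (l s u v)\<^sup>2) / 2" for s u v
  define N where "N s = (l s a b)\<^sup>2 * g s c d - g s b c * g s b d" for s
  define D where "D s = ((l s a b)\<^sup>2 * (l s a c)\<^sup>2 - (g s b c)\<^sup>2) * ((l s a b)\<^sup>2 * (l s a d)\<^sup>2 - (g s b d)\<^sup>2)" for s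
  have eq: "dihedral_angle (l s) a b c d = arccos (N s / sqrt (D s))" for s
    by (simp add: dihedral_angle_def N_def D_def g_def Let_def)
  have fd_sq: "(\<lambda>s. (l s u v)\<^sup>2) field_differentiable at s0" for u v
    unfolding power2_eq_square by (intro field_differentiable_mult diff)
  have fd_g: "(\<lambda>s. g s u v) field_differentiable at s0" for u v
    unfolding g_def by (intro field_differentiable_divide field_differentiable_add field_differentiable_diff fd_sq) auto
  have fd_N: "N field_differentiable at s0"
    unfolding N_def[abs_def] by (intro field_differentiable_diff field_differentiable_mult fd_sq fd_g)
  have fd_D: "D field_differentiable at s0"
    unfolding D_def[abs_def] power2_eq_square[of "g _ _ _"]
    by (intro field_differentiable_diff field_differentiable_mult fd_sq fd_g)
  let ?B = "p b - p a" and ?C = "p c - p a" and ?D = "p d - p a"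
  have sq: "(l s0 a u)\<^sup>2 = (p u - p a) \<bullet> (p u - p a)" if "u \<in> {b, c, d}" for u
    using that assms(3) dist[of a u]
    by (auto simp: dist_norm power2_norm_eq_inner inner_diff inner_commute algebra_simps)
  have polar: "g s0 u v = (p u - p a) \<bullet> (p v - p a)" if "u \<in> {b, c, d}" "v \<in> {b, c, d}" "u \<noteq> v" for u v
    unfolding g_def sq[OF that(1)] sq[OF that(2)] using that dist[of u v]
    by (simp add: dist_norm power2_norm_eq_inner inner_diff inner_commute field_simps)
  have ne: "b \<noteq> c" "b \<noteq> d" "c \<noteq> d" using assms(3) by auto
  have "D s0 - (N s0)\<^sup>2 = (?B \<bullet> ?B) * (six_volume (p a) (p b) (p c) (p d))\<^sup>2"
    unfolding six_volume_gram[symmetric] D_def N_def using ne by (simp add: sq polar)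
  moreover have "?B \<noteq> 0" using nz by (auto simp: six_volume_def)
  ultimately have less: "(N s0)\<^sup>2 < D s0" using nz by (smt (verit) inner_gt_zero_iff mult_pos_pos zero_less_power2)
  then have D0: "0 < D s0" by (smt (verit) zero_le_power2)
  have "\<bar>N s0\<bar> < sqrt (D s0)" using less by (rule real_less_rsqrt[of "\<bar>N s0\<bar>", simplified])
  then have "\<bar>N s0 / sqrt (D s0)\<bar> < 1" using D0 by simp
  then have arg: "-1 < N s0 / sqrt (D s0)" "N s0 / sqrt (D s0) < 1" unfolding abs_less_iff by linarith+
  have "sqrt field_differentiable at (D s0)"
    using DERIV_real_sqrt[OF D0] by (auto simp: field_differentiable_def)
  from field_differentiable_compose[OF fd_D this] have "(\<lambda>s. sqrt (D s)) field_differentiable at s0"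
    by (simp add: o_def)
  then have "(\<lambda>s. N s / sqrt (D s)) field_differentiable at s0"
    using fd_N D0 by (intro field_differentiable_divide) auto
  moreover have "arccos field_differentiable at (N s0 / sqrt (D s0))"
    using DERIV_arccos[OF arg] by (auto simp: field_differentiable_def)
  ultimately have "(arccos \<circ> (\<lambda>s. N s / sqrt (D s))) field_differentiable at s0"
    by (rule field_differentiable_compose)
  then show ?thesis by (simp add: eq o_def)
qed

context
  fixes K :: "'c triangulation"
  assumes poset: "simplicial_poset3 K"
begin

lemma edge_between:
  assumes "t \<in> tetrahedra K" "u \<in> verts K t" "v \<in> verts K t"
  shows "(edge_between K t u v, t) \<in> face K" "verts K (edge_between K t u v) = {u, v}"
proof -
  obtain e where e: "(e, t) \<in> face K" "verts K e = {u, v}"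
    using face_with_verts_exists[OF poset, of t "{u, v}"] assms by (auto simp: tetrahedra_def)
  have "(edge_between K t u v, t) \<in> face K \<and> verts K (edge_between K t u v) = {u, v}"
    unfolding edge_between_def
  proof (rule theI[of _ e])
    show "e' = e" if "(e', t) \<in> face K \<and> verts K e' = {u, v}" for e'
      using face_with_verts_unique[OF poset, of e' t e] that e by simp
  qed (use e in simp)
  then show "(edge_between K t u v, t) \<in> face K" "verts K (edge_between K t u v) = {u, v}" by auto
qed

lemma edge_in_tetrahedron:
  assumes "t \<in> tetrahedra K" "e \<in> edges K" "(e, t) \<in> face K"
  obtains a b c d where "ends (verts K e) = (a, b)" "ends (verts K t - verts K e) = (c, d)"
    "distinct [a, b, c, d]" "verts K t = {a, b, c, d}"
proof -
  obtain a b where ab: "a \<noteq> b" "verts K e = {a, b}" "ends (verts K e) = (a, b)"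
    using edge_verts[OF poset assms(2)] by metis
  have sub: "verts K e \<subseteq> verts K t" using verts_mono[OF poset assms(3)] .
  have "card (verts K t - verts K e) = 2"
    using assms sub finite_verts[OF poset] by (simp add: card_Diff_subset edges_def tetrahedra_def)
  then obtain u v where uv: "verts K t - verts K e = {u, v}" "u \<noteq> v" by (auto simp: card_2_iff)
  obtain c d where cd: "ends {u, v} = (c, d)" by fastforce
  show ?thesis
    by (rule that[of a b c d]) (use ab uv cd sub ends_doubleton[OF uv(2) cd] in auto)
qed

lemma angle_in_cong:
  assumes "t \<in> tetrahedra K" "e \<in> edges K" "(e, t) \<in> face K"
    and l: "\<And>f. f \<in> cells K \<Longrightarrow> l f = l' f"
  shows "angle_in K l t e = angle_in K l' t e"
proof -
  obtain a b c d where abcd: "ends (verts K e) = (a, b)" "ends (verts K t - verts K e) = (c, d)"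
    "verts K t = {a, b, c, d}"
    using edge_in_tetrahedron[OF assms(1-3)] by metis
  have "l (edge_between K t u v) = l' (edge_between K t u v)" if "u \<in> {a, b, c, d}" "v \<in> {a, b, c, d}" for u v
    using edge_between(1)[OF assms(1)] that abcd(3) face_cells[OF poset] l by metis
  then show ?thesis by (simp add: angle_in_def abcd(1,2) dihedral_angle_def)
qed

lemma angle_in_differentiable:
  assumes x: "tetrahedra_oriented K" "nondegenerate K x"
    and t: "t \<in> tetrahedra K" "e \<in> edges K" "(e, t) \<in> face K"
  shows "(\<lambda>s. angle_in K ((edge_length K x)(j := s)) t e) field_differentiable at (edge_length K x j)"
proof -
  obtain a b c d where abcd: "ends (verts K e) = (a, b)" "ends (verts K t - verts K e) = (c, d)"
    "distinct [a, b, c, d]" "verts K t = {a, b, c, d}"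
    using edge_in_tetrahedron[OF t] by metis
  let ?l = "\<lambda>s u v. ((edge_length K x)(j := s)) (edge_between K t u v)"
  have "(\<lambda>s. dihedral_angle (?l s) a b c d) field_differentiable at (edge_length K x j)"
  proof (rule dihedral_angle_differentiable[where p = x])
    show "(\<lambda>s. ?l s u v) field_differentiable at (edge_length K x j)" for u v
      by (cases "edge_between K t u v = j") (simp_all add: field_differentiable_ident)
    show "?l (edge_length K x j) u v = dist (x u) (x v)"
      if "u \<in> {a, b, c, d}" "v \<in> {a, b, c, d}" "u \<noteq> v" for u v
      using edge_length_verts[OF that(3) edge_between(2)[OF t(1)]] that abcd(4) by simp
    show "six_volume (x a) (x b) (x c) (x d) \<noteq> 0"
      by (rule tetrahedron_six_volume_nonzero[OF x t(1) abcd(3,4)])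
  qed (fact abcd(3))
  then show ?thesis by (simp add: angle_in_def abcd(1,2))
qed

lemma f3_eq:
  assumes x: "tetrahedra_oriented K" "nondegenerate K x" and i: "i \<in> edges K"
  shows "f3 K x i j = - (\<Sum>t | t \<in> tetrahedra K \<and> (i, t) \<in> face K. sgn (volume K x t) *
    deriv (\<lambda>s. angle_in K ((edge_length K x)(j := s)) t i) (edge_length K x j))"
proof -
  let ?T = "{t. t \<in> tetrahedra K \<and> (i, t) \<in> face K}"
  let ?\<theta> = "\<lambda>t s. angle_in K ((edge_length K x)(j := s)) t i"
  have "finite ?T" using finite_subset[OF _ finite_cells[OF poset]] by (auto simp: tetrahedra_def)
  have "(?\<theta> t has_field_derivative deriv (?\<theta> t) (edge_length K x j)) (at (edge_length K x j))" if "t \<in> ?T" for t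
    using angle_in_differentiable[OF x _ i, of t j] that
    by (simp add: DERIV_deriv_iff_field_differentiable)
  then have "((\<lambda>s. (if i \<in> boundary_cells K then 0 else 2 * pi) - (\<Sum>t\<in>?T. sgn (volume K x t) * ?\<theta> t s))
      has_field_derivative 0 - (\<Sum>t\<in>?T. sgn (volume K x t) * deriv (?\<theta> t) (edge_length K x j)))
      (at (edge_length K x j))"
    by (intro DERIV_diff DERIV_const DERIV_sum DERIV_cmult)
  then show ?thesis by (simp add: f3_def curvature_def DERIV_imp_deriv)
qed

end

context gluing begin

lemma edge_length_M1: "e \<in> cells M1 \<Longrightarrow> edge_length M x e = edge_length M1 x e"
  by (simp add: edge_length_def verts_M1)

lemma length_change_M1: "e \<in> cells M1 \<Longrightarrow> length_change M x u e = length_change M1 x u e"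
  by (simp add: length_change_def verts_M1)

lemma volume_M1: "t \<in> tetrahedra M1 \<Longrightarrow> volume M x t = volume M1 x t"
  by (simp add: volume_def orient1)

lemma angle_in_M1:
  assumes "t \<in> tetrahedra M1" "(e, t) \<in> face M1"
  shows "angle_in M l t e = angle_in M1 l t e"
proof -
  have t: "t \<in> cells M1" using assms by (auto simp: tetrahedra_def)
  have "(e', t) \<in> face M \<and> verts M e' = S \<longleftrightarrow> (e', t) \<in> face M1 \<and> verts M1 e' = S" for e' S
    using face_M1[OF t] face_cells[OF poset1, of e' t] verts_M1[of e'] by auto
  then have "edge_between M t u v = edge_between M1 t u v" for u v
    by (simp add: edge_between_def)
  moreover have "e \<in> cells M1" using assms face_cells[OF poset1] by blast
  ultimately show ?thesis using t by (simp add: angle_in_def verts_M1)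
qed

text \<open>The tetrahedra of \<open>M1\<close> involve lengths of edges of \<open>M1\<close> only, so their angles do not
  depend on the length of an edge outside \<open>M1\<close>.\<close>

lemma f3_part1:
  assumes x: "tetrahedra_oriented M1" "nondegenerate M1 x" and i: "i \<in> edges M"
  shows "- (\<Sum>t | t \<in> tetrahedra M1 \<and> (i, t) \<in> face M1. sgn (volume M x t) *
      deriv (\<lambda>s. angle_in M ((edge_length M x)(j := s)) t i) (edge_length M x j)) =
    (if i \<in> cells M1 \<and> j \<in> cells M1 then f3 M1 x i j else 0)"
proof (cases "i \<in> cells M1")
  case True
  then have i1: "i \<in> edges M1" using i edges_M1 by blast
  have angle: "angle_in M l t i = angle_in M1 l' t i"
    if "t \<in> tetrahedra M1" "(i, t) \<in> face M1" "\<And>f. f \<in> cells M1 \<Longrightarrow> l f = l' f" for t l l'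
    using angle_in_M1[OF that(1,2)] angle_in_cong[OF poset1 that(1) i1 that(2), of l l'] that(3) by simp
  show ?thesis
  proof (cases "j \<in> cells M1")
    case j: True
    have "deriv (\<lambda>s. angle_in M ((edge_length M x)(j := s)) t i) =
        deriv (\<lambda>s. angle_in M1 ((edge_length M1 x)(j := s)) t i)"
      if "t \<in> tetrahedra M1" "(i, t) \<in> face M1" for t
      by (intro arg_cong[of _ _ deriv] ext angle that) (simp add: edge_length_M1)
    then show ?thesis
      using True j by (simp add: f3_eq[OF poset1 x i1] volume_M1 edge_length_M1)
  next
    case j: False
    have "deriv (\<lambda>s. angle_in M ((edge_length M x)(j := s)) t i) r = 0"
      if "t \<in> tetrahedra M1" "(i, t) \<in> face M1" for t r
    proof -
      have "angle_in M ((edge_length M x)(j := s)) t i = angle_in M1 (edge_length M x) t i" for s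
        by (intro angle that) (use j in auto)
      then show ?thesis by simp
    qed
    then show ?thesis using j by simp
  qed
next
  case False
  then have none: "{t. t \<in> tetrahedra M1 \<and> (i, t) \<in> face M1} = {}" using face_cells[OF poset1] by auto
  show ?thesis unfolding none using False by simp
qed

end

context gluing begin

lemmas edge_length_M2 = gluing.edge_length_M1[OF swap]
  and volume_M2 = gluing.volume_M1[OF swap]

lemma poset_M: "simplicial_poset3 M"
proof -
  have "antisym (face M)"
  proof (rule antisymI)
    fix \<sigma> \<tau> assume st: "(\<sigma>, \<tau>) \<in> face M" "(\<tau>, \<sigma>) \<in> face M"
    have anti: "antisym (face M1)" "antisym (face M2)"
      using partial_order_face[OF poset1] partial_order_face[OF poset2] by (simp_all add: partial_order_on_def)
    have "\<sigma> \<in> cells M1 \<and> \<tau> \<in> cells M1 \<or> \<sigma> \<in> cells M2 \<and> \<tau> \<in> cells M2"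
      using st(1) face_cells[OF poset1] face_cells[OF poset2] by (auto simp: face_M)
    then show "\<sigma> = \<tau>" using st face_M1 face_M2 anti by (metis antisymD)
  qed
  moreover have "trans (face M)"
  proof (rule transI)
    fix \<rho> \<sigma> \<tau> assume st: "(\<rho>, \<sigma>) \<in> face M" "(\<sigma>, \<tau>) \<in> face M"
    then have "\<tau> \<in> cells M1 \<or> \<tau> \<in> cells M2" using face_cells[OF poset1] face_cells[OF poset2] by (auto simp: face_M)
    then show "(\<rho>, \<tau>) \<in> face M"
      using st face_M1 face_M2 face_cells[OF poset1] face_cells[OF poset2] face_trans[OF poset1] face_trans[OF poset2]
      by metis
  qed
  moreover have "refl_on (Field (face M)) (face M)" "face M \<subseteq> Field (face M) \<times> Field (face M)"
    using face_refl[OF poset1] face_refl[OF poset2] cells_M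
    by (auto simp: refl_on_def face_M cells_def intro: FieldI1 FieldI2)
  ultimately have "Partial_order (face M)"
    by (simp add: partial_order_on_def preorder_on_def)
  have sub: "bij_betw (verts M) {\<tau>. (\<tau>, \<sigma>) \<in> face M} (Pow (verts M \<sigma>) - {{}}) \<and>
        (\<forall>\<rho> \<tau>. (\<rho>, \<sigma>) \<in> face M \<and> (\<tau>, \<sigma>) \<in> face M \<longrightarrow> ((\<rho>, \<tau>) \<in> face M \<longleftrightarrow> verts M \<rho> \<subseteq> verts M \<tau>))"
    if g: "gluing M N N' \<Gamma>" and s: "\<sigma> \<in> cells N" for N N' \<sigma>
  proof -
    have N: "simplicial_poset3 N" using g unfolding gluing_def by blast
    have fc: "\<tau> \<in> cells N" if "(\<tau>, \<sigma>) \<in> face N" for \<tau> using face_cells[OF N that] by simp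
    have old: "bij_betw (verts N) {\<tau>. (\<tau>, \<sigma>) \<in> face N} (Pow (verts N \<sigma>) - {{}})"
      "\<forall>\<rho> \<tau>. (\<rho>, \<sigma>) \<in> face N \<and> (\<tau>, \<sigma>) \<in> face N \<longrightarrow> ((\<rho>, \<tau>) \<in> face N \<longleftrightarrow> verts N \<rho> \<subseteq> verts N \<tau>)"
      using N s unfolding simplicial_poset3_def by blast+
    have "bij_betw (verts M) {\<tau>. (\<tau>, \<sigma>) \<in> face N} (Pow (verts N \<sigma>) - {{}})"
      using old(1) by (rule bij_betw_cong[THEN iffD1, rotated]) (use fc gluing.verts_M1[OF g] in auto)
    moreover have verts: "verts M \<tau> = verts N \<tau>" if "\<tau> \<in> cells N" for \<tau>
      using gluing.verts_M1[OF g that] .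
    moreover have face: "(\<rho>, \<tau>) \<in> face M \<longleftrightarrow> (\<rho>, \<tau>) \<in> face N" if "\<tau> \<in> cells N" for \<rho> \<tau>
      using gluing.face_M1[OF g that] .
    moreover have "(\<rho>, \<tau>) \<in> face M \<longleftrightarrow> verts M \<rho> \<subseteq> verts M \<tau>"
      if faces: "(\<rho>, \<sigma>) \<in> face M" "(\<tau>, \<sigma>) \<in> face M" for \<rho> \<tau>
    proof -
      have "(\<rho>, \<sigma>) \<in> face N" "(\<tau>, \<sigma>) \<in> face N" using faces face[OF s] by auto
      then have "(\<rho>, \<tau>) \<in> face N \<longleftrightarrow> verts N \<rho> \<subseteq> verts N \<tau>" "\<rho> \<in> cells N" "\<tau> \<in> cells N"
        using old(2) fc by blast+
      then show ?thesis using face verts by simp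
    qed
    ultimately show ?thesis using s by simp
  qed
  have cells: "\<forall>\<sigma>\<in>cells M. bij_betw (verts M) {\<tau>. (\<tau>, \<sigma>) \<in> face M} (Pow (verts M \<sigma>) - {{}}) \<and>
        (\<forall>\<rho> \<tau>. (\<rho>, \<sigma>) \<in> face M \<and> (\<tau>, \<sigma>) \<in> face M \<longrightarrow> ((\<rho>, \<tau>) \<in> face M \<longleftrightarrow> verts M \<rho> \<subseteq> verts M \<tau>))"
    using sub[OF gluing_axioms] sub[OF swap] unfolding cells_M by blast
  have tetrahedra: "\<forall>\<sigma>\<in>cells M. \<exists>t\<in>tetrahedra M. (\<sigma>, t) \<in> face M"
    using cell_in_tetrahedron[OF poset1] cell_in_tetrahedron[OF poset2]
    unfolding cells_M tetrahedra_M face_M by (metis Un_iff)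
  have "finite (cells M)" using finite_cells[OF poset1] finite_cells[OF poset2] by (simp add: cells_M)
  then show ?thesis
    unfolding simplicial_poset3_def using \<open>Partial_order (face M)\<close> cells tetrahedra by blast
qed

lemma tetrahedra_oriented_M:
  assumes "tetrahedra_oriented M1" "tetrahedra_oriented M2"
  shows "tetrahedra_oriented M"
  unfolding tetrahedra_oriented_def
proof
  fix t assume "t \<in> tetrahedra M"
  then consider "t \<in> tetrahedra M1" | "t \<in> tetrahedra M2" unfolding tetrahedra_M(1) by blast
  then show "distinct (orient M t) \<and> set (orient M t) = verts M t"
  proof cases
    case 1
    then have "verts M t = verts M1 t" using verts_M1[of t] by (simp add: tetrahedra_def)
    then show ?thesis using 1 assms(1) orient1 by (simp add: tetrahedra_oriented_def)
  next
    case 2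
    then have "verts M t = verts M2 t" using verts_M2[of t] by (simp add: tetrahedra_def)
    then show ?thesis using 2 assms(2) orient2 by (simp add: tetrahedra_oriented_def)
  qed
qed

lemma nondegenerate_M:
  assumes "nondegenerate M1 x" "nondegenerate M2 x"
  shows "nondegenerate M x"
  using assms unfolding nondegenerate_def tetrahedra_M(1)
  by (auto simp: volume_M1 volume_M2)

end

section \<open>Torsion and the gluing formula\<close>

definition torsion_sq :: "'c triangulation \<Rightarrow> ('c \<Rightarrow> real^3) \<Rightarrow> 'c set \<Rightarrow> 'c basis_vector set \<Rightarrow> real" where
  "torsion_sq K x Q R = (minor (f1 x) R UNIV / minor (f2 K x) Q (basis K - R))\<^sup>2"

text \<open>\<open>f\<^sub>5\<close> is the transpose of \<open>f\<^sub>1\<close>, and \<open>f\<^sub>4\<close> is minus the transpose of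
  \<open>f\<^sub>2\<close>, with one sign for each edge.\<close>

lemma generating_function_eq:
  "generating_function K x B Q R = (\<lambda>U. ((-1) ^ card Q * torsion_sq K x Q R *
     ((\<Prod>t\<in>tetrahedra K. - 6 * volume K x t) / (\<Prod>e\<in>inner_edges K. (edge_length K x e)\<^sup>2))) *
     berezin_pairs (inner_edges K - Q) (gr_exp (bilinear_form (f3 K x) (edge_set K B Q))) U)"
proof -
  have f5: "minor (f5 x) UNIV R = minor (f1 x) R UNIV"
    using minor_transpose[of "f1 x" UNIV R] by (simp add: f5_def[abs_def])
  have f4: "minor (f4 K x) X Q = (-1) ^ card Q * minor (f2 K x) Q X" for X
  proof -
    have "minor (f4 K x) X Q = (-1) ^ card Q * minor (\<lambda>c e. f2 K x e c) X Q"
      unfolding f4_def[abs_def] by (rule minor_minus)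
    then show ?thesis by (simp only: minor_transpose[of "f2 K x" X Q])
  qed
  have "(a * a) / (b * ((-1) ^ n * b)) = (-1) ^ n * (a / b)\<^sup>2" for a b :: real and n :: nat
    by (cases "even n") (simp_all add: power2_eq_square)
  then show ?thesis
    unfolding generating_function_def f4 f5 torsion_sq_def by simp
qed

text \<open>If one of the minors of \<open>f2\<close> vanishes, then by \<open>minor_sq_exchange\<close> so does the
  other one, and both sides are zero.\<close>

lemma (in motion_blocks) torsion_sq_independent:
  assumes K: "simplicial_poset3 K" and Q: "Q \<subseteq> edges K" "\<And>e. e \<in> Q \<Longrightarrow> verts K e \<subseteq> V"
    and card: "card Q + 6 = card (motion_basis F C)"
    and R: "R \<subseteq> motion_basis F C" "card R = 6" "minor (f1 x) R UNIV \<noteq> 0"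
    and R': "R' \<subseteq> motion_basis F C" "card R' = 6" "minor (f1 x) R' UNIV \<noteq> 0"
  shows "(minor (f1 x) R UNIV / minor (f2 K x) Q (motion_basis F C - R))\<^sup>2 =
    (minor (f1 x) R' UNIV / minor (f2 K x) Q (motion_basis F C - R'))\<^sup>2"
proof -
  let ?X = "motion_basis F C"
  let ?a = "minor (f1 x) R UNIV" and ?b = "minor (f2 K x) Q (?X - R)"
  let ?a' = "minor (f1 x) R' UNIV" and ?b' = "minor (f2 K x) Q (?X - R')"
  have finQ: "finite Q"
    using finite_subset[OF Q(1)] finite_cells[OF K] by (auto simp: edges_def)
  have "(?a * ?b')\<^sup>2 = (?a' * ?b)\<^sup>2"
  proof (rule minor_sq_exchange[OF finX finite_motion finQ])
    show "(\<Sum>c\<in>?X. f2 K x e c * f1 x c a) = 0" if "e \<in> Q" for e a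
      using f2_f1[OF K _ Q(2)[OF that]] Q(1) that by blast
  qed (use R R' card in \<open>simp_all add: card_motion\<close>)
  then have eq: "?a\<^sup>2 * ?b'\<^sup>2 = ?a'\<^sup>2 * ?b\<^sup>2" by (simp add: power_mult_distrib)
  show ?thesis
  proof (cases "?b = 0")
    case True
    then have "?b' = 0" using eq R(3) by simp
    then show ?thesis using True by simp
  next
    case False
    then have "?b' \<noteq> 0" using eq R'(3) by auto
    then show ?thesis using False eq by (simp add: power_divide divide_simps mult_ac)
  qed
qed

lemma minor_f1_sways: "(minor (f1 x) (motion_basis {} {k}) UNIV)\<^sup>2 = 1"
proof -
  have "motion_basis {} {k} = Sway k ` UNIV" by (auto simp: motion_basis_def)
  moreover have "(minor (f1 x) (Sway k ` UNIV) (id ` UNIV))\<^sup>2 = 1"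
    by (subst minor_sq_image) (simp_all add: finite_motion inj_on_def minor_delta)
  ultimately show ?thesis by simp
qed

text \<open>On the components of the sway of \<open>k\<close>, \<open>f1\<close> is the identity.\<close>

lemma torsion_sq_sways:
  assumes K: "simplicial_poset3 K" "tetrahedra_oriented K" "nondegenerate K x"
    and Q: "mrc_manifold K x Q" and R: "admissible_rows K x R" and k: "k \<in> boundary_components K"
  defines "X \<equiv> motion_basis (inner_vertices K) (boundary_components K - {k})"
  shows "card Q = card X" "torsion_sq K x Q R = 1 / (minor (f2 K x) Q X)\<^sup>2"
proof -
  interpret motion_blocks x "inner_vertices K" "boundary_components K" "vertices K"
    by (rule motion_blocks_manifold[OF K])
  let ?S = "motion_basis {} {k}"
  have X: "basis K - ?S = X" unfolding basis_eq X_def by (auto simp: motion_basis_def)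
  have S: "?S \<subseteq> basis K" "card ?S = 6"
    using k card_motion_basis[of "{}" "{k}"] by (auto simp: basis_eq motion_basis_def)
  have card: "card Q + 6 = card (basis K)" by (rule card_mrc_manifold[OF K Q R])
  then show "card Q = card X"
    using S finX by (simp flip: X add: card_Diff_subset finite_subset basis_eq)
  have "minor (f1 x) ?S UNIV \<noteq> 0" using minor_f1_sways[of x k] by auto
  then have "torsion_sq K x Q R = (minor (f1 x) ?S UNIV / minor (f2 K x) Q (basis K - ?S))\<^sup>2"
    unfolding torsion_sq_def basis_eq
    using R S Q card verts_subset(1)[OF K(1)]
    by (intro torsion_sq_independent[OF K(1)])
      (auto simp: admissible_rows_def basis_eq mrc_manifold_def inner_edges_def)
  then show "torsion_sq K x Q R = 1 / (minor (f2 K x) Q X)\<^sup>2"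
    by (simp add: X power_divide minor_f1_sways)
qed

context gluing begin

text \<open>Displacing vertices strictly inside \<open>M1\<close>, or swaying its other boundary components,
  does not move any vertex of \<open>M2\<close>.\<close>

lemma f2_M_other_side:
  assumes e: "e \<in> edges M" "e \<in> cells M2"
    and c: "c \<in> motion_basis (inner_vertices M1) (boundary_components M1 - {\<Gamma>})"
  shows "f2 M x e c = 0"
  unfolding f2_def
proof (rule length_change_zero[OF poset_M e(1)])
  fix v assume "v \<in> verts M e"
  then have "v \<in> cells M2"
    using verts_M2[OF e(2)] verts_subset[OF poset2] by blast
  consider w i where "c = Coord w i" "w \<in> inner_vertices M1"
    | k a where "c = Sway k a" "k \<in> boundary_components M1" "k \<noteq> \<Gamma>"
    using c by (auto simp: motion_basis_def)
  then show "basis_displacement x c v = 0"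
  proof cases
    case 1
    then show ?thesis using \<open>v \<in> cells M2\<close> inner1_not_M2(1) by auto
  next
    case 2
    then show ?thesis using \<open>v \<in> cells M2\<close> component1_disjoint(2)[of k] by auto
  qed
qed

lemma f2_M1: "e \<in> cells M1 \<Longrightarrow> f2 M x e c = f2 M1 x e c"
  by (simp add: f2_def length_change_M1)

lemma finite_parts: "finite (inner_vertices M1)" "finite (boundary_components M1 - {\<Gamma>})" "finite (vertices M \<inter> \<Gamma>)"
proof -
  have "finite (cells M)" using finite_cells[OF poset_M] .
  then show "finite (vertices M \<inter> \<Gamma>)" by (rule finite_subset[rotated]) (auto simp: vertices_def)
  show "finite (inner_vertices M1)"
    using finite_cells[OF poset1] by (rule finite_subset[rotated]) (auto simp: inner_vertices_def vertices_def)
  show "finite (boundary_components M1 - {\<Gamma>})" using finite_boundary_components[OF poset1] by simp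
qed

text \<open>Edges of \<open>\<Gamma>\<close> change only with vertices of \<open>\<Gamma>\<close>, edges of \<open>Q1\<close> do not change
  with the vertices inside \<open>M2\<close>, and conversely: the matrix is block triangular with three square blocks on
  the diagonal.\<close>

lemma minor_f2_M:
  fixes x :: "'c \<Rightarrow> real^3" and Q1 Q2 B\<Gamma> :: "'c set" and R\<Gamma> :: "'c basis_vector set"
  defines "X1 \<equiv> motion_basis (inner_vertices M1) (boundary_components M1 - {\<Gamma>})"
    and "X2 \<equiv> motion_basis (inner_vertices M2) (boundary_components M2 - {\<Gamma>})"
  assumes Q: "Q1 \<subseteq> inner_edges M1" "Q2 \<subseteq> inner_edges M2" "B\<Gamma> \<subseteq> edges M \<inter> \<Gamma>"
    and R\<Gamma>: "R\<Gamma> \<subseteq> surface_basis M \<Gamma>" "card R\<Gamma> = 6"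
    and card: "card Q1 = card X1" "card Q2 = card X2" "card B\<Gamma> + 6 = card (surface_basis M \<Gamma>)"
  shows "card (Q1 \<union> Q2 \<union> B\<Gamma>) = card Q1 + card Q2 + card B\<Gamma>"
    and "card (Q1 \<union> Q2 \<union> B\<Gamma>) + 6 = card (basis M)"
    and "R\<Gamma> \<subseteq> basis M"
    and "(minor (f2 M x) (Q1 \<union> Q2 \<union> B\<Gamma>) (basis M - R\<Gamma>))\<^sup>2 =
      (minor (f2 M x) B\<Gamma> (surface_basis M \<Gamma> - R\<Gamma>))\<^sup>2 *
      ((minor (f2 M1 x) Q1 X1)\<^sup>2 * (minor (f2 M2 x) Q2 X2)\<^sup>2)"
proof -
  let ?S = "surface_basis M \<Gamma>"
  have finX: "finite X1" "finite X2" "finite ?S"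
    unfolding X1_def X2_def surface_basis_eq
    using finite_parts gluing.finite_parts[OF swap] by (auto intro!: finite_motion_basis)
  have QM: "Q1 \<subseteq> edges M" "Q2 \<subseteq> edges M" "B\<Gamma> \<subseteq> edges M"
    using Q by (auto simp: inner_edges_def edges_M)
  have finQ: "finite Q1" "finite Q2" "finite B\<Gamma>"
    using QM finite_cells[OF poset_M] by (auto intro: finite_subset simp: edges_def)
  have cQ: "Q1 \<subseteq> cells M1 - cells M2" "Q2 \<subseteq> cells M2 - cells M1" "B\<Gamma> \<subseteq> cells M1 \<inter> cells M2"
    using Q inner1_not_M2(2) inner2_not_M1(2) inter by auto
  then have disjQ: "Q1 \<inter> Q2 = {}" "B\<Gamma> \<inter> (Q1 \<union> Q2) = {}" by auto
  have disjV: "inner_vertices M1 \<inter> inner_vertices M2 = {}"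
    "(vertices M \<inter> \<Gamma>) \<inter> (inner_vertices M1 \<union> inner_vertices M2) = {}"
    using inner1_not_M2(1) inner2_not_M1(1) inter by blast+
  have disjC: "(boundary_components M1 - {\<Gamma>}) \<inter> (boundary_components M2 - {\<Gamma>}) = {}"
    using component1_disjoint(3) by blast
  have disjX: "X1 \<inter> X2 = {}" "?S \<inter> (X1 \<union> X2) = {}"
    unfolding X1_def X2_def surface_basis_eq motion_basis_Un[symmetric]
    by (rule motion_basis_disjoint; use disjV disjC in blast)+
  have basis: "basis M = ?S \<union> (X1 \<union> X2)"
    unfolding X1_def X2_def surface_basis_eq motion_basis_Un[symmetric] basis_eq
      inner_vertices_M boundary_components_M
    by (rule arg_cong2[of _ _ _ _ motion_basis]) auto
  have Qeq: "Q1 \<union> Q2 \<union> B\<Gamma> = B\<Gamma> \<union> (Q1 \<union> Q2)" by auto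
  show cardQ: "card (Q1 \<union> Q2 \<union> B\<Gamma>) = card Q1 + card Q2 + card B\<Gamma>"
    unfolding Qeq using disjQ finQ by (simp add: card_Un_disjoint)
  have "card (basis M) = card ?S + (card X1 + card X2)"
    unfolding basis using disjX finX by (simp add: card_Un_disjoint)
  then show "card (Q1 \<union> Q2 \<union> B\<Gamma>) + 6 = card (basis M)" using cardQ card by simp
  show "R\<Gamma> \<subseteq> basis M" using R\<Gamma> basis by auto
  have basis': "basis M - R\<Gamma> = (?S - R\<Gamma>) \<union> (X1 \<union> X2)" using basis disjX R\<Gamma> by auto
  have finR: "finite R\<Gamma>" using R\<Gamma> finX finite_subset by auto
  have "(minor (f2 M x) (B\<Gamma> \<union> (Q1 \<union> Q2)) ((?S - R\<Gamma>) \<union> (X1 \<union> X2)))\<^sup>2 =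
      (minor (f2 M x) B\<Gamma> (?S - R\<Gamma>))\<^sup>2 * (minor (f2 M x) (Q1 \<union> Q2) (X1 \<union> X2))\<^sup>2"
  proof (rule minor_sq_block_triangular)
    show "card B\<Gamma> = card (?S - R\<Gamma>)" using card R\<Gamma> finR by (simp add: card_Diff_subset)
    show "card (Q1 \<union> Q2) = card (X1 \<union> X2)" using card disjQ disjX finQ finX by (simp add: card_Un_disjoint)
    show "f2 M x e c = 0" if "e \<in> B\<Gamma>" "c \<in> X1 \<union> X2" for e c
      using that QM cQ f2_M_other_side[of e c] gluing.f2_M_other_side[OF swap, of e c]
      unfolding X1_def X2_def by blast
  qed (use finQ finX disjQ disjX in auto)
  also have "(minor (f2 M x) (Q1 \<union> Q2) (X1 \<union> X2))\<^sup>2 = (minor (f2 M x) Q1 X1)\<^sup>2 * (minor (f2 M x) Q2 X2)\<^sup>2"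
  proof (rule minor_sq_block_triangular)
    show "f2 M x e c = 0" if "e \<in> Q1" "c \<in> X2" for e c
      using that QM cQ gluing.f2_M_other_side[OF swap, of e c] unfolding X2_def by blast
  qed (use finQ finX disjQ disjX card in auto)
  also have "minor (f2 M x) Q1 X1 = minor (f2 M1 x) Q1 X1"
    by (rule minor_cong[OF finQ(1) finX(1)]) (use cQ f2_M1 in auto)
  also have "minor (f2 M x) Q2 X2 = minor (f2 M2 x) Q2 X2"
    by (rule minor_cong[OF finQ(2) finX(2)]) (use cQ gluing.f2_M1[OF swap] in auto)
  finally show "(minor (f2 M x) (Q1 \<union> Q2 \<union> B\<Gamma>) (basis M - R\<Gamma>))\<^sup>2 =
      (minor (f2 M x) B\<Gamma> (?S - R\<Gamma>))\<^sup>2 * ((minor (f2 M1 x) Q1 X1)\<^sup>2 * (minor (f2 M2 x) Q2 X2)\<^sup>2)"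
    unfolding Qeq basis' .
qed

lemma surface_basis_M1: "surface_basis M1 \<Gamma> = surface_basis M \<Gamma>"
  using vertices_M1 \<Gamma>_cells1 by (auto simp: surface_basis_def)

lemma torsion_sq_M:
  assumes x: "tetrahedra_oriented M1" "tetrahedra_oriented M2" "nondegenerate M1 x" "nondegenerate M2 x"
    and Q: "mrc_manifold M1 x Q1" "mrc_manifold M2 x Q2" "mrc_surface M1 x \<Gamma> B\<Gamma>"
    and R: "admissible_rows M x R" "admissible_rows M1 x R1" "admissible_rows M2 x R2"
    and R\<Gamma>: "R\<Gamma> \<subseteq> surface_basis M \<Gamma>" "card R\<Gamma> = 6" "minor (f1 x) R\<Gamma> UNIV \<noteq> 0"
  shows "(-1) ^ card (Q1 \<union> Q2 \<union> B\<Gamma>) * torsion_sq M x (Q1 \<union> Q2 \<union> B\<Gamma>) R =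
    (-1) ^ card (vertices M \<inter> \<Gamma>) * (surface_torsion M x \<Gamma> B\<Gamma> R\<Gamma>)\<^sup>2 *
    ((-1) ^ card Q1 * torsion_sq M1 x Q1 R1) * ((-1) ^ card Q2 * torsion_sq M2 x Q2 R2)"
proof -
  let ?Q = "Q1 \<union> Q2 \<union> B\<Gamma>"
  have QE: "Q1 \<subseteq> inner_edges M1" "Q2 \<subseteq> inner_edges M2" "B\<Gamma> \<subseteq> edges M \<inter> \<Gamma>"
    using Q edges_M by (auto simp: mrc_manifold_def mrc_surface_def)
  have cB: "card B\<Gamma> + 6 = card (surface_basis M \<Gamma>)"
    using card_mrc_surface[OF poset1 \<Gamma>1 Q(3)] R\<Gamma> by (simp add: surface_basis_M1)
  note side1 = torsion_sq_sways[OF poset1 x(1,3) Q(1) R(2) \<Gamma>1]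
  note side2 = torsion_sq_sways[OF poset2 x(2,4) Q(2) R(3) \<Gamma>2]
  note M = minor_f2_M[OF QE R\<Gamma>(1,2) side1(1) side2(1) cB]
  interpret motion_blocks x "inner_vertices M" "boundary_components M" "vertices M"
    by (rule motion_blocks_manifold[OF poset_M tetrahedra_oriented_M[OF x(1,2)] nondegenerate_M[OF x(3,4)]])
  have "?Q \<subseteq> edges M" using QE by (auto simp: inner_edges_def edges_M)
  then have "torsion_sq M x ?Q R = (minor (f1 x) R\<Gamma> UNIV / minor (f2 M x) ?Q (basis M - R\<Gamma>))\<^sup>2"
    unfolding torsion_sq_def basis_eq
    using R(1) R\<Gamma> M(2,3) verts_subset(1)[OF poset_M]
    by (intro torsion_sq_independent[OF poset_M]) (auto simp: admissible_rows_def basis_eq)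
  also have "\<dots> = (surface_torsion M x \<Gamma> B\<Gamma> R\<Gamma>)\<^sup>2 * torsion_sq M1 x Q1 R1 * torsion_sq M2 x Q2 R2"
    unfolding power_divide M(4) surface_torsion_def side1(2) side2(2) by simp
  finally have "torsion_sq M x ?Q R = \<dots>" .
  moreover have "(-1 :: real) ^ card B\<Gamma> = (-1) ^ card (vertices M \<inter> \<Gamma>)"
  proof -
    have "card (surface_basis M \<Gamma>) = 3 * card (vertices M \<inter> \<Gamma>)"
      unfolding surface_basis_eq by (subst card_motion_basis) (use finite_parts in auto)
    then have "card B\<Gamma> + 6 = 3 * card (vertices M \<inter> \<Gamma>)" using cB by simp
    \<comment> \<open>the number of edges and the number of vertices have the same parity, as 3 is odd and 6 is even\<close>
    then have "even (card B\<Gamma>) \<longleftrightarrow> even (card (vertices M \<inter> \<Gamma>))" by presburger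
    then show ?thesis by (simp add: minus_one_power_iff)
  qed
  ultimately show ?thesis unfolding M(1) by (simp add: power_add mult_ac)
qed

text \<open>An edge of \<open>\<Gamma>\<close> belongs either to both edge sets or to none, since both pieces use the
  same minimal rigid construction in \<open>\<Gamma>\<close>.\<close>

lemma edge_set_M1_cells:
  assumes "i \<in> edge_set M1 B Q1 \<union> edge_set M2 B Q2"
  shows "i \<in> cells M1 \<longleftrightarrow> i \<in> edge_set M1 B Q1"
proof
  assume i: "i \<in> cells M1"
  show "i \<in> edge_set M1 B Q1"
  proof (rule ccontr)
    assume "i \<notin> edge_set M1 B Q1"
    then have "i \<in> edge_set M2 B Q2" using assms by simp
    then obtain k where k: "k \<in> boundary_components M2" "i \<in> edges M2" "i \<in> k" "i \<notin> B k"
      using inner2_not_M1(2) i by (auto simp: edge_set_def)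
    then have "k = \<Gamma>" using component2_disjoint(2)[of k] i by auto
    then have "i \<in> edges M1" using k edges_M1[OF i] edges_M by blast
    then have "i \<in> edge_set M1 B Q1" using k \<open>k = \<Gamma>\<close> \<Gamma>1 by (auto simp: edge_set_def)
    then show False using \<open>i \<notin> edge_set M1 B Q1\<close> by simp
  qed
next
  assume "i \<in> edge_set M1 B Q1"
  then show "i \<in> cells M1" by (auto simp: edge_set_def inner_edges_def edges_def)
qed

lemma f3_M:
  assumes x: "tetrahedra_oriented M1" "tetrahedra_oriented M2" "nondegenerate M1 x" "nondegenerate M2 x"
    and i: "i \<in> edges M"
  shows "f3 M x i j = (if i \<in> cells M1 \<and> j \<in> cells M1 then f3 M1 x i j else 0) +
    (if i \<in> cells M2 \<and> j \<in> cells M2 then f3 M2 x i j else 0)"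
proof -
  let ?T = "\<lambda>K. {t. t \<in> tetrahedra K \<and> (i, t) \<in> face K}"
  let ?h = "\<lambda>t. sgn (volume M x t) * deriv (\<lambda>s. angle_in M ((edge_length M x)(j := s)) t i) (edge_length M x j)"
  have fin: "finite (?T M1)" "finite (?T M2)"
    using finite_cells[OF poset1] finite_cells[OF poset2] by (auto intro: finite_subset simp: tetrahedra_def)
  have "(\<Sum>t\<in>?T M. ?h t) = (\<Sum>t\<in>?T M1. ?h t) + (\<Sum>t\<in>?T M2. ?h t)"
    unfolding tetrahedra_at by (rule sum.union_disjoint[OF fin]) (use tetrahedra_M(2) in auto)
  then have "f3 M x i j = - (\<Sum>t\<in>?T M1. ?h t) + - (\<Sum>t\<in>?T M2. ?h t)"
    using f3_eq[OF poset_M tetrahedra_oriented_M[OF x(1,2)] nondegenerate_M[OF x(3,4)] i, of j] by simp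
  then show ?thesis
    unfolding f3_part1[OF x(1,3) i] gluing.f3_part1[OF swap x(2,4) i] .
qed

lemma berezin_pairs_M:
  fixes Q1 Q2 :: "'c set" and B :: "'c set \<Rightarrow> 'c set"
  assumes x: "tetrahedra_oriented M1" "tetrahedra_oriented M2" "nondegenerate M1 x" "nondegenerate M2 x"
    and Q: "Q1 \<subseteq> inner_edges M1" "Q2 \<subseteq> inner_edges M2" "B \<Gamma> \<subseteq> edges M \<inter> \<Gamma>"
  defines "Q \<equiv> Q1 \<union> Q2 \<union> B \<Gamma>"
  shows "berezin_pairs (inner_edges M - Q) (gr_exp (bilinear_form (f3 M x) (edge_set M B Q))) =
    berezin_pairs (edges M \<inter> \<Gamma> - B \<Gamma>)
      (gr_mult (berezin_pairs (inner_edges M1 - Q1) (gr_exp (bilinear_form (f3 M1 x) (edge_set M1 B Q1))))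
               (berezin_pairs (inner_edges M2 - Q2) (gr_exp (bilinear_form (f3 M2 x) (edge_set M2 B Q2)))))"
  unfolding Q_def edge_set_M[where B = B, OF Q]
proof (rule berezin_pairs_exp_glue)
  let ?E1 = "edge_set M1 B Q1" and ?E2 = "edge_set M2 B Q2"
  have sub: "?E1 \<subseteq> edges M1" "?E2 \<subseteq> edges M2" by (auto simp: edge_set_def inner_edges_def)
  then show "finite ?E1" "finite ?E2"
    using finite_cells[OF poset1] finite_cells[OF poset2] by (auto intro: finite_subset simp: edges_def)
  have cells: "?E1 \<subseteq> cells M1" "?E2 \<subseteq> cells M2" using sub by (auto simp: edges_def)
  show "inner_edges M1 - Q1 \<subseteq> ?E1 - ?E2" "inner_edges M2 - Q2 \<subseteq> ?E2 - ?E1"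
    using inner1_not_M2(2) inner2_not_M1(2) cells by (auto simp: edge_set_def)
  show "edges M \<inter> \<Gamma> - B \<Gamma> \<subseteq> ?E1 \<inter> ?E2"
  proof
    fix e assume e: "e \<in> edges M \<inter> \<Gamma> - B \<Gamma>"
    then have "e \<in> edges M1" "e \<in> edges M2"
      using edges_M1[OF \<Gamma>_cells1] edges_M2[OF \<Gamma>_cells2] by blast+
    then show "e \<in> ?E1 \<inter> ?E2" unfolding edge_set_def using e \<Gamma>1 \<Gamma>2 by blast
  qed
  show "f3 M x i j = (if i \<in> ?E1 \<and> j \<in> ?E1 then f3 M1 x i j else 0) +
      (if i \<in> ?E2 \<and> j \<in> ?E2 then f3 M2 x i j else 0)" if ij: "i \<in> ?E1 \<union> ?E2" "j \<in> ?E1 \<union> ?E2" for i j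
  proof -
    have "i \<in> edges M" using ij sub edges_M by auto
    have 1: "i \<in> cells M1 \<longleftrightarrow> i \<in> ?E1" "j \<in> cells M1 \<longleftrightarrow> j \<in> ?E1"
      using edge_set_M1_cells ij by auto
    have 2: "i \<in> cells M2 \<longleftrightarrow> i \<in> ?E2" "j \<in> cells M2 \<longleftrightarrow> j \<in> ?E2"
      using gluing.edge_set_M1_cells[OF swap, of _ B Q2 Q1] ij by auto
    show ?thesis using f3_M[OF x \<open>i \<in> edges M\<close>, of j] unfolding 1 2 .
  qed
qed

lemma prod_volume_M:
  "(\<Prod>t\<in>tetrahedra M. - 6 * volume M x t) =
    (\<Prod>t\<in>tetrahedra M1. - 6 * volume M1 x t) * (\<Prod>t\<in>tetrahedra M2. - 6 * volume M2 x t)"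
proof -
  have fin: "finite (tetrahedra M1)" "finite (tetrahedra M2)"
    using finite_cells[OF poset1] finite_cells[OF poset2] by (auto intro: finite_subset simp: tetrahedra_def)
  show ?thesis
    unfolding tetrahedra_M(1) prod.union_disjoint[OF fin tetrahedra_M(2)]
    by (simp add: volume_M1 volume_M2)
qed

lemma prod_edge_length_M:
  "(\<Prod>e\<in>inner_edges M. (edge_length M x e)\<^sup>2) =
    (\<Prod>e\<in>inner_edges M1. (edge_length M1 x e)\<^sup>2) * (\<Prod>e\<in>inner_edges M2. (edge_length M2 x e)\<^sup>2) *
    (\<Prod>e\<in>edges M \<inter> \<Gamma>. (edge_length M x e)\<^sup>2)"
proof -
  have "finite (inner_edges M)"
    using finite_cells[OF poset_M] by (rule finite_subset[rotated]) (auto simp: inner_edges_def edges_def)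
  then have fin: "finite (inner_edges M1)" "finite (inner_edges M2)" "finite (edges M \<inter> \<Gamma>)"
    unfolding inner_edges_M by auto
  have disj: "inner_edges M1 \<inter> inner_edges M2 = {}" "(inner_edges M1 \<union> inner_edges M2) \<inter> (edges M \<inter> \<Gamma>) = {}"
    using inner1_not_M2 inner2_not_M1 inter by blast+
  have "(\<Prod>e\<in>inner_edges M1. (edge_length M x e)\<^sup>2) = (\<Prod>e\<in>inner_edges M1. (edge_length M1 x e)\<^sup>2)"
    using inner1_not_M2(2) by (intro prod.cong refl) (auto simp: edge_length_M1)
  moreover have "(\<Prod>e\<in>inner_edges M2. (edge_length M x e)\<^sup>2) = (\<Prod>e\<in>inner_edges M2. (edge_length M2 x e)\<^sup>2)"
    using inner2_not_M1(2) by (intro prod.cong refl) (auto simp: edge_length_M2)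
  ultimately show ?thesis
    unfolding inner_edges_M using fin disj by (simp add: prod.union_disjoint)
qed

end

lemma gluing_glue:
  assumes "simplicial_poset3 M1" "simplicial_poset3 M2" "gluable M1 M2 \<Gamma>"
  shows "gluing (glue M1 M2) M1 M2 \<Gamma>"
proof
  show \<Gamma>: "\<Gamma> \<in> boundary_components M1" "\<Gamma> \<in> boundary_components M2"
    "cells M1 \<inter> cells M2 = \<Gamma>" "face M1 \<inter> (\<Gamma> \<times> \<Gamma>) = face M2 \<inter> (\<Gamma> \<times> \<Gamma>)"
    using assms(3) by (simp_all add: gluable_def)
  show "orient (glue M1 M2) t = orient M1 t" if "t \<in> tetrahedra M1" for t
    using that by (simp add: glue_def tetrahedra_def)
  show "orient (glue M1 M2) t = orient M2 t" if "t \<in> tetrahedra M2" for t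
  proof -
    have "t \<notin> \<Gamma>"
      using tetrahedron_not_boundary[OF assms(2) that] boundary_component_subset[OF \<Gamma>(2)] by blast
    then have "t \<notin> cells M1" using that \<Gamma>(3) by (auto simp: tetrahedra_def)
    then show ?thesis by (simp add: glue_def)
  qed
qed (use assms in \<open>simp_all add: glue_def\<close>)

theorem theorem4:
  fixes M M1 M2 :: "'c triangulation" and \<Gamma> :: "'c set" and x :: "'c \<Rightarrow> real^3"
    and B :: "'c set \<Rightarrow> 'c set" and Q1 Q2 :: "'c set"
    and R R1 R2 R\<Gamma> :: "'c basis_vector set"
  assumes "oriented_triangulated_manifold3 M1" and "oriented_triangulated_manifold3 M2"
    and "card (inner_vertices M1) \<ge> 3" and "card (inner_vertices M2) \<ge> 3"
    and "gluable M1 M2 \<Gamma>" and "M = glue M1 M2"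
    and "nondegenerate M1 x" and "nondegenerate M2 x"
    and "mrc_manifold M1 x Q1" and "mrc_manifold M2 x Q2"
    and "\<forall>k\<in>boundary_components M1. mrc_surface M1 x k (B k)"
    and "\<forall>k\<in>boundary_components M2. mrc_surface M2 x k (B k)"
    and "admissible_rows M x R" and "admissible_rows M1 x R1" and "admissible_rows M2 x R2"
    and "R\<Gamma> \<subseteq> surface_basis M \<Gamma>" and "card R\<Gamma> = 6" and "minor (f1 x) R\<Gamma> UNIV \<noteq> 0"
  shows "generating_function M x B (Q1 \<union> Q2 \<union> B \<Gamma>) R =
    (\<lambda>U. (-1) ^ card (vertices M \<inter> \<Gamma>) * (surface_torsion M x \<Gamma> (B \<Gamma>) R\<Gamma>)\<^sup>2 /
           (\<Prod>e\<in>edges M \<inter> \<Gamma>. (edge_length M x e)\<^sup>2) *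
         berezin_pairs (edges M \<inter> \<Gamma> - B \<Gamma>)
           (gr_mult (generating_function M1 x B Q1 R1) (generating_function M2 x B Q2 R2)) U)"
proof -
  have poset: "simplicial_poset3 M1" "simplicial_poset3 M2"
    and oriented: "tetrahedra_oriented M1" "tetrahedra_oriented M2"
    using assms(1,2)
    by (auto simp: oriented_triangulated_manifold3_def coherently_oriented_def tetrahedra_oriented_def)
  interpret gluing M M1 M2 \<Gamma>
    using gluing_glue[OF poset assms(5)] assms(6) by simp
  note x = oriented assms(7,8)
  have B: "mrc_surface M1 x \<Gamma> (B \<Gamma>)" using assms(11) \<Gamma>1 by blast
  have Q: "Q1 \<subseteq> inner_edges M1" "Q2 \<subseteq> inner_edges M2" "B \<Gamma> \<subseteq> edges M \<inter> \<Gamma>"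
    using assms(9,10) B edges_M by (auto simp: mrc_manifold_def mrc_surface_def)
  note torsion = torsion_sq_M[OF x assms(9,10) B assms(13-18)]
  show ?thesis
    unfolding generating_function_eq torsion prod_volume_M prod_edge_length_M
      berezin_pairs_M[where B = B, OF x Q] gr_mult_scale berezin_pairs_scale
    by (simp add: fun_eq_iff mult_ac)
qed

end
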